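(* Consider the Exponential-Inverse-Gamma prior model described in the context, with $0<d<1$ and a fixed matrix $\boldsymbol{\Sigma}$ with $0<\lambda_{\min}(\boldsymbol{\Sigma})\le\lambda_{\max}(\boldsymbol{\Sigma})<\infty$. Let $(q_n)$ be positive integers with $q_n=o(n)$, and let $c_n=(q_n/n)^{(1+\epsilon_n)/d}$ with $\epsilon_n=1/\log(\log(n/q_n))$ (for $n$ large). Then $$\lim_{n\to\infty}\ \sup_{\{\boldsymbol{\theta}_{0i}\}\in L_0[q_n]}\ \frac{\sum_{i:\boldsymbol{\theta}_{0i}=\boldsymbol{0}}E_{\boldsymbol{0}}\lVert\widehat{\boldsymbol{\theta}}^{EIG}_i\rVert_\Sigma^2}{q_n\log(n/q_n)}=0$$ and $$\limsup_{n\to\infty}\ \sup_{\{\boldsymbol{\theta}_{0i}\}\in L_0[q_n]}\ \frac{\sum_{i:\boldsymbol{\theta}_{0i}\neq\boldsymbol{0}}E_{\boldsymbol{\theta}_{0i}}\lVert\widehat{\boldsymbol{\theta}}^{EIG}_i-\boldsymbol{\theta}_{0i}\rVert_\Sigma^2}{2q_n\log(n/q_n)}\le 1.$$ Consequently, $$\lim_{n\to\infty}\ \sup_{\{\boldsymbol{\theta}_{0i}\}\in L_0[q_n]}\ \frac{\sum_{i=1}^nE_{\boldsymbol{\theta}_{0i}}\lVert\widehat{\boldsymbol{\theta}}^{EIG}_i-\boldsymbol{\theta}_{0i}\rVert_\Sigma^2}{2q_n\log(n/q_n)}=1.$$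
   Context: Exponential-Inverse-Gamma model (dimension $k\ge1$ fixed): $\boldsymbol{X}_i\mid\boldsymbol{\theta}_i\sim N_k(\boldsymbol{\theta}_i,\boldsymbol{\Sigma})$ independently, $i=1,\dots,n$, with $\boldsymbol{\Sigma}$ known positive definite; $\boldsymbol{\theta}_i\mid\lambda_i^2,\tau_i\sim N_k(\boldsymbol{0},\lambda_i^2\tau_i\boldsymbol{\Sigma})$ independently; all $\lambda_i^2$ and $\tau_i$, $i=1,\dots,n$, are mutually independent, with densities on $(0,\infty)$ $\pi(\lambda_i^2)\propto\exp(-\lambda_i^2/2)$ and $\pi(\tau_i)\propto\exp(-c_n/(2\tau_i))\,\tau_i^{-d-1}$, where $c_n>0$, $c_n\to0$ and $0<d<1$. The estimator is the posterior mean $\widehat{\boldsymbol{\theta}}^{EIG}_i=E(\boldsymbol{\theta}_i\mid\boldsymbol{X}_i)$. Mahalanobis norm: $\lVert\boldsymbol{x}\rVert_\Sigma^2=\boldsymbol{x}^T\boldsymbol{\Sigma}^{-1}\boldsymbol{x}$. Nearly-black means: $L_0[q_n]=\{\{\boldsymbol{\theta}_{0i}\}_{i=1}^n:\boldsymbol{\theta}_{0i}\in\mathbb{R}^k,\ \sum_{i=1}^n\mathbf{1}(\boldsymbol{\theta}_{0i}\ne\boldsymbol{0})\le q_n\}$. $E_{\boldsymbol{\theta}_{0i}}$ denotes expectation when $\boldsymbol{X}_i\sim N_k(\boldsymbol{\theta}_{0i},\boldsymbol{\Sigma})$. $\lambda_{\min},\lambda_{\max}$ are the smallest and largest eigenvalues.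 *)

theory Defs
  imports "HOL-Probability.Probability" "HOL-Library.Landau_Symbols"
begin

definition pos_def :: "real^'k^'k \<Rightarrow> bool" where
  "pos_def S \<longleftrightarrow> transpose S = S \<and> (\<forall>x. x \<noteq> 0 \<longrightarrow> x \<bullet> (S *v x) > 0)"

definition eigvals :: "real^'k^'k \<Rightarrow> real set" where
  "eigvals S = {l. \<exists>v. v \<noteq> 0 \<and> S *v v = l *\<^sub>R v}"

text \<open>The set of real eigenvalues is finite, and nonempty for symmetric matrices, so that
  \<open>Min\<close> and \<open>Max\<close> are meaningful below.\<close>

definition lambda_min :: "real^'k^'k \<Rightarrow> real" where
  "lambda_min S = Min (eigvals S)"

definition lambda_max :: "real^'k^'k \<Rightarrow> real" where
  "lambda_max S = Max (eigvals S)"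

definition mahal_sq :: "real^'k^'k \<Rightarrow> real^'k \<Rightarrow> real" where
  "mahal_sq S x = x \<bullet> (matrix_inv S *v x)"

definition mvn_density :: "real^'k \<Rightarrow> real^'k^'k \<Rightarrow> real^'k \<Rightarrow> real" where
  "mvn_density \<mu> S x =
     exp (- mahal_sq S (x - \<mu>) / 2) / sqrt ((2 * pi) ^ CARD('k) * det S)"

definition mvn :: "real^'k \<Rightarrow> real^'k^'k \<Rightarrow> (real^'k) measure" where
  "mvn \<mu> S = density lborel (\<lambda>x. ennreal (mvn_density \<mu> S x))"

text \<open>Inverse gamma density with shape \<open>a\<close> and scale \<open>b\<close>, proportional to
  \<open>exp (- b / t) * t powr (- a - 1)\<close> on the positive half-line.\<close>

definition inv_gamma_density :: "real \<Rightarrow> real \<Rightarrow> real \<Rightarrow> real" where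
  "inv_gamma_density a b t =
     (if t > 0 then b powr a / Gamma a * t powr (- a - 1) * exp (- b / t) else 0)"

text \<open>Joint law of the pair \<open>(\<lambda>\<^sup>2, \<tau>)\<close>.\<close>

definition EIG_scale_law :: "real \<Rightarrow> real \<Rightarrow> (real \<times> real) measure" where
  "EIG_scale_law d c =
     density lborel (\<lambda>l. ennreal (exponential_density (1/2) l)) \<Otimes>\<^sub>M
     density lborel (\<lambda>t. ennreal (inv_gamma_density d (c/2) t))"

text \<open>Prior law of a mean vector, with \<open>(\<lambda>\<^sup>2, \<tau>)\<close> integrated out. The event
  \<open>\<lambda>\<^sup>2 * \<tau> \<le> 0\<close>, where the covariance matrix is not positive definite, is null.\<close>

definition EIG_prior :: "real^'k^'k \<Rightarrow> real \<Rightarrow> real \<Rightarrow> (real^'k) measure" where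
  "EIG_prior S d c =
     density lborel
       (\<lambda>\<theta>. \<integral>\<^sup>+(l, t). ennreal (mvn_density 0 ((l * t) *\<^sub>R S) \<theta>) \<partial>EIG_scale_law d c)"

text \<open>Posterior law of the mean vector given the observation \<open>x\<close>, by Bayes' formula, and its mean. The
  prior has no first moment when \<open>d \<le> 1/2\<close>, hence the posterior mean is taken pointwise as the
  mean of the posterior law rather than as a conditional expectation of an integrable variable.\<close>

definition EIG_posterior ::
    "real^'k^'k \<Rightarrow> real \<Rightarrow> real \<Rightarrow> real^'k \<Rightarrow> (real^'k) measure" where
  "EIG_posterior S d c x =
     density (EIG_prior S d c)
       (\<lambda>\<theta>. ennreal (mvn_density \<theta> S x) /
            (\<integral>\<^sup>+\<theta>'. ennreal (mvn_density \<theta>' S x) \<partial>EIG_prior S d c))"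

definition EIG_estimator :: "real^'k^'k \<Rightarrow> real \<Rightarrow> real \<Rightarrow> real^'k \<Rightarrow> real^'k" where
  "EIG_estimator S d c x = (\<integral>\<theta>. \<theta> \<partial>EIG_posterior S d c x)"

text \<open>Expected squared error at the true mean \<open>\<theta>0\<close>. A Lebesgue integral with values in
  \<open>[0, \<infinity>]\<close>, so that no convention about non-integrable functions or unbounded suprema is involved.\<close>

definition EIG_risk :: "real^'k^'k \<Rightarrow> real \<Rightarrow> real \<Rightarrow> real^'k \<Rightarrow> ennreal" where
  "EIG_risk S d c \<theta>0 =
     (\<integral>\<^sup>+x. ennreal (mahal_sq S (EIG_estimator S d c x - \<theta>0)) \<partial>mvn \<theta>0 S)"

definition nearly_black :: "nat \<Rightarrow> nat \<Rightarrow> (nat \<Rightarrow> real^'k) set" where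
  "nearly_black n q =
     {\<theta> \<in> {1..n} \<rightarrow>\<^sub>E UNIV. (\<Sum>i=1..n. of_bool (\<theta> i \<noteq> 0)) \<le> q}"

end

theory Submission
  imports Defs "HOL-Real_Asymp.Real_Asymp"
begin

text \<open>Write \<open>u = \<lambda>\<^sup>2 * \<tau>\<close>. Since \<open>\<lambda>\<^sup>2\<close> is exponential and \<open>1 / \<tau>\<close> is gamma distributed, \<open>u\<close> has the density
\<open>(c + u) powr (- d - 1)\<close> up to a constant (\<open>nn_integral_EIG_scale_law\<close>). Given \<open>u\<close> the model is
conjugate, so the posterior mean is \<open>R s *\<^sub>R x\<close>, where \<open>s\<close> is the squared Mahalanobis norm of the observation
\<open>x\<close> and \<open>R s\<close> is the mean of \<open>u / (1 + u)\<close> under the posterior weight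
\<open>(1 + u) powr (- k / 2) * exp (- s / (2 * (1 + u))) * (c + u) powr (- d - 1)\<close>
(\<open>EIG_estimator_eq\<close>). The whole proof rests on two bounds for \<open>R\<close>.

First, \<open>R s\<close> is at most a constant times \<open>c powr d * exp (s / 2)\<close> (\<open>shrink_factor_upper\<close>): the prior puts
mass of order \<open>c powr (- d)\<close>, before normalisation, near \<open>u = 0\<close>, and the likelihood of a large \<open>u\<close>
exceeds that of \<open>u = 0\<close> by a factor \<open>exp (s / 2)\<close> at most. Secondly, once \<open>s\<close> is large and exceeds
\<open>2 * ln (c powr (- d))\<close> by a fixed factor, \<open>(1 - R s) * sqrt s\<close> is at most \<open>2\<close> (\<open>shrink_factor_bias\<close>). Hence the estimator acts like hard
thresholding of \<open>s\<close> at \<open>2 * ln (c powr (- d))\<close>, and the choice of \<open>c\<close> makes this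
\<open>2 * (L + L / ln L)\<close> with \<open>L = ln (n / q)\<close>.

At a zero mean, splitting the integral at \<open>s = 4 * L\<close> bounds the risk, up to a constant, by \<open>c powr d\<close> times a power of \<open>L\<close>, plus
\<open>exp (- 3 * L / 2)\<close>. Multiplied by \<open>n / q = exp L\<close> this is a power of \<open>L\<close> times
\<open>exp (- L / ln L)\<close>, up to a smaller term, and tends to \<open>0\<close>: this is where the correction \<open>1 / ln L\<close> in the exponent
is needed (\<open>EIG_zero_risk_rate\<close>).
At a nonzero mean the bias \<open>(1 - R s) * sqrt s\<close> is at most the square root of \<open>2 * (1 + h) * L\<close> for every \<open>s\<close>, so the risk
is at most \<open>2 * L * (1 + 4 * h)\<close> uniformly in the mean (\<open>EIG_nonzero_risk_rate\<close>). Conversely, a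
mean whose squared norm is \<open>2 * (1 - h) * L\<close> lies below the threshold: its observations are shrunk to nearly \<open>0\<close>
with high probability, and the risk is almost the squared norm of the mean (\<open>EIG_worst_risk_rate\<close>).
Placing \<open>q\<close> copies of such a mean gives the lower bound in the last claim; the upper bound is the sum
of the first two claims.\<close>

section \<open>Linear changes of variables for Lebesgue measure\<close>

lemma borel_measurable_vec_nth [measurable (raw)]:
  "f \<in> borel_measurable M \<Longrightarrow> (\<lambda>x. (f x :: real^'k) $ i) \<in> borel_measurable M"
  by (rule measurable_compose[of f M borel "\<lambda>v. v $ i"])
     (auto intro: borel_measurable_continuous_onI continuous_intros)

lemma nn_integral_lborel_translate:
  fixes f :: "'a::euclidean_space \<Rightarrow> ennreal"
  assumes [measurable]: "f \<in> borel_measurable borel"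
  shows "(\<integral>\<^sup>+x. f (a + x) \<partial>lborel) = (\<integral>\<^sup>+x. f x \<partial>lborel)"
proof -
  have "(\<integral>\<^sup>+x. f x \<partial>lborel) = (\<integral>\<^sup>+x. f x \<partial>distr lborel borel ((+) a))"
    by (simp add: lborel_distr_plus)
  also have "\<dots> = (\<integral>\<^sup>+x. f (a + x) \<partial>lborel)"
    by (subst nn_integral_distr) auto
  finally show ?thesis by simp
qed

lemma nn_integral_lborel_scale:
  fixes f :: "'a::euclidean_space \<Rightarrow> ennreal"
  assumes [measurable]: "f \<in> borel_measurable borel" and "c \<noteq> 0"
  shows "(\<integral>\<^sup>+x. f x \<partial>lborel) = ennreal (\<bar>c\<bar> ^ DIM('a)) * (\<integral>\<^sup>+x. f (c *\<^sub>R x) \<partial>lborel)"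
proof -
  have "(lborel :: 'a measure) = density (distr lborel borel (\<lambda>x. 0 + c *\<^sub>R x)) (\<lambda>_. ennreal (\<bar>c\<bar> ^ DIM('a)))"
    using lborel_affine[OF assms(2), of "0::'a"] by simp
  then have "(\<integral>\<^sup>+x. f x \<partial>lborel) = (\<integral>\<^sup>+x. f x \<partial>density (distr lborel borel (\<lambda>x. 0 + c *\<^sub>R x)) (\<lambda>_. ennreal (\<bar>c\<bar> ^ DIM('a))))"
    by (rule arg_cong)
  also have "\<dots> = ennreal (\<bar>c\<bar> ^ DIM('a)) * (\<integral>\<^sup>+x. f (c *\<^sub>R x) \<partial>lborel)"
    by (simp add: nn_integral_density nn_integral_distr nn_integral_cmult)
  finally show ?thesis .
qed

text \<open>Weight the integrand by the indicator of a unit interval in coordinate \<open>m\<close>, moved by \<open>t\<close>, and integrate over \<open>t\<close>.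
After a translation along \<open>axis m 1\<close> the variable \<open>t\<close> absorbs the shear, so that the sheared and the
plain integral become the same double integral. Only translation invariance and Tonelli's theorem enter.\<close>

lemma nn_integral_lborel_shear:
  fixes g :: "real^'k \<Rightarrow> ennreal"
  assumes [measurable]: "g \<in> borel_measurable borel" and mn: "m \<noteq> n"
  shows "(\<integral>\<^sup>+x. g (x + x$n *\<^sub>R axis m 1) \<partial>lborel) = (\<integral>\<^sup>+x. g x \<partial>lborel)"
proof -
  define W :: "real \<Rightarrow> ennreal" where "W = indicator {0..1}"
  have [measurable]: "W \<in> borel_measurable borel" by (simp add: W_def)
  have W1: "(\<integral>\<^sup>+t. W (a + t) \<partial>lborel) = 1" for a
    by (subst nn_integral_lborel_translate) (auto simp: W_def)
  have key: "(\<integral>\<^sup>+x. g (x + (h * x$n) *\<^sub>R axis m 1) \<partial>lborel)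
      = (\<integral>\<^sup>+x. W (x$m) * (\<integral>\<^sup>+t. g (x + t *\<^sub>R axis m 1) \<partial>lborel) \<partial>lborel)" for h :: real
  proof -
    have "(\<integral>\<^sup>+x. g (x + (h * x$n) *\<^sub>R axis m 1) \<partial>lborel)
        = (\<integral>\<^sup>+x. (\<integral>\<^sup>+t. W (x$m + t) * g (x + (h * x$n) *\<^sub>R axis m 1) \<partial>lborel) \<partial>lborel)"
      by (simp add: nn_integral_multc W1)
    also have "\<dots> = (\<integral>\<^sup>+t. (\<integral>\<^sup>+x. W (x$m + t) * g (x + (h * x$n) *\<^sub>R axis m 1) \<partial>lborel) \<partial>lborel)"
      by (rule lborel_pair.Fubini'[symmetric]) measurable
    also have "\<dots> = (\<integral>\<^sup>+t. (\<integral>\<^sup>+x. W (x$m) * g (x + (h * x$n - t) *\<^sub>R axis m 1) \<partial>lborel) \<partial>lborel)"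
    proof (rule nn_integral_cong, goal_cases)
      case (1 t)
      have "(\<integral>\<^sup>+x. W (x$m + t) * g (x + (h * x$n) *\<^sub>R axis m 1) \<partial>lborel)
        = (\<integral>\<^sup>+x. W ((-t *\<^sub>R axis m 1 + x)$m + t) * g ((-t *\<^sub>R axis m 1 + x) + (h * (-t *\<^sub>R axis m 1 + x)$n) *\<^sub>R axis m 1) \<partial>lborel)"
        by (rule nn_integral_lborel_translate[symmetric]) measurable
      also have "\<dots> = (\<integral>\<^sup>+x. W (x$m) * g (x + (h * x$n - t) *\<^sub>R axis m 1) \<partial>lborel)"
        using mn by (intro nn_integral_cong) (simp add: axis_def algebra_simps)
      finally show ?case .
    qed
    also have "\<dots> = (\<integral>\<^sup>+x. (\<integral>\<^sup>+t. W (x$m) * g (x + (h * x$n - t) *\<^sub>R axis m 1) \<partial>lborel) \<partial>lborel)"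
      by (rule lborel_pair.Fubini') measurable
    also have "\<dots> = (\<integral>\<^sup>+x. W (x$m) * (\<integral>\<^sup>+t. g (x + t *\<^sub>R axis m 1) \<partial>lborel) \<partial>lborel)"
    proof (rule nn_integral_cong, goal_cases)
      case (1 x)
      have "(\<integral>\<^sup>+t. g (x + t *\<^sub>R axis m 1) \<partial>lborel) = (\<integral>\<^sup>+t. g (x + (h * x$n + (-1) *\<^sub>R t) *\<^sub>R axis m 1) \<partial>lborel)"
        by (subst nn_integral_lborel_translate[of _ "h * x$n", symmetric], measurable)
           (subst nn_integral_lborel_scale[where c="-1"], auto)
      then show ?case by (simp add: nn_integral_cmult)
    qed
    finally show ?thesis .
  qed
  from key[of 1] key[of 0] show ?thesis by simp
qed

lemma lborel_permute_coords:
  fixes p :: "'k \<Rightarrow> 'k::finite"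
  assumes "p permutes UNIV"
  shows "distr lborel borel (\<lambda>x::real^'k. \<chi> i. x $ p i) = lborel"
proof (rule lborel_eqI[symmetric])
  fix l u :: "real^'k" assume le: "\<And>b. b \<in> Basis \<Longrightarrow> l \<bullet> b \<le> u \<bullet> b"
  then have le': "l $ i \<le> u $ i" for i
    using le[of "axis i 1"] by (auto simp: inner_axis axis_in_Basis_iff)
  let ?h = "\<lambda>x::real^'k. \<chi> i. x $ p i" and ?h' = "\<lambda>x::real^'k. \<chi> i. x $ inv p i"
  have [measurable]: "?h \<in> borel_measurable borel"
    by (intro borel_measurable_continuous_onI continuous_intros)
  have pp: "p (inv p i) = i" "inv p (p i) = i" for i
    using assms permutes_inverses by fastforce+
  have "?h -` box l u = box (?h' l) (?h' u)"
    by (auto simp: mem_box_cart pp) (metis pp)+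
  moreover have "(\<Prod>i\<in>UNIV. (u - l) $ inv p i) = (\<Prod>i\<in>UNIV. (u - l) $ i)"
    using prod.permute[OF permutes_inv[OF assms], of "\<lambda>i. (u - l) $ i"] by (simp add: o_def)
  ultimately show "emeasure (distr lborel borel ?h) (box l u) = ennreal (\<Prod>b\<in>Basis. (u - l) \<bullet> b)"
    using le' by (simp add: emeasure_distr emeasure_lborel_box_eq Basis_vec_def prod.UNION_disjoint
        inner_axis axis_eq_axis)
qed simp

text \<open>The change of variables formula for invertible linear maps over an arbitrary finite index type, by decomposition of the map into
diagonal maps, transpositions of coordinates and shears.\<close>

lemma nn_integral_lborel_linear:
  fixes f :: "real^'k \<Rightarrow> real^'k" and g :: "real^'k \<Rightarrow> ennreal"
  assumes "linear f" and "g \<in> borel_measurable borel" and "det (matrix f) \<noteq> 0"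
  shows "(\<integral>\<^sup>+x. g x \<partial>lborel) = ennreal \<bar>det (matrix f)\<bar> * (\<integral>\<^sup>+x. g (f x) \<partial>lborel)"
proof -
  define good where "good f \<longleftrightarrow> (det (matrix f) \<noteq> 0 \<longrightarrow> (\<forall>g \<in> borel_measurable borel.
      (\<integral>\<^sup>+x. g x \<partial>lborel) = ennreal \<bar>det (matrix f)\<bar> * (\<integral>\<^sup>+x. g (f x) \<partial>lborel)))"
    for f :: "real^'k \<Rightarrow> real^'k"
  have "good f"
    using assms(1)
  proof (rule induct_linear_elementary)
    fix f1 f2 :: "real^'k \<Rightarrow> real^'k"
    assume lin: "linear f1" "linear f2"
      and I: "good f1" "good f2"
    have [measurable]: "f1 \<in> borel_measurable borel"
      using lin(1) by (intro borel_measurable_continuous_onI linear_continuous_on) (simp add: linear_linear)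
    have D: "det (matrix (f1 \<circ> f2)) = det (matrix f1) * det (matrix f2)"
      using matrix_compose[OF lin(2) lin(1)] by (simp add: det_mul)
    show "good (f1 \<circ> f2)"
      unfolding good_def
    proof (intro impI ballI)
      fix g :: "real^'k \<Rightarrow> ennreal" assume [measurable]: "g \<in> borel_measurable borel"
      assume "det (matrix (f1 \<circ> f2)) \<noteq> 0"
      then have nz: "det (matrix f1) \<noteq> 0" "det (matrix f2) \<noteq> 0" by (auto simp: D)
      have "(\<integral>\<^sup>+x. g x \<partial>lborel) = ennreal \<bar>det (matrix f1)\<bar> * (\<integral>\<^sup>+x. g (f1 x) \<partial>lborel)"
        by (rule I(1)[unfolded good_def, THEN mp, OF nz(1), THEN bspec]) measurable
      also have "(\<integral>\<^sup>+x. g (f1 x) \<partial>lborel) = ennreal \<bar>det (matrix f2)\<bar> * (\<integral>\<^sup>+x. g (f1 (f2 x)) \<partial>lborel)"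
        by (rule I(2)[unfolded good_def, THEN mp, OF nz(2), THEN bspec, of "\<lambda>x. g (f1 x)"]) measurable
      finally show "(\<integral>\<^sup>+x. g x \<partial>lborel) = ennreal \<bar>det (matrix (f1 \<circ> f2))\<bar> * (\<integral>\<^sup>+x. g ((f1 \<circ> f2) x) \<partial>lborel)"
        by (simp add: D abs_mult ennreal_mult mult_ac)
    qed
  next
    fix f :: "real^'k \<Rightarrow> real^'k" and i
    assume "linear f" and 0: "\<And>x. f x $ i = 0"
    then have "\<not> inj f"
      by (metis (full_types) linear_injective_imp_surjective one_neq_zero surjE vec_component)
    then have "det (matrix f) = 0"
      using det_nz_iff_inj[OF \<open>linear f\<close>] by blast
    then show "good f"
      by (simp add: good_def)
  next
    fix c :: "'k \<Rightarrow> real"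
    let ?f = "\<lambda>x::real^'k. \<chi> i. c i * x $ i"
    have D: "det (matrix ?f) = prod c UNIV"
      by (simp add: axis_def matrix_def det_diagonal)
    have [measurable]: "?f \<in> borel_measurable borel"
      by (intro borel_measurable_continuous_onI continuous_intros)
    show "good ?f"
      unfolding good_def
    proof (intro impI ballI)
      fix g :: "real^'k \<Rightarrow> ennreal" assume [measurable]: "g \<in> borel_measurable borel"
      assume "det (matrix ?f) \<noteq> 0"
      then have nz: "c i \<noteq> 0" for i by (auto simp: D)
      define c' :: "real^'k \<Rightarrow> real" where "c' b = (\<chi> i. c i) \<bullet> b" for b
      have c'_axis: "c' (axis i 1) = c i" for i by (simp add: c'_def inner_axis)
      have T: "0 + (\<Sum>j\<in>Basis. (c' j * (x \<bullet> j)) *\<^sub>R j) = ?f x" for x :: "real^'k"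
        by (simp add: Basis_vec_def sum.UNION_disjoint axis_eq_axis c'_axis inner_axis)
           (simp add: vec_eq_iff axis_def if_distrib sum.delta cong: if_cong)
      have P: "(\<Prod>j\<in>Basis. \<bar>c' j\<bar>) = \<bar>prod c UNIV\<bar>"
        by (simp add: Basis_vec_def prod.UNION_disjoint axis_eq_axis c'_axis abs_prod)
      have "(lborel :: (real^'k) measure) = density (distr lborel borel ?f) (\<lambda>_. ennreal \<bar>prod c UNIV\<bar>)"
      proof -
        have nz': "c' j \<noteq> 0" if "j \<in> Basis" for j
          using that nz by (auto simp: Basis_vec_def c'_axis)
        show ?thesis
          using lborel_affine_euclidean[of c' "0::real^'k", OF nz'] unfolding T P .
      qed
      then have "(\<integral>\<^sup>+x. g x \<partial>lborel) = (\<integral>\<^sup>+x. g x \<partial>density (distr lborel borel ?f) (\<lambda>_. ennreal \<bar>prod c UNIV\<bar>))"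
        by (rule arg_cong)
      then show "(\<integral>\<^sup>+x. g x \<partial>lborel) = ennreal \<bar>det (matrix ?f)\<bar> * (\<integral>\<^sup>+x. g (?f x) \<partial>lborel)"
        by (simp add: nn_integral_density nn_integral_distr nn_integral_cmult D)
    qed
  next
    fix m n :: 'k assume "m \<noteq> n"
    let ?f = "\<lambda>x::real^'k. \<chi> i. x $ Transposition.transpose m n i"
    have "(\<chi> i j. if Transposition.transpose m n i = j then 1 else 0) = (\<chi> i j. if j = Transposition.transpose m n i then 1 else (0::real))"
      by (auto intro!: Cart_lambda_cong)
    then have "matrix ?f = transpose (\<chi> i j. mat 1 $ i $ Transposition.transpose m n j)"
      by (auto simp: matrix_eq transpose_def axis_def mat_def matrix_def)
    then have D: "\<bar>det (matrix ?f)\<bar> = 1"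
      by (simp add: det_permute_columns permutes_swap_id sign_swap_id abs_mult)
    have [measurable]: "?f \<in> borel_measurable borel"
      by (intro borel_measurable_continuous_onI continuous_intros)
    show "good ?f"
      unfolding good_def
    proof (intro impI ballI)
      fix g :: "real^'k \<Rightarrow> ennreal" assume [measurable]: "g \<in> borel_measurable borel"
      have "(\<integral>\<^sup>+x. g x \<partial>lborel) = (\<integral>\<^sup>+x. g x \<partial>distr lborel borel ?f)"
        by (simp add: lborel_permute_coords permutes_swap_id)
      then show "(\<integral>\<^sup>+x. g x \<partial>lborel) = ennreal \<bar>det (matrix ?f)\<bar> * (\<integral>\<^sup>+x. g (?f x) \<partial>lborel)"
        by (simp add: D nn_integral_distr)
    qed
  next
    fix m n :: 'k assume mn: "m \<noteq> n"
    let ?f = "\<lambda>x::real^'k. \<chi> i. if i = m then x $ m + x $ n else x $ i"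
    have f: "?f x = x + x$n *\<^sub>R axis m 1" for x
      by (auto simp: vec_eq_iff axis_def)
    have "matrix ?f = (\<chi> k. if k = m then row m (mat 1) + 1 *s row n (mat 1) else row k (mat 1))"
      by (auto simp: matrix_def row_def vec_eq_iff axis_def mat_def)
    then have D: "det (matrix ?f) = 1"
      using det_row_operation[OF mn, of "mat 1" 1] by simp
    show "good ?f"
      unfolding good_def D unfolding f using nn_integral_lborel_shear[OF _ mn] by simp
  qed
  with assms show ?thesis by (simp add: good_def)
qed

section \<open>Whitening and Gaussian integrals\<close>

text \<open>Gram-Schmidt for the inner product defined by \<open>S\<close>, one vector at a time.\<close>

lemma pos_def_orthonormal_set:
  fixes S :: "real^'k^'k"
  assumes S: "pos_def S" and "n \<le> CARD('k)"
  shows "\<exists>F. finite F \<and> card F = n \<and> (\<forall>a\<in>F. \<forall>b\<in>F. a \<bullet> (S *v b) = of_bool (a = b))"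
  using assms(2)
proof (induction n)
  case 0
  show ?case by (rule exI[of _ "{}"]) simp
next
  case (Suc n)
  then obtain F where F: "finite F" "card F = n"
    and orth: "\<And>a b. a \<in> F \<Longrightarrow> b \<in> F \<Longrightarrow> a \<bullet> (S *v b) = of_bool (a = b)" by auto
  have sym: "a \<bullet> (S *v b) = b \<bullet> (S *v a)" for a b
    using S dot_lmul_matrix[of a S b] transpose_matrix_vector[of S a]
    by (simp add: pos_def_def inner_commute)
  have "dim (span F) < DIM(real^'k)"
    using dim_le_card'[of F] F Suc.prems by simp
  then have "span F \<noteq> UNIV" by (metis dim_UNIV less_irrefl)
  then obtain v where v: "v \<notin> span F" by auto
  define w where "w = v - (\<Sum>a\<in>F. (a \<bullet> (S *v v)) *\<^sub>R a)"
  have "w \<noteq> 0"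
  proof
    assume "w = 0"
    then have "v = (\<Sum>a\<in>F. (a \<bullet> (S *v v)) *\<^sub>R a)" by (simp add: w_def)
    also have "\<dots> \<in> span F" by (intro span_sum span_scale span_base)
    finally show False using v by simp
  qed
  then have wp: "w \<bullet> (S *v w) > 0" using S by (simp add: pos_def_def)
  have wF: "a \<bullet> (S *v w) = 0" if "a \<in> F" for a
  proof -
    have "a \<bullet> (S *v w) = w \<bullet> (S *v a)" by (rule sym)
    also have "\<dots> = v \<bullet> (S *v a) - (\<Sum>b\<in>F. (b \<bullet> (S *v v)) * (b \<bullet> (S *v a)))"
      by (simp add: w_def inner_diff_left inner_sum_left)
    also have "(\<Sum>b\<in>F. (b \<bullet> (S *v v)) * (b \<bullet> (S *v a))) = (\<Sum>b\<in>F. if b = a then a \<bullet> (S *v v) else 0)"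
      using that by (intro sum.cong) (auto simp: orth)
    also have "\<dots> = v \<bullet> (S *v a)" using that F(1) sym[of a v] by simp
    finally show ?thesis by simp
  qed
  define u where "u = (1 / sqrt (w \<bullet> (S *v w))) *\<^sub>R w"
  have uu: "u \<bullet> (S *v u) = 1"
    using wp by (simp add: u_def matrix_vector_mult_scaleR)
  have uF: "a \<bullet> (S *v u) = 0" "u \<bullet> (S *v a) = 0" if "a \<in> F" for a
    using wF[OF that] sym[of a w] by (auto simp: u_def matrix_vector_mult_scaleR)
  have "u \<notin> F" using uu uF(1) by force
  have "a \<bullet> (S *v b) = of_bool (a = b)" if "a \<in> insert u F" "b \<in> insert u F" for a b
    using that \<open>u \<notin> F\<close> orth[of a b] uu uF by (cases "a = u"; cases "b = u") auto
  with F \<open>u \<notin> F\<close> show ?case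
    by (intro exI[of _ "insert u F"]) simp
qed

lemma matrix_inv_eqI:
  fixes A :: "real^'k^'k"
  assumes "B ** A = mat 1"
  shows "matrix_inv A = B"
proof -
  have AB: "A ** B = mat 1" using assms matrix_left_right_inverse by blast
  have inv: "A ** matrix_inv A = mat 1 \<and> matrix_inv A ** A = mat 1"
    unfolding matrix_inv_def by (rule someI[of _ B]) (use assms AB in auto)
  then have "matrix_inv A = B ** (A ** matrix_inv A)"
    using assms by (subst matrix_mul_assoc) simp
  also have "\<dots> = B" using inv by simp
  finally show ?thesis .
qed

text \<open>The rows of \<open>B\<close> are orthonormal for the inner product defined by \<open>S\<close>, so \<open>B\<close> turns the Mahalanobis norm into the
Euclidean norm. The determinant identity supplies the normalising constant of the Gaussian density.\<close>

lemma pos_def_whitening: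
  fixes S :: "real^'k^'k"
  assumes S: "pos_def S"
  obtains B :: "real^'k^'k" where "B ** S ** transpose B = mat 1" "matrix_inv S = transpose B ** B"
    "\<And>x. mahal_sq S x = (norm (B *v x))\<^sup>2" "(det B)\<^sup>2 * det S = 1"
proof -
  obtain F :: "(real^'k) set" where F: "finite F" "card F = CARD('k)"
    and orth: "\<And>a b. a \<in> F \<Longrightarrow> b \<in> F \<Longrightarrow> a \<bullet> (S *v b) = of_bool (a = b)"
    using pos_def_orthonormal_set[OF S order_refl] by auto
  obtain h where h: "bij_betw h (UNIV :: 'k set) F"
    using F finite_same_card_bij[of "UNIV :: 'k set" F] by auto
  define B :: "real^'k^'k" where "B = (\<chi> i. h i)"
  have "(B ** S ** transpose B) $ i $ j = (mat 1 :: real^'k^'k) $ i $ j" for i j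
  proof -
    have "(B ** S ** transpose B) $ i $ j = (B ** (S ** transpose B)) $ i $ j"
      by (simp add: matrix_mul_assoc)
    also have "\<dots> = h i \<bullet> (S *v h j)"
      by (simp add: B_def matrix_matrix_mult_def inner_vec_def matrix_vector_mult_def transpose_def
          del: matrix_mult_transpose_dot_column)
    also have "\<dots> = of_bool (i = j)"
      using orth[of "h i" "h j"] h by (auto simp: bij_betw_def inj_on_eq_iff)
    finally show ?thesis by (simp add: mat_def)
  qed
  then have 1: "B ** S ** transpose B = mat 1" by (simp add: vec_eq_iff)
  then have "transpose B ** (B ** S) = mat 1" using matrix_left_right_inverse by blast
  then have "(transpose B ** B) ** S = mat 1" by (simp add: matrix_mul_assoc)
  then have 2: "matrix_inv S = transpose B ** B" by (rule matrix_inv_eqI)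
  have 3: "mahal_sq S x = (norm (B *v x))\<^sup>2" for x
  proof -
    have "mahal_sq S x = x \<bullet> (transpose B *v (B *v x))"
      by (simp add: mahal_sq_def 2 matrix_vector_mul_assoc)
    also have "\<dots> = (B *v x) \<bullet> (B *v x)"
      using dot_lmul_matrix[of x "transpose B" "B *v x"] by (simp add: vector_transpose_matrix)
    finally show ?thesis by (simp add: power2_norm_eq_inner)
  qed
  have "det (B ** S ** transpose B) = 1" using 1 by simp
  then have 4: "(det B)\<^sup>2 * det S = 1" by (simp add: det_mul power2_eq_square mult_ac)
  show ?thesis using that[OF 1 2 3 4] .
qed

lemma nn_integral_gaussian_std:
  "(\<integral>\<^sup>+x. ennreal (exp (- (norm (x :: real^'k))\<^sup>2 / 2)) \<partial>lborel) = ennreal (sqrt ((2 * pi) ^ CARD('k)))"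
proof -
  have 1: "(\<integral>\<^sup>+x. ennreal (exp (- x\<^sup>2 / 2)) \<partial>lborel) = ennreal (sqrt (2 * pi))"
  proof -
    have "(\<integral>\<^sup>+x. ennreal (exp (- x\<^sup>2 / 2)) \<partial>lborel) = (\<integral>\<^sup>+x. ennreal (sqrt (2 * pi)) * ennreal (std_normal_density x) \<partial>lborel)"
      by (intro nn_integral_cong) (simp add: std_normal_density_def ennreal_mult[symmetric])
    also have "\<dots> = ennreal (sqrt (2 * pi))"
      by (simp add: nn_integral_cmult nn_integral_eq_integral)
    finally show ?thesis .
  qed
  have "(\<integral>\<^sup>+x. ennreal (exp (- (norm (x :: real^'k))\<^sup>2 / 2)) \<partial>lborel)
      = (\<integral>\<^sup>+(x :: real^'k). (\<Prod>b\<in>Basis. ennreal (exp (- (x \<bullet> b)\<^sup>2 / 2))) \<partial>lborel)"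
  proof (rule nn_integral_cong)
    fix x :: "real^'k"
    have "exp (- (norm x)\<^sup>2 / 2) = (\<Prod>b\<in>Basis. exp (- (x \<bullet> b)\<^sup>2 / 2))"
      by (simp add: exp_sum[symmetric] sum_negf sum_divide_distrib[symmetric] norm_eq_sqrt_inner
          euclidean_inner[of x x] power2_eq_square[symmetric] sum_nonneg)
    then show "ennreal (exp (- (norm x)\<^sup>2 / 2)) = (\<Prod>b\<in>Basis. ennreal (exp (- (x \<bullet> b)\<^sup>2 / 2)))"
      by (simp add: prod_ennreal)
  qed
  also have "\<dots> = (\<Prod>b\<in>(Basis :: (real^'k) set). (\<integral>\<^sup>+x. ennreal (exp (- x\<^sup>2 / 2)) \<partial>lborel))"
    by (rule nn_integral_lborel_prod) auto
  also have "\<dots> = ennreal (sqrt ((2 * pi) ^ CARD('k)))"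
    by (simp only: 1 prod_constant ennreal_power[OF real_sqrt_ge_zero] real_sqrt_power DIM_cart DIM_real)
      (simp add: ennreal_power)
  finally show ?thesis .
qed

text \<open>Gaussian integrals at all scales \<open>v\<close>: besides the normalisation of the densities, varying \<open>v\<close> yields the exponential moments
from which every expectation below is bounded.\<close>

lemma nn_integral_gaussian_mahal:
  fixes S :: "real^'k^'k"
  assumes S: "pos_def S" and v: "v > 0"
  shows "(\<integral>\<^sup>+x. ennreal (exp (- mahal_sq S (x - a) / (2 * v))) \<partial>lborel)
    = ennreal (sqrt v ^ CARD('k) * sqrt ((2 * pi) ^ CARD('k) * det S))"
proof -
  from pos_def_whitening[OF S] obtain B :: "real^'k^'k" where
    B: "\<And>x. mahal_sq S x = (norm (B *v x))\<^sup>2" and D: "(det B)\<^sup>2 * det S = 1" by metis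
  have nz: "det B \<noteq> 0" using D by auto
  have DS: "sqrt (det S) = 1 / \<bar>det B\<bar>"
  proof -
    have "det S = 1 / (det B)\<^sup>2" using D nz by (simp add: field_simps)
    then show ?thesis by (simp add: real_sqrt_divide)
  qed
  have [measurable]: "(\<lambda>x. B *v x) \<in> borel_measurable borel"
    by (intro borel_measurable_continuous_onI matrix_vector_mult_linear_continuous_on)
  have "ennreal (\<bar>det B\<bar>) * (\<integral>\<^sup>+x. ennreal (exp (- mahal_sq S (x - a) / (2 * v))) \<partial>lborel)
      = ennreal (\<bar>det B\<bar>) * (\<integral>\<^sup>+x. ennreal (exp (- (norm (B *v (- a + x)))\<^sup>2 / (2 * v))) \<partial>lborel)"
    by (simp add: B)
  also have "\<dots> = ennreal (\<bar>det B\<bar>) * (\<integral>\<^sup>+x. ennreal (exp (- (norm (B *v x))\<^sup>2 / (2 * v))) \<partial>lborel)"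
    by (subst nn_integral_lborel_translate) auto
  also have "\<dots> = (\<integral>\<^sup>+x. ennreal (exp (- (norm (x :: real^'k))\<^sup>2 / (2 * v))) \<partial>lborel)"
    using nn_integral_lborel_linear[OF matrix_vector_mul_linear[of B],
        of "\<lambda>x. ennreal (exp (- (norm x)\<^sup>2 / (2 * v)))"] nz by simp
  also have "\<dots> = ennreal (sqrt v ^ CARD('k)) * (\<integral>\<^sup>+x. ennreal (exp (- (norm (x :: real^'k))\<^sup>2 / 2)) \<partial>lborel)"
    using v by (subst nn_integral_lborel_scale[where c = "sqrt v"]) (auto simp: power_mult_distrib)
  also have "\<dots> = ennreal (sqrt v ^ CARD('k) * sqrt ((2 * pi) ^ CARD('k)))"
    using v by (simp only: nn_integral_gaussian_std) (simp add: ennreal_mult)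
  finally have "ennreal (1 / \<bar>det B\<bar>) * (ennreal \<bar>det B\<bar> * (\<integral>\<^sup>+x. ennreal (exp (- mahal_sq S (x - a) / (2 * v))) \<partial>lborel))
     = ennreal (1 / \<bar>det B\<bar>) * ennreal (sqrt v ^ CARD('k) * sqrt ((2 * pi) ^ CARD('k)))" by simp
  then have "(\<integral>\<^sup>+x. ennreal (exp (- mahal_sq S (x - a) / (2 * v))) \<partial>lborel)
     = ennreal (1 / \<bar>det B\<bar>) * ennreal (sqrt v ^ CARD('k) * sqrt ((2 * pi) ^ CARD('k)))"
    unfolding mult.assoc[symmetric] using nz by (subst (asm) ennreal_mult[symmetric]) auto
  also have "\<dots> = ennreal (1 / \<bar>det B\<bar> * (sqrt v ^ CARD('k) * sqrt ((2 * pi) ^ CARD('k))))"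
    using v by (subst ennreal_mult) auto
  also have "1 / \<bar>det B\<bar> * (sqrt v ^ CARD('k) * sqrt ((2 * pi) ^ CARD('k)))
      = sqrt v ^ CARD('k) * sqrt ((2 * pi) ^ CARD('k) * det S)"
    by (simp only: real_sqrt_mult DS) simp
  finally show ?thesis .
qed

section \<open>The shrinkage factor\<close>

text \<open>The Lomax density of the product of the two scales, without its normalising constant, which cancels in the posterior.\<close>

definition scale_weight :: "real \<Rightarrow> real \<Rightarrow> real \<Rightarrow> real" where
  "scale_weight d c u = (c + u) powr (- d - 1)"

text \<open>The scale weight times the marginal likelihood of the observation given the product \<open>u\<close> of the scales, which is normal with
covariance \<open>(1 + u) *\<^sub>R S\<close>. The dimension \<open>k\<close> and the squared Mahalanobis norm \<open>s\<close> of the observation are all that remains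
of the multivariate problem.\<close>

definition post_weight :: "real \<Rightarrow> real \<Rightarrow> real \<Rightarrow> real \<Rightarrow> real \<Rightarrow> real" where
  "post_weight k d c s u = (1 + u) powr (- k / 2) * exp (- s / (2 * (1 + u))) * scale_weight d c u"

definition shrink_factor :: "real \<Rightarrow> real \<Rightarrow> real \<Rightarrow> real \<Rightarrow> real" where
  "shrink_factor k d c s =
     (LINT u:{0<..}|lborel. u / (1 + u) * post_weight k d c s u) /
     (LINT u:{0<..}|lborel. post_weight k d c s u)"

lemma scale_weight_nonneg [simp]: "0 \<le> scale_weight d c u"
  by (simp add: scale_weight_def)

lemma post_weight_nonneg [simp]: "0 \<le> post_weight k d c s u"
  by (simp add: post_weight_def)

lemma measurable_scale_weight [measurable]: "scale_weight d c \<in> borel_measurable borel"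
  unfolding scale_weight_def by measurable

lemma measurable_post_weight [measurable]: "post_weight k d c s \<in> borel_measurable borel"
  unfolding post_weight_def by measurable

lemma DERIV_shifted_powr:
  fixes c x p :: real
  assumes "0 < c + x" "p \<noteq> 0"
  shows "DERIV (\<lambda>u. (c + u) powr p / p) x :> (c + x) powr (p - 1)"
proof -
  have "((\<lambda>u. (c + u) powr p) has_real_derivative p * (c + x) powr (p - 1) * 1) (at x)"
    by (rule DERIV_chain2[where f = "\<lambda>z. z powr p" and g = "\<lambda>u. c + u",
          OF has_real_derivative_powr[OF assms(1)]]) (auto intro!: derivative_eq_intros)
  from DERIV_cdivide[OF this, of p] show ?thesis using assms(2) by simp
qed

lemma scale_weight_tail:
  assumes "0 < d" "0 < c + a"
  shows "set_integrable lborel {a..} (scale_weight d c)"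
    and "(LINT u:{a..}|lborel. scale_weight d c u) = (c + a) powr (- d) / d"
proof -
  have "(\<integral>\<^sup>+u. ennreal (scale_weight d c u) * indicator {a..} u \<partial>lborel) = ennreal (0 - (- ((c + a) powr (- d) / d)))"
  proof (rule nn_integral_FTC_atLeast)
    show "((\<lambda>u. - ((c + u) powr (- d) / d)) \<longlongrightarrow> 0) at_top"
      using assms by real_asymp
    show "DERIV (\<lambda>u. - ((c + u) powr (- d) / d)) x :> scale_weight d c x" if "a \<le> x" for x
      using DERIV_shifted_powr[of c x "-d"] assms that
      by (simp add: scale_weight_def)
  qed auto
  then have "has_bochner_integral lborel (\<lambda>u. indicator {a..} u * scale_weight d c u) ((c + a) powr (- d) / d)"
    using assms by (intro has_bochner_integral_nn_integral)
      (auto simp: ennreal_mult ennreal_indicator mult.commute)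
  then show "set_integrable lborel {a..} (scale_weight d c)"
    and "(LINT u:{a..}|lborel. scale_weight d c u) = (c + a) powr (- d) / d"
    by (auto simp: has_bochner_integral_iff set_integrable_def set_lebesgue_integral_def)
qed

lemma scale_weight_unit:
  assumes "0 < d" "0 < c"
  shows "set_integrable lborel {0..1} (scale_weight d c)"
    and "(LINT u:{0..1}|lborel. scale_weight d c u) = (c powr (- d) - (c + 1) powr (- d)) / d"
proof -
  have "has_bochner_integral lborel (\<lambda>u. scale_weight d c u * indicator {0..1} u)
     ((- ((c + 1) powr (- d) / d)) - (- ((c + 0) powr (- d) / d)))"
  proof (rule has_bochner_integral_FTC_Icc_nonneg)
    show "DERIV (\<lambda>u. - ((c + u) powr (- d) / d)) x :> scale_weight d c x" if "x \<in> {0..1}" for x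
      using DERIV_shifted_powr[of c x "-d"] assms that
      by (simp add: scale_weight_def)
  qed auto
  then show "set_integrable lborel {0..1} (scale_weight d c)"
    and "(LINT u:{0..1}|lborel. scale_weight d c u) = (c powr (- d) - (c + 1) powr (- d)) / d"
    by (auto simp: has_bochner_integral_iff set_integrable_def set_lebesgue_integral_def diff_divide_distrib mult.commute)
qed

lemma powr_unit_integral:
  fixes c d :: real
  assumes "0 < d" "d < 1" "0 < c"
  shows "set_integrable lborel {0..1} (\<lambda>u. (c + u) powr (- d))"
    and "(LINT u:{0..1}|lborel. (c + u) powr (- d)) \<le> (1 + c) / (1 - d)"
proof -
  have "has_bochner_integral lborel (\<lambda>u. (c + u) powr (- d) * indicator {0..1} u)
     ((c + 1) powr (1 - d) / (1 - d) - (c + 0) powr (1 - d) / (1 - d))"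
  proof (rule has_bochner_integral_FTC_Icc_nonneg)
    show "DERIV (\<lambda>u. (c + u) powr (1 - d) / (1 - d)) x :> (c + x) powr (- d)" if "x \<in> {0..1}" for x
      using DERIV_shifted_powr[of c x "1-d"] assms that by simp
  qed auto
  then have I: "set_integrable lborel {0..1} (\<lambda>u. (c + u) powr (- d))"
    "(LINT u:{0..1}|lborel. (c + u) powr (- d)) = ((c + 1) powr (1 - d) - c powr (1 - d)) / (1 - d)"
    by (auto simp: has_bochner_integral_iff set_integrable_def set_lebesgue_integral_def diff_divide_distrib mult.commute)
  show "set_integrable lborel {0..1} (\<lambda>u. (c + u) powr (- d))" by (rule I)
  have "(c + 1) powr (1 - d) \<le> (c + 1) powr 1"
    using assms by (intro powr_mono) auto
  moreover have "0 \<le> c powr (1 - d)" by simp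
  ultimately have "(c + 1) powr (1 - d) - c powr (1 - d) \<le> 1 + c" using assms(3) by (simp del: powr_ge_zero)
  then show "(LINT u:{0..1}|lborel. (c + u) powr (- d)) \<le> (1 + c) / (1 - d)"
    unfolding I(2) using assms by (intro divide_right_mono) auto
qed

lemma post_weight_le_scale_weight:
  assumes "0 \<le> k" "0 \<le> s" "0 < u"
  shows "post_weight k d c s u \<le> scale_weight d c u"
proof -
  have "(1 + u) powr (- k / 2) \<le> 1"
    using assms powr_mono[of "-k/2" 0 "1 + u"] by simp
  moreover have "exp (- s / (2 * (1 + u))) \<le> 1" using assms by simp
  ultimately have "(1 + u) powr (- k / 2) * exp (- s / (2 * (1 + u))) \<le> 1"
    by (intro mult_le_one) auto
  then show ?thesis unfolding post_weight_def by (intro mult_left_le_one_le) auto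
qed

lemma post_weight_integrable:
  assumes "0 < d" "0 < c" "0 \<le> k" "0 \<le> s"
  shows "set_integrable lborel {0<..} (post_weight k d c s)"
proof (rule set_integrable_bound)
  show "set_integrable lborel {0<..} (scale_weight d c)"
    by (rule set_integrable_subset[OF scale_weight_tail(1)[of d c 0]]) (use assms in auto)
  show "AE u in lborel. u \<in> {0<..} \<longrightarrow> norm (post_weight k d c s u) \<le> norm (scale_weight d c u)"
    using post_weight_le_scale_weight assms by auto
qed (simp add: set_borel_measurable_def)

lemma post_weight_mult_integrable:
  assumes "0 < d" "0 < c" "0 \<le> k" "0 \<le> s" and [measurable]: "h \<in> borel_measurable borel"
    and "\<And>u. 0 < u \<Longrightarrow> \<bar>h u\<bar> \<le> 1"
  shows "set_integrable lborel {0<..} (\<lambda>u. h u * post_weight k d c s u)"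
proof (rule set_integrable_bound)
  show "set_integrable lborel {0<..} (post_weight k d c s)"
    by (rule post_weight_integrable[OF assms(1-4)])
  show "AE u in lborel. u \<in> {0<..} \<longrightarrow> norm (h u * post_weight k d c s u) \<le> norm (post_weight k d c s u)"
    using assms(6) by (auto simp: abs_mult intro!: mult_left_le_one_le)
qed (simp add: set_borel_measurable_def)

lemma post_weight_mass_lower:
  assumes "0 < d" "0 < c" "0 \<le> k" "0 \<le> s"
  shows "2 powr (- k / 2) * exp (- s / 2) * ((c powr (- d) - (c + 1) powr (- d)) / d)
    \<le> (LINT u:{0<..}|lborel. post_weight k d c s u)"
proof -
  let ?C = "2 powr (- k / 2) * exp (- s / 2)"
  have "?C * ((c powr (- d) - (c + 1) powr (- d)) / d) = (LINT u:{0..1}|lborel. ?C * scale_weight d c u)"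
    using scale_weight_unit[OF assms(1,2)] by simp
  also have "\<dots> = (LINT u:{0<..1}|lborel. ?C * scale_weight d c u)"
    unfolding set_lebesgue_integral_def
    by (intro integral_cong_AE) (auto intro!: AE_I[where N="{0}"] simp: indicator_def)
  also have "\<dots> \<le> (LINT u:{0<..1}|lborel. post_weight k d c s u)"
  proof (rule set_integral_mono)
    show "set_integrable lborel {0<..1} (\<lambda>u. ?C * scale_weight d c u)"
      by (intro set_integrable_mult_right set_integrable_subset[OF scale_weight_unit(1)[OF assms(1,2)]]) auto
    show "set_integrable lborel {0<..1} (post_weight k d c s)"
      by (rule set_integrable_subset[OF post_weight_integrable[OF assms]]) auto
    fix u :: real assume u: "u \<in> {0<..1}"
    have "2 powr (- k / 2) \<le> (1 + u) powr (- k / 2)"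
      using u assms by (intro powr_mono2') auto
    moreover have "s / (2 * (1 + u)) \<le> s / 2"
      using u assms by (intro divide_left_mono) auto
    ultimately show "?C * scale_weight d c u \<le> post_weight k d c s u"
      unfolding post_weight_def by (intro mult_right_mono mult_mono) auto
  qed
  also have "\<dots> \<le> (LINT u:{0<..}|lborel. post_weight k d c s u)"
    using post_weight_integrable[OF assms]
      set_integrable_subset[OF post_weight_integrable[OF assms], of "{0<..1}", simplified subset_eq, simplified]
    unfolding set_lebesgue_integral_def set_integrable_def
    by (intro integral_mono) (auto simp: indicator_def)
  finally show ?thesis .
qed

lemma post_weight_mass_pos:
  assumes "0 < d" "0 < c" "0 \<le> k" "0 \<le> s"
  shows "0 < (LINT u:{0<..}|lborel. post_weight k d c s u)"
proof -
  have "(c + 1) powr (- d) < c powr (- d)"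
    using assms by (intro powr_less_mono2_neg) auto
  then have "0 < 2 powr (- k / 2) * exp (- s / 2) * ((c powr (- d) - (c + 1) powr (- d)) / d)"
    using assms by simp
  also note post_weight_mass_lower[OF assms]
  finally show ?thesis .
qed

lemma shrink_factor_bounds:
  assumes "0 < d" "0 < c" "0 \<le> k" "0 \<le> s"
  shows "0 \<le> shrink_factor k d c s" "shrink_factor k d c s \<le> 1"
proof -
  note I = post_weight_integrable[OF assms] and pos = post_weight_mass_pos[OF assms]
  have "0 \<le> (LINT u:{0<..}|lborel. u / (1 + u) * post_weight k d c s u)"
    unfolding set_lebesgue_integral_def by (intro integral_nonneg_AE) (auto simp: indicator_def)
  then show "0 \<le> shrink_factor k d c s" using pos by (simp add: shrink_factor_def)
  have "(LINT u:{0<..}|lborel. u / (1 + u) * post_weight k d c s u) \<le> (LINT u:{0<..}|lborel. post_weight k d c s u)"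
    by (intro set_integral_mono post_weight_mult_integrable[OF assms] I)
       (auto intro!: mult_left_le_one_le simp del: times_divide_eq_left)
  then show "shrink_factor k d c s \<le> 1" using pos by (simp add: shrink_factor_def)
qed

lemma one_minus_shrink_factor:
  assumes "0 < d" "0 < c" "0 \<le> k" "0 \<le> s"
  shows "1 - shrink_factor k d c s =
     (LINT u:{0<..}|lborel. 1 / (1 + u) * post_weight k d c s u) /
     (LINT u:{0<..}|lborel. post_weight k d c s u)"
proof -
  note I = post_weight_integrable[OF assms] and pos = post_weight_mass_pos[OF assms]
  have "(LINT u:{0<..}|lborel. 1 / (1 + u) * post_weight k d c s u)
      = (LINT u:{0<..}|lborel. post_weight k d c s u - u / (1 + u) * post_weight k d c s u)"
    by (intro set_lebesgue_integral_cong) (auto simp: field_simps)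
  also have "\<dots> = (LINT u:{0<..}|lborel. post_weight k d c s u)
        - (LINT u:{0<..}|lborel. u / (1 + u) * post_weight k d c s u)"
    by (intro set_integral_diff I post_weight_mult_integrable[OF assms]) auto
  finally show ?thesis using pos by (simp add: shrink_factor_def field_simps)
qed

text \<open>The numerator is bounded uniformly in \<open>c\<close>, because \<open>u * (c + u) powr (- d - 1)\<close> is integrable near \<open>0\<close> when
\<open>d < 1\<close>, while the denominator is of order \<open>c powr (- d) * exp (- s / 2)\<close> already on the unit interval.\<close>

lemma shrink_factor_upper:
  assumes "0 < d" "d < 1" "0 \<le> k"
  obtains C where "0 < C" "\<And>c s. 0 < c \<Longrightarrow> c \<le> 1 \<Longrightarrow> 0 \<le> s \<Longrightarrow>
    shrink_factor k d c s \<le> C * (c powr d * exp (s / 2))"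
proof -
  define N where "N = 2 / (1 - d) + 1 / d"
  define E where "E = 2 powr (- k / 2) * (1 - 2 powr (- d)) / d"
  have two: "2 powr (- d) < 1" using assms(1) by (simp add: powr_less_one)
  have Np: "N > 0" and Ep: "E > 0"
    using assms two by (auto simp: N_def E_def add_pos_pos)
  have "shrink_factor k d c s \<le> N / E * (c powr d * exp (s / 2))" if c: "0 < c" "c \<le> 1" and s: "0 \<le> s" for c s
  proof -
    note A = assms(1) c(1) assms(3) s
    note pu = powr_unit_integral[OF assms(1,2) c(1)] and st = scale_weight_tail[OF assms(1), of c 1]
    have bnd: "indicator {0<..} u * (u / (1 + u) * post_weight k d c s u)
        \<le> indicator {0..1} u * (c + u) powr (- d) + indicator {1..} u * scale_weight d c u" for u :: real
    proof (cases "u > 0")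
      case True
      have le: "u / (1 + u) * post_weight k d c s u \<le> u / (1 + u) * scale_weight d c u"
        using post_weight_le_scale_weight[OF assms(3) s True] True by (intro mult_left_mono) auto
      show ?thesis
      proof (cases "u \<le> 1")
        case T1: True
        have "u / (1 + u) \<le> c + u"
          using True c by (simp add: field_simps)
        then have "u / (1 + u) * scale_weight d c u \<le> (c + u) * scale_weight d c u"
          by (intro mult_right_mono) auto
        also have "\<dots> = (c + u) powr (- d)"
          using True c powr_add[of "c + u" 1 "-d-1"] by (simp add: scale_weight_def)
        finally have "u / (1 + u) * post_weight k d c s u \<le> (c + u) powr (- d)"
          using le by linarith
        then show ?thesis using True T1 by (auto simp: indicator_def add_increasing2)
      next
        case False
        have "u / (1 + u) * scale_weight d c u \<le> scale_weight d c u"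
          using True by (intro mult_left_le_one_le) auto
        with le have "u / (1 + u) * post_weight k d c s u \<le> scale_weight d c u" by linarith
        then show ?thesis using True False by (simp add: indicator_def)
      qed
    qed (simp add: indicator_def)
    have "(LINT u:{0<..}|lborel. u / (1 + u) * post_weight k d c s u)
       \<le> (LINT u|lborel. indicator {0..1} u * (c + u) powr (- d) + indicator {1..} u * scale_weight d c u)"
      unfolding set_lebesgue_integral_def real_scaleR_def
      using pu(1) st(1) c bnd post_weight_mult_integrable[OF A, of "\<lambda>u. u / (1 + u)"]
      by (intro integral_mono) (auto simp: set_integrable_def)
    also have "\<dots> = (LINT u:{0..1}|lborel. (c + u) powr (- d)) + (LINT u:{1..}|lborel. scale_weight d c u)"
      using pu(1) st(1) c by (simp add: set_integrable_def set_lebesgue_integral_def)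
    also have "\<dots> \<le> N"
    proof -
      have "(c + 1) powr (- d) \<le> 1" using c assms powr_mono[of "-d" 0 "c + 1"] by simp
      then have "(LINT u:{1..}|lborel. scale_weight d c u) \<le> 1 / d"
        using st assms c by (simp add: divide_right_mono)
      moreover have "(1 + c) / (1 - d) \<le> 2 / (1 - d)" using c assms by (intro divide_right_mono) auto
      ultimately show ?thesis using pu(2) by (simp add: N_def)
    qed
    finally have num: "(LINT u:{0<..}|lborel. u / (1 + u) * post_weight k d c s u) \<le> N" .
    have "(c + 1) powr (- d) \<le> (2 * c) powr (- d)"
      using c assms by (intro powr_mono2') auto
    also have "\<dots> = 2 powr (- d) * c powr (- d)" using c by (simp add: powr_mult)
    finally have "c powr (- d) * (1 - 2 powr (- d)) \<le> c powr (- d) - (c + 1) powr (- d)"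
      by (simp add: algebra_simps)
    then have "2 powr (- k / 2) * exp (- s / 2) * (c powr (- d) * (1 - 2 powr (- d)) / d)
      \<le> 2 powr (- k / 2) * exp (- s / 2) * ((c powr (- d) - (c + 1) powr (- d)) / d)"
      using assms by (intro mult_left_mono divide_right_mono) auto
    also note post_weight_mass_lower[OF A]
    finally have den: "E * (c powr (- d) * exp (- s / 2)) \<le> (LINT u:{0<..}|lborel. post_weight k d c s u)"
      by (simp add: E_def mult_ac)
    have "shrink_factor k d c s \<le> N / (E * (c powr (- d) * exp (- s / 2)))"
      unfolding shrink_factor_def using num den Np Ep c
      by (intro frac_le) auto
    also have "\<dots> = N / E * (c powr d * exp (s / 2))"
      by (simp add: powr_minus exp_minus field_simps)
    finally show ?thesis .
  qed
  with that[of "N / E"] Np Ep show ?thesis by simp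
qed

text \<open>For \<open>u\<close> between \<open>s\<close> and \<open>2 * s\<close> the exponential factor is bounded below, so that the mass decays only
polynomially in \<open>s\<close>.\<close>

lemma post_weight_mass_lower_far:
  assumes "0 < d" "0 < c" "c \<le> 1" "0 \<le> k" "1 \<le> s"
  shows "s * ((3 * s) powr (- k / 2 - d - 1) * exp (- 1 / 2))
    \<le> (LINT u:{0<..}|lborel. post_weight k d c s u)"
proof -
  have s0: "0 \<le> s" using assms by simp
  note I = post_weight_integrable[OF assms(1,2,4) s0]
  have "s * ((3 * s) powr (- k / 2 - d - 1) * exp (- 1 / 2))
     = (LINT u:{s..2 * s}|lborel. (3 * s) powr (- k / 2 - d - 1) * exp (- 1 / 2))"
    using s0 by (simp add: set_lebesgue_integral_def)
  also have "\<dots> \<le> (LINT u:{0<..}|lborel. post_weight k d c s u)"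
    unfolding set_lebesgue_integral_def real_scaleR_def
  proof (rule integral_mono)
    show "integrable lborel (\<lambda>u. indicator {s..2 * s} u * ((3 * s) powr (- k / 2 - d - 1) * exp (- 1 / 2)))"
      by (rule integrable_mult_left, rule integrable_real_indicator) (auto simp: emeasure_lborel_Icc_eq)
    show "integrable lborel (\<lambda>u. indicator {0<..} u * post_weight k d c s u)"
      using I by (simp add: set_integrable_def)
    fix u :: real
    show "indicator {s..2 * s} u * ((3 * s) powr (- k / 2 - d - 1) * exp (- 1 / 2))
        \<le> indicator {0<..} u * post_weight k d c s u"
    proof (cases "u \<in> {s..2 * s}")
      case True
      then have u: "s \<le> u" "u \<le> 2 * s" by auto
      have "(3 * s) powr (- k / 2) \<le> (1 + u) powr (- k / 2)"
        using u assms by (intro powr_mono2') auto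
      moreover have "(3 * s) powr (- d - 1) \<le> scale_weight d c u"
        unfolding scale_weight_def using u assms by (intro powr_mono2') auto
      moreover have "exp (- 1 / 2) \<le> exp (- s / (2 * (1 + u)))"
        using u assms by (simp add: field_simps)
      ultimately have "(3 * s) powr (- k / 2) * exp (- 1 / 2) * (3 * s) powr (- d - 1) \<le> post_weight k d c s u"
        unfolding post_weight_def by (intro mult_mono) auto
      moreover have "(3 * s) powr (- k / 2) * (3 * s) powr (- d - 1) = (3 * s) powr (- k / 2 - d - 1)"
      proof -
        have e: "- k / 2 - d - 1 = - k / 2 + (- d - 1)" by simp
        show ?thesis by (simp only: e powr_add)
      qed
      ultimately show ?thesis using True assms by (simp add: mult_ac)
    qed simp
  qed
  finally show ?thesis .
qed

text \<open>The hypothesis on \<open>c\<close> says that the likelihood gain \<open>exp (s / 2)\<close> beats the prior mass \<open>c powr (- d)\<close> near \<open>0\<close> by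
the factor \<open>exp (\<gamma> * s / 2)\<close>. The posterior mass below a constant \<open>U\<close>, and that between \<open>U\<close> and \<open>sqrt s\<close>, are then exponentially small in
\<open>s\<close> and in \<open>sqrt s\<close> respectively, which outweighs the polynomial lower bound on the total mass. Above \<open>sqrt s\<close> the factor \<open>1 / (1 + u)\<close> is at most
\<open>1 / sqrt s\<close>.\<close>

lemma shrink_factor_bias:
  assumes "0 < d" "0 \<le> k" "0 < \<gamma>" "\<gamma> \<le> 1"
  obtains s0 where "1 \<le> s0"
    "\<And>c s. 0 < c \<Longrightarrow> c \<le> 1 \<Longrightarrow> s0 \<le> s \<Longrightarrow> c powr (- d) \<le> exp ((1 - \<gamma>) * s / 2) \<Longrightarrow>
      (1 - shrink_factor k d c s) * sqrt s \<le> 2"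
proof -
  \<comment> \<open>chosen such that \<open>exp (- s / (2 * (1 + U)))\<close> times \<open>c powr (- d)\<close> is at most \<open>exp (- \<gamma> * s / 4)\<close>\<close>
  define U where "U = \<gamma> / (2 - \<gamma>)"
  have U: "0 < U" "1 / (1 + U) = 1 - \<gamma> / 2" using assms by (auto simp: U_def field_simps)
  define V where "V = U powr (- d)"
  have V: "0 \<le> V" by (simp add: V_def)
  define A where "A s = exp (- \<gamma> * s / 4) / d + exp (- sqrt s / 4) * V / d" for s
  define D where "D s = s * ((3 * s) powr (- k / 2 - d - 1) * exp (- 1 / 2))" for s :: real
  \<comment> \<open>\<open>A s\<close> bounds the mass below \<open>sqrt s\<close> and \<open>D s\<close> the total mass from below\<close>
  have "((\<lambda>s. sqrt s * (exp (- \<gamma> * s / 4) / d / D s)) \<longlongrightarrow> 0) at_top"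
    unfolding D_def using assms by real_asymp
  moreover have "((\<lambda>s. sqrt s * (exp (- sqrt s / 4) / D s)) \<longlongrightarrow> 0) at_top"
    unfolding D_def using assms by real_asymp
  ultimately have "((\<lambda>s. sqrt s * (exp (- \<gamma> * s / 4) / d / D s) + sqrt s * (exp (- sqrt s / 4) / D s) * (V / d))
      \<longlongrightarrow> 0 + 0 * (V / d)) at_top"
    by (intro tendsto_intros)
  then have "((\<lambda>s. sqrt s * (A s / D s)) \<longlongrightarrow> 0) at_top"
    by (simp add: A_def add_divide_distrib distrib_left mult_ac)
  then have "\<forall>\<^sub>F s in at_top. sqrt s * (A s / D s) < 1"
    by (rule order_tendstoD) simp
  then obtain s1 where s1: "\<And>s. s1 \<le> s \<Longrightarrow> sqrt s * (A s / D s) < 1"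
    by (auto simp: eventually_at_top_linorder)
  have main: "(1 - shrink_factor k d c s) * sqrt s \<le> 2"
    if c: "0 < c" "c \<le> 1" and s: "max 1 s1 \<le> s" and cd: "c powr (- d) \<le> exp ((1 - \<gamma>) * s / 2)" for c s
  proof -
    have s0: "1 \<le> s" "0 \<le> s" and sq: "1 \<le> sqrt s" using s by auto
    note A4 = assms(1) c(1) assms(2) s0(2)
    note I = post_weight_integrable[OF A4] and st0 = scale_weight_tail[OF assms(1), of c 0, simplified, OF c(1)]
    have stU: "set_integrable lborel {U..} (scale_weight d c)"
      "(LINT u:{U..}|lborel. scale_weight d c u) = (c + U) powr (- d) / d"
      using scale_weight_tail[OF assms(1), of c U] U c by auto
    define P where "P = (LINT u:{0<..}|lborel. post_weight k d c s u)"
    define a where "a = exp (- s * (1 - \<gamma> / 2) / 2)"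
    define b where "b = exp (- sqrt s / 4)"
    \<comment> \<open>the three terms dominate the integrand for \<open>u \<le> U\<close>, for \<open>U < u \<le> sqrt s\<close> and for \<open>sqrt s < u\<close>\<close>
    have bnd: "indicator {0<..} u * (1 / (1 + u) * post_weight k d c s u)
      \<le> a * (indicator {0..} u * scale_weight d c u) + b * (indicator {U..} u * scale_weight d c u)
         + 1 / sqrt s * (indicator {0<..} u * post_weight k d c s u)" for u
    proof (cases "u > 0")
      case u: True
      have crude: "1 / (1 + u) * post_weight k d c s u \<le> exp (- s / (2 * (1 + u))) * scale_weight d c u"
      proof -
        have "(1 + u) powr (- k / 2) \<le> 1"
          using u assms powr_mono[of "-k/2" 0 "1 + u"] by simp
        then have "1 / (1 + u) * (1 + u) powr (- k / 2) \<le> 1"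
          using u by (intro mult_le_one) auto
        then have "1 / (1 + u) * (1 + u) powr (- k / 2) * (exp (- s / (2 * (1 + u))) * scale_weight d c u)
            \<le> exp (- s / (2 * (1 + u))) * scale_weight d c u"
          using u by (intro mult_left_le_one_le) auto
        then show ?thesis by (simp add: post_weight_def mult_ac)
      qed
      consider "u \<le> U" | "U < u" "u \<le> sqrt s" | "U < u" "sqrt s < u" by linarith
      then show ?thesis
      proof cases
        case 1
        have "s * (1 / (1 + U)) \<le> s * (1 / (1 + u))"
          using 1 u s0 by (intro mult_left_mono divide_left_mono) auto
        then have "exp (- s / (2 * (1 + u))) \<le> a"
        proof -
          have "- s / (2 * (1 + u)) = - (s * (1 / (1 + u)) / 2)" "- s * (1 - \<gamma> / 2) / 2 = - (s * (1 - \<gamma> / 2) / 2)"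
            by simp_all
          moreover have "s * (1 - \<gamma> / 2) / 2 \<le> s * (1 / (1 + u)) / 2"
            using \<open>s * (1 / (1 + U)) \<le> _\<close> by (simp only: U(2) divide_right_mono zero_le_numeral)
          ultimately show ?thesis unfolding a_def exp_le_cancel_iff by (simp only: neg_le_iff_le)
        qed
        then have "exp (- s / (2 * (1 + u))) * scale_weight d c u \<le> a * scale_weight d c u"
          by (intro mult_right_mono) auto
        with crude have "1 / (1 + u) * post_weight k d c s u \<le> a * scale_weight d c u" by linarith
        moreover have "0 \<le> b * (indicator {U..} u * scale_weight d c u)" "0 \<le> 1 / sqrt s * post_weight k d c s u"
          using s0 by (auto simp: b_def)
        ultimately show ?thesis using u by simp
      next
        case 2
        have "2 * (1 + u) \<le> 2 * (sqrt s + sqrt s)"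
          using 2(2) sq by (intro mult_left_mono add_mono) auto
        then have "2 * (1 + u) \<le> 4 * sqrt s" by simp
        then have "sqrt s * (2 * (1 + u)) \<le> sqrt s * (4 * sqrt s)"
          using s0 by (intro mult_left_mono) auto
        also have "\<dots> = 4 * s" using s0 by simp
        finally have "sqrt s / 4 \<le> s / (2 * (1 + u))"
          using u by (simp add: field_simps)
        then have "exp (- s / (2 * (1 + u))) \<le> b"
          unfolding b_def by simp
        then have "exp (- s / (2 * (1 + u))) * scale_weight d c u \<le> b * scale_weight d c u"
          by (intro mult_right_mono) auto
        with crude have "1 / (1 + u) * post_weight k d c s u \<le> b * scale_weight d c u" by linarith
        moreover have "0 \<le> a * scale_weight d c u" "0 \<le> 1 / sqrt s * post_weight k d c s u"
          using s0 by (auto simp: a_def)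
        ultimately show ?thesis using u 2 by simp
      next
        case 3
        have "1 / (1 + u) \<le> 1 / sqrt s" using 3 u s0 by (intro divide_left_mono mult_pos_pos) auto
        then have "1 / (1 + u) * post_weight k d c s u \<le> 1 / sqrt s * post_weight k d c s u"
          by (intro mult_right_mono) auto
        moreover have "0 \<le> a * scale_weight d c u" "0 \<le> b * scale_weight d c u"
          by (auto simp: a_def b_def)
        ultimately show ?thesis using u 3 by simp
      qed
    qed (auto simp: a_def b_def indicator_def)
    have "(LINT u:{0<..}|lborel. 1 / (1 + u) * post_weight k d c s u)
       \<le> (LINT u|lborel. a * (indicator {0..} u * scale_weight d c u) + b * (indicator {U..} u * scale_weight d c u)
         + 1 / sqrt s * (indicator {0<..} u * post_weight k d c s u))"
      unfolding set_lebesgue_integral_def real_scaleR_def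
    proof (rule integral_mono[OF _ _ bnd])
      show "integrable lborel (\<lambda>u. indicator {0<..} u * (1 / (1 + u) * post_weight k d c s u))"
        using post_weight_mult_integrable[OF A4, of "\<lambda>u. 1 / (1 + u)"] by (simp add: set_integrable_def)
      show "integrable lborel (\<lambda>u. a * (indicator {0..} u * scale_weight d c u) + b * (indicator {U..} u * scale_weight d c u)
         + 1 / sqrt s * (indicator {0<..} u * post_weight k d c s u))"
        using st0(1) stU(1) I unfolding set_integrable_def real_scaleR_def
        by (intro Bochner_Integration.integrable_add integrable_mult_right)
    qed
    also have "\<dots> = a * (LINT u:{0..}|lborel. scale_weight d c u) + b * (LINT u:{U..}|lborel. scale_weight d c u) + 1 / sqrt s * P"
    proof -
      have lin: "(LINT u|lborel. a * f u + b * g u + r * h u) = a * integral\<^sup>L lborel f + b * integral\<^sup>L lborel g + r * integral\<^sup>L lborel h"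
        if "integrable lborel f" "integrable lborel g" "integrable lborel h" for f g h :: "real \<Rightarrow> real" and r
        using that by simp
      show ?thesis
        using st0(1) stU(1) I unfolding set_integrable_def real_scaleR_def P_def set_lebesgue_integral_def by (rule lin)
    qed
    also have "\<dots> \<le> A s + 1 / sqrt s * P"
    proof -
      have "a * c powr (- d) \<le> a * exp ((1 - \<gamma>) * s / 2)"
        using cd by (intro mult_left_mono) (auto simp: a_def)
      also have "\<dots> = exp (- \<gamma> * s / 4)"
        by (simp add: a_def exp_add[symmetric]) (simp add: field_simps)
      finally have "a * (c powr (- d) / d) \<le> exp (- \<gamma> * s / 4) / d"
        using assms(1) by (simp add: divide_right_mono)
      moreover have "(c + U) powr (- d) \<le> V"
        unfolding V_def using c U assms(1) by (intro powr_mono2') auto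
      then have "b * ((c + U) powr (- d) / d) \<le> exp (- sqrt s / 4) * V / d"
        using assms(1) by (simp add: b_def divide_right_mono)
      ultimately show ?thesis using st0 stU by (simp add: A_def)
    qed
    finally have num: "(LINT u:{0<..}|lborel. 1 / (1 + u) * post_weight k d c s u) \<le> A s + 1 / sqrt s * P" .
    have P: "0 < P" "D s \<le> P"
      using post_weight_mass_pos[OF A4] post_weight_mass_lower_far[OF assms(1) c assms(2) s0(1)]
      by (auto simp: P_def D_def)
    have Dp: "0 < D s" using s0 by (simp add: D_def)
    have Ap: "0 \<le> A s" using assms(1) V by (simp add: A_def)
    have "1 - shrink_factor k d c s \<le> (A s + 1 / sqrt s * P) / P"
      unfolding one_minus_shrink_factor[OF A4] P_def[symmetric]
      using num P by (intro divide_right_mono) auto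
    also have "\<dots> = A s / P + 1 / sqrt s" using P by (simp add: field_simps)
    also have "\<dots> \<le> A s / D s + 1 / sqrt s"
      using P Dp Ap by (intro add_right_mono divide_left_mono) auto
    finally have "(1 - shrink_factor k d c s) * sqrt s \<le> (A s / D s + 1 / sqrt s) * sqrt s"
      using sq by (intro mult_right_mono) auto
    also have "\<dots> = sqrt s * (A s / D s) + 1"
      using sq s0 by (simp add: field_simps)
    also have "\<dots> \<le> 2" using s1[of s] s by auto
    finally show ?thesis .
  qed
  show ?thesis by (rule that[of "max 1 s1"]) (use main in auto)
qed

section \<open>The law of the product of the two scales\<close>

lemma powr_exp_bounded:
  fixes a :: real
  assumes "0 \<le> a"
  obtains M where "0 \<le> M" "\<And>z. 0 < z \<Longrightarrow> z powr a * exp (- z / 2) \<le> M"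
proof -
  have "((\<lambda>z::real. z powr a * exp (- z / 2)) \<longlongrightarrow> 0) at_top" by real_asymp
  then have "\<forall>\<^sub>F z in at_top. z powr a * exp (- z / 2) < 1" by (rule order_tendstoD) simp
  then obtain z0 where z0: "\<And>z. z0 \<le> z \<Longrightarrow> z powr a * exp (- z / 2) < 1"
    by (auto simp: eventually_at_top_linorder)
  have "z powr a * exp (- z / 2) \<le> max 1 (z0 powr a)" if "0 < z" for z
  proof (cases "z0 \<le> z")
    case False
    then have "z powr a \<le> z0 powr a" using that assms by (intro powr_mono2) auto
    moreover have "z powr a * exp (- z / 2) \<le> z powr a * 1" using that by (intro mult_left_mono) auto
    ultimately show ?thesis by linarith
  qed (use z0[of z] in linarith)
  then show ?thesis by (intro that[of "max 1 (z0 powr a)"]) auto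
qed

text \<open>The dependence on \<open>b\<close> follows by scaling. The constant \<open>J\<close> cancels in the posterior, so its value, which is
\<open>Gamma (d + 1) * 2 powr (d + 1)\<close>, need not be computed.\<close>

lemma inverse_gamma_mass:
  fixes d :: real
  assumes "0 < d"
  obtains J where "0 < J"
    "\<And>b. 0 < b \<Longrightarrow> (\<integral>\<^sup>+t. ennreal (indicator {0<..} t * (t powr (- d - 2) * exp (- b / (2 * t)))) \<partial>lborel)
       = ennreal (J * b powr (- d - 1))"
proof -
  define I where "I b = (\<integral>\<^sup>+t. ennreal (indicator {0<..} t * (t powr (- d - 2) * exp (- b / (2 * t)))) \<partial>lborel)" for b :: real
  obtain M where M: "0 \<le> M" "\<And>z. 0 < z \<Longrightarrow> z powr (d + 2) * exp (- z / 2) \<le> M"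
    using powr_exp_bounded[of "d + 2"] assms by auto
  have "I 1 \<le> (\<integral>\<^sup>+t. ennreal (M * indicator {0..1} t + indicator {1..} t * scale_weight d 0 t) \<partial>lborel)"
    unfolding I_def
  proof (intro nn_integral_mono ennreal_leI)
    fix t :: real
    consider "t \<le> 0" | "0 < t" "t < 1" | "1 \<le> t" by linarith
    then show "indicator {0<..} t * (t powr (- d - 2) * exp (- 1 / (2 * t)))
       \<le> M * indicator {0..1} t + indicator {1..} t * scale_weight d 0 t"
    proof cases
      case 2
      have "(1 / t) powr (d + 2) * exp (- (1 / t) / 2) \<le> M" using 2 by (intro M) auto
      moreover have "(1 / t) powr (d + 2) = t powr (- d - 2)"
        using 2 by (simp add: powr_divide powr_minus_divide[symmetric])
      ultimately show ?thesis using 2 by (simp add: mult.commute)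
    next
      case 3
      have "t powr (- d - 2) * exp (- 1 / (2 * t)) \<le> t powr (- d - 1) * 1"
        using 3 by (intro mult_mono powr_mono) auto
      then have "t powr (- d - 2) * exp (- 1 / (2 * t)) \<le> scale_weight d 0 t" by (simp add: scale_weight_def)
      moreover have "0 \<le> M * indicator {0..1} t" using M(1) by simp
      ultimately show ?thesis using 3 by (simp add: add_increasing)
    qed (auto simp: M)
  qed
  also have "\<dots> < \<infinity>"
  proof -
    have "integrable lborel (\<lambda>t. M * indicator {0..1} t + indicator {1..} t * scale_weight d 0 t)"
      using scale_weight_tail(1)[of d 0 1] assms by (intro Bochner_Integration.integrable_add integrable_mult_right)
        (auto simp: set_integrable_def)
    then show ?thesis
      by (subst nn_integral_eq_integral) (auto simp: M(1))
  qed
  finally have fin: "I 1 < \<infinity>" .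
  have "ennreal (2 powr (- d - 2) * exp (- 1 / 2)) = (\<integral>\<^sup>+t. ennreal (2 powr (- d - 2) * exp (- 1 / 2)) * indicator {1..2::real} t \<partial>lborel)"
    by (simp add: nn_integral_cmult)
  also have "\<dots> \<le> I 1"
    unfolding I_def
  proof (rule nn_integral_mono)
    fix t :: real
    have "2 powr (- d - 2) * exp (- 1 / 2) \<le> t powr (- d - 2) * exp (- 1 / (2 * t))" if "1 \<le> t" "t \<le> 2"
      using that assms by (intro mult_mono powr_mono2') (auto simp: field_simps)
    then show "ennreal (2 powr (- d - 2) * exp (- 1 / 2)) * indicator {1..2} t
        \<le> ennreal (indicator {0<..} t * (t powr (- d - 2) * exp (- 1 / (2 * t))))"
      by (auto simp: indicator_def intro!: ennreal_leI)
  qed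
  finally have "0 < I 1" by (rule less_le_trans[rotated]) simp
  then have J: "0 < enn2real (I 1)" "I 1 = ennreal (enn2real (I 1))"
    using fin by (auto simp: enn2real_positive_iff)
  have "I b = ennreal (enn2real (I 1) * b powr (- d - 1))" if b: "0 < b" for b
  proof -
    have "I b = ennreal \<bar>b\<bar> * (\<integral>\<^sup>+t. ennreal (indicator {0<..} (b * t) * ((b * t) powr (- d - 2) * exp (- b / (2 * (b * t))))) \<partial>lborel)"
      unfolding I_def using b by (subst nn_integral_lborel_scale[where c = b]) auto
    also have "\<dots> = ennreal b * (\<integral>\<^sup>+t. ennreal (b powr (- d - 2)) * ennreal (indicator {0<..} t * (t powr (- d - 2) * exp (- 1 / (2 * t)))) \<partial>lborel)"
      using b by (intro arg_cong2[where f = "(*)"] nn_integral_cong)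
        (auto simp: indicator_def zero_less_mult_iff powr_mult ennreal_mult[symmetric] mult_ac)
    also have "\<dots> = ennreal b * (ennreal (b powr (- d - 2)) * I 1)"
      unfolding I_def by (subst nn_integral_cmult) auto
    also have "\<dots> = ennreal ((b * b powr (- d - 2)) * enn2real (I 1))"
      using b by (subst J(2)) (simp add: ennreal_mult mult.assoc)
    also have "b * b powr (- d - 2) = b powr (- d - 1)"
    proof -
      have "b powr 1 * b powr (- d - 2) = b powr (1 + (- d - 2))" by (rule powr_add[symmetric])
      also have "1 + (- d - 2) = - d - 1" by simp
      finally show ?thesis using b by simp
    qed
    finally show ?thesis by (simp add: mult.commute)
  qed
  note scaling = this
  show ?thesis
  proof (rule that[OF J(1)])
    show "(\<integral>\<^sup>+t. ennreal (indicator {0<..} t * (t powr (- d - 2) * exp (- b / (2 * t)))) \<partial>lborel)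
       = ennreal (enn2real (I 1) * b powr (- d - 1))" if "0 < b" for b
      by (rule trans[OF I_def[symmetric] scaling[OF that]])
  qed
qed

text \<open>The substitution \<open>l = u / t\<close> and Tonelli's theorem leave an inverse gamma integral in \<open>t\<close> with parameter \<open>c + u\<close>.\<close>

lemma nn_integral_EIG_scale_law:
  assumes d: "0 < d" and c: "0 < c"
  obtains K where "0 < K"
    "\<And>g. g \<in> borel_measurable borel \<Longrightarrow>
       (\<integral>\<^sup>+(l, t). g (l * t) \<partial>EIG_scale_law d c) =
       ennreal K * (\<integral>\<^sup>+u. ennreal (indicator {0<..} u * scale_weight d c u) * g u \<partial>lborel)"
proof -
  obtain J where J: "0 < J"
    "\<And>b. 0 < b \<Longrightarrow> (\<integral>\<^sup>+t. ennreal (indicator {0<..} t * (t powr (- d - 2) * exp (- b / (2 * t)))) \<partial>lborel)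
       = ennreal (J * b powr (- d - 1))"
    using inverse_gamma_mass[OF d] by auto
  define e where "e = exponential_density (1/2)"
  define h where "h = inv_gamma_density d (c / 2)"
  define C where "C = (c / 2) powr d / Gamma d"
  have C: "0 < C" using c d by (simp add: C_def Gamma_real_pos)
  have [measurable]: "e \<in> borel_measurable borel" by (simp add: e_def)
  have [measurable]: "h \<in> borel_measurable borel"
    unfolding h_def inv_gamma_density_def by measurable
  have e0: "0 \<le> e l" for l by (simp add: e_def exponential_density_def)
  have h0: "0 \<le> h t" for t using c d Gamma_real_pos[OF d] by (simp add: h_def inv_gamma_density_def)
  have law: "EIG_scale_law d c = density (lborel \<Otimes>\<^sub>M lborel) (\<lambda>(l, t). ennreal (e l) * ennreal (h t))"
    unfolding EIG_scale_law_def e_def[symmetric] h_def[symmetric]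
    by (rule pair_measure_density) (auto simp: sigma_finite_measure.sigma_finite_iff_density_finite[OF sigma_finite_lborel] sigma_finite_lborel)
  have key: "(\<integral>\<^sup>+t. ennreal (h t) * (ennreal (1 / t) * ennreal (e (u / t))) \<partial>lborel) = ennreal (C / 2 * J) * ennreal (scale_weight d c u)"
    if u: "0 < u" for u
  proof -
    have "(\<integral>\<^sup>+t. ennreal (h t) * (ennreal (1 / t) * ennreal (e (u / t))) \<partial>lborel)
       = (\<integral>\<^sup>+t. ennreal (C / 2) * ennreal (indicator {0<..} t * (t powr (- d - 2) * exp (- (c + u) / (2 * t)))) \<partial>lborel)"
    proof (rule nn_integral_cong)
      fix t :: real
      show "ennreal (h t) * (ennreal (1 / t) * ennreal (e (u / t)))
        = ennreal (C / 2) * ennreal (indicator {0<..} t * (t powr (- d - 2) * exp (- (c + u) / (2 * t))))"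
      proof (cases "t > 0")
        case True
        have p: "t powr (- d - 2) = t powr (- d - 1) * (1 / t)"
        proof -
          have "t powr (- d - 2) = t powr ((- d - 1) + (- 1))" by (rule arg_cong[where f = "(powr) t"]) simp
          also have "\<dots> = t powr (- d - 1) * (1 / t)" using True by (subst powr_add) (simp add: powr_minus_divide)
          finally show ?thesis .
        qed
        have x: "exp (- (c + u) / (2 * t)) = exp (- (c / 2) / t) * exp (- (u / t) * (1 / 2))"
          using True by (simp add: exp_add[symmetric] field_simps)
        have nn: "\<not> u / t < 0" using divide_pos_pos[OF u True] by (rule less_not_sym)
        have ee: "e (u / t) = 1 / 2 * exp (- (u / t) * (1 / 2))"
          by (simp only: e_def exponential_density_def nn if_False)
        have eq: "h t * (1 / t * e (u / t)) = C / 2 * (t powr (- d - 2) * exp (- (c + u) / (2 * t)))"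
          unfolding p x ee using True by (simp add: h_def inv_gamma_density_def C_def)
        have "ennreal (h t) * (ennreal (1 / t) * ennreal (e (u / t))) = ennreal (h t * (1 / t * e (u / t)))"
        proof -
          have t0: "0 \<le> 1 / t" using True by simp
          show ?thesis by (simp only: ennreal_mult[OF h0 mult_nonneg_nonneg[OF t0 e0]] ennreal_mult[OF t0 e0])
        qed
        also have "\<dots> = ennreal (C / 2) * ennreal (indicator {0<..} t * (t powr (- d - 2) * exp (- (c + u) / (2 * t))))"
        proof -
          have "ennreal (C / 2 * X) = ennreal (C / 2) * ennreal (indicator {0<..} t * X)" if "0 \<le> X" for X
            using C True that by (subst ennreal_mult) auto
          then show ?thesis unfolding eq by simp
        qed
        finally show ?thesis .
      qed (simp add: h_def inv_gamma_density_def)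
    qed
    also have "\<dots> = ennreal (C / 2) * ennreal (J * (c + u) powr (- d - 1))"
      using c u by (subst nn_integral_cmult, measurable) (simp only: J(2) add_pos_pos)
    also have "\<dots> = ennreal (C / 2 * (J * (c + u) powr (- d - 1)))"
      using C J(1) by (intro ennreal_mult[symmetric]) auto
    also have "C / 2 * (J * (c + u) powr (- d - 1)) = C / 2 * J * scale_weight d c u"
      by (simp add: scale_weight_def)
    also have "ennreal \<dots> = ennreal (C / 2 * J) * ennreal (scale_weight d c u)"
      using C J(1) by (intro ennreal_mult) auto
    finally show ?thesis .
  qed
  have main: "(\<integral>\<^sup>+(l, t). g (l * t) \<partial>EIG_scale_law d c) =
       ennreal (C / 2 * J) * (\<integral>\<^sup>+u. ennreal (indicator {0<..} u * scale_weight d c u) * g u \<partial>lborel)"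
    if [measurable]: "g \<in> borel_measurable borel" for g
  proof -
    have "(\<integral>\<^sup>+(l, t). g (l * t) \<partial>EIG_scale_law d c)
        = (\<integral>\<^sup>+z. (case z of (l, t) \<Rightarrow> ennreal (e l) * ennreal (h t) * g (l * t)) \<partial>(lborel \<Otimes>\<^sub>M lborel))"
      unfolding law by (subst nn_integral_density) (auto intro!: nn_integral_cong simp: borel_prod)
    also have "\<dots> = (\<integral>\<^sup>+t. \<integral>\<^sup>+l. ennreal (e l) * ennreal (h t) * g (l * t) \<partial>lborel \<partial>lborel)"
      by (subst lborel_pair.nn_integral_snd[symmetric]) auto
    also have "\<dots> = (\<integral>\<^sup>+t. \<integral>\<^sup>+u. ennreal (h t) * (ennreal (1 / t) * ennreal (e (u / t))) * g u \<partial>lborel \<partial>lborel)"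
    proof (rule nn_integral_cong)
      fix t :: real
      show "(\<integral>\<^sup>+l. ennreal (e l) * ennreal (h t) * g (l * t) \<partial>lborel)
         = (\<integral>\<^sup>+u. ennreal (h t) * (ennreal (1 / t) * ennreal (e (u / t))) * g u \<partial>lborel)"
      proof (cases "t > 0")
        case True
        have "(\<integral>\<^sup>+l. ennreal (e l) * ennreal (h t) * g (l * t) \<partial>lborel)
           = ennreal \<bar>1 / t\<bar> * (\<integral>\<^sup>+u. ennreal (e (1 / t * u)) * ennreal (h t) * g (1 / t * u * t) \<partial>lborel)"
          using True by (subst nn_integral_lborel_scale[where c = "1 / t"]) auto
        also have "\<dots> = (\<integral>\<^sup>+u. ennreal (1 / t) * (ennreal (e (u / t)) * ennreal (h t) * g u) \<partial>lborel)"
          using True by (subst nn_integral_cmult) auto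
        finally show ?thesis by (simp add: mult_ac)
      qed (simp add: h_def inv_gamma_density_def)
    qed
    also have "\<dots> = (\<integral>\<^sup>+u. \<integral>\<^sup>+t. ennreal (h t) * (ennreal (1 / t) * ennreal (e (u / t))) * g u \<partial>lborel \<partial>lborel)"
      by (rule lborel_pair.Fubini'[symmetric]) measurable
    also have "\<dots> = (\<integral>\<^sup>+u. ennreal (C / 2 * J) * (ennreal (indicator {0<..} u * scale_weight d c u) * g u) \<partial>lborel)"
    proof (rule nn_integral_cong_AE, rule AE_I[where N = "{0}"])
      show "{u \<in> space lborel. (\<integral>\<^sup>+t. ennreal (h t) * (ennreal (1 / t) * ennreal (e (u / t))) * g u \<partial>lborel)
          \<noteq> ennreal (C / 2 * J) * (ennreal (indicator {0<..} u * scale_weight d c u) * g u)} \<subseteq> {0}"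
      proof safe
        fix u :: real assume ne: "(\<integral>\<^sup>+t. ennreal (h t) * (ennreal (1 / t) * ennreal (e (u / t))) * g u \<partial>lborel)
          \<noteq> ennreal (C / 2 * J) * (ennreal (indicator {0<..} u * scale_weight d c u) * g u)"
        show "u = 0"
        proof (rule ccontr)
          assume "u \<noteq> 0"
          then consider "u > 0" | "u < 0" by linarith
          then show False
          proof cases
            case 1
            have "(\<integral>\<^sup>+t. ennreal (h t) * (ennreal (1 / t) * ennreal (e (u / t))) * g u \<partial>lborel)
              = ennreal (C / 2 * J) * ennreal (scale_weight d c u) * g u"
              unfolding key[OF 1, symmetric] by (rule nn_integral_multc) measurable
            also have "\<dots> = ennreal (C / 2 * J) * (ennreal (indicator {0<..} u * scale_weight d c u) * g u)"
              using 1 by (simp only: mult.assoc) simp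
            finally show False using ne by (rule notE[rotated])
          next
            case 2
            have "ennreal (h t) * (ennreal (1 / t) * ennreal (e (u / t))) * g u = 0" for t
            proof (cases "t > 0")
              case True
              then have "u / t < 0" using 2 by (simp add: divide_neg_pos)
              then have "e (u / t) = 0" by (simp only: e_def exponential_density_def if_True)
              then show ?thesis by simp
            qed (simp add: h_def inv_gamma_density_def)
            with ne 2 show False by simp
          qed
        qed
      qed
    qed auto
    also have "\<dots> = ennreal (C / 2 * J) * (\<integral>\<^sup>+u. ennreal (indicator {0<..} u * scale_weight d c u) * g u \<partial>lborel)"
      by (subst nn_integral_cmult) auto
    finally show ?thesis .
  qed
  show ?thesis by (rule that[of "C / 2 * J", OF _ main]) (use C J(1) in \<open>simp only: mult_pos_pos half_gt_zero\<close>)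
qed

section \<open>Gaussian prior and likelihood\<close>

lemma mahal_sq_nonneg:
  fixes S :: "real^'k^'k"
  assumes "pos_def S"
  shows "0 \<le> mahal_sq S x"
  using pos_def_whitening[OF assms] by (metis zero_le_power2)

lemma mahal_sq_uminus [simp]: "mahal_sq S (- x) = mahal_sq S x"
  by (simp add: mahal_sq_def linear_neg[OF matrix_vector_mul_linear])

lemma measurable_mahal_sq [measurable]: "mahal_sq S \<in> borel_measurable borel"
  unfolding mahal_sq_def[abs_def]
  by (intro borel_measurable_continuous_onI continuous_intros matrix_vector_mult_linear_continuous_on)

lemma det_pos_def:
  fixes S :: "real^'k^'k"
  assumes "pos_def S"
  shows "0 < det S"
proof -
  obtain B :: "real^'k^'k" where "(det B)\<^sup>2 * det S = 1" using pos_def_whitening[OF assms] by metis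
  then show ?thesis by (metis zero_less_mult_pos zero_less_one zero_less_power2 mult_zero_left power2_eq_square zero_neq_one)
qed

lemma norm_le_mahal:
  fixes S :: "real^'k^'k"
  assumes "pos_def S"
  obtains b where "0 < b" "\<And>x. norm x \<le> b * sqrt (mahal_sq S x)"
proof -
  obtain B :: "real^'k^'k" where B: "\<And>x. mahal_sq S x = (norm (B *v x))\<^sup>2" and D: "(det B)\<^sup>2 * det S = 1"
    using pos_def_whitening[OF assms] by metis
  have "invertible B" using D by (auto simp: invertible_det_nz)
  then obtain A where A: "A ** B = mat 1" by (auto simp: invertible_def)
  obtain b where b: "0 < b" "\<And>x. norm (A *v x) \<le> b * norm x"
    using linear_bounded_pos[OF matrix_vector_mul_linear[of A]] by metis
  have "norm x \<le> b * sqrt (mahal_sq S x)" for x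
    using b(2)[of "B *v x"] by (simp add: B matrix_vector_mul_assoc A)
  with that[OF b(1)] show ?thesis by blast
qed

lemma det_scaleR_matrix:
  fixes S :: "real^'k^'k"
  shows "det (u *\<^sub>R S) = u ^ CARD('k) * det S"
proof -
  have "u *\<^sub>R S = (\<chi> i. u *s S $ i)" by (simp add: vec_eq_iff)
  then show ?thesis by (simp add: det_rows_mul)
qed

lemma mahal_sq_scaleR_matrix:
  fixes S :: "real^'k^'k"
  assumes S: "pos_def S" and u: "u \<noteq> 0"
  shows "mahal_sq (u *\<^sub>R S) x = mahal_sq S x / u"
proof -
  obtain B :: "real^'k^'k" where B: "B ** S ** transpose B = mat 1" "matrix_inv S = transpose B ** B"
    using pos_def_whitening[OF S] by metis
  have "transpose B ** (B ** S) = mat 1" using B(1) matrix_left_right_inverse by blast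
  then have "matrix_inv S ** S = mat 1" by (simp add: B(2) matrix_mul_assoc)
  then have "((1 / u) *\<^sub>R matrix_inv S) ** (u *\<^sub>R S) = mat 1"
    using u by (simp add: matrix_scalar_ac scalar_matrix_assoc[symmetric])
  then have "matrix_inv (u *\<^sub>R S) = (1 / u) *\<^sub>R matrix_inv S" by (rule matrix_inv_eqI)
  then show ?thesis by (simp add: mahal_sq_def scaleR_matrix_vector_assoc[symmetric])
qed

text \<open>Completing the square for a Gaussian prior centred at \<open>0\<close> with covariance \<open>u *\<^sub>R S\<close> and an observation \<open>x\<close> with covariance \<open>S\<close>: the
posterior is centred at \<open>(u / (1 + u)) *\<^sub>R x\<close>.\<close>

lemma mahal_sq_complete_square:
  fixes S :: "real^'k^'k"
  assumes S: "pos_def S" and u: "0 < u"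
  shows "mahal_sq S \<theta> / u + mahal_sq S (x - \<theta>)
    = mahal_sq S (\<theta> - (u / (1 + u)) *\<^sub>R x) / (u / (1 + u)) + mahal_sq S x / (1 + u)"
proof -
  obtain B :: "real^'k^'k" where B: "\<And>x. mahal_sq S x = (norm (B *v x))\<^sup>2"
    using pos_def_whitening[OF S] by metis
  define y z where "y = B *v x" and "z = B *v \<theta>"
  have e: "B *v (x - \<theta>) = y - z" "B *v (\<theta> - (u / (1 + u)) *\<^sub>R x) = z - (u / (1 + u)) *\<^sub>R y"
    by (simp_all add: y_def z_def matrix_vector_mult_diff_distrib matrix_vector_mult_scaleR)
  have "z \<bullet> z / u + (y \<bullet> y - 2 * (y \<bullet> z) + z \<bullet> z)
    = (z \<bullet> z - 2 * (u / (1 + u)) * (y \<bullet> z) + (u / (1 + u))\<^sup>2 * (y \<bullet> y)) / (u / (1 + u)) + y \<bullet> y / (1 + u)"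
  proof -
    define r where "r = u / (1 + u)"
    have r: "r \<noteq> 0" using u by (simp add: r_def)
    have "(z \<bullet> z - 2 * r * (y \<bullet> z) + r\<^sup>2 * (y \<bullet> y)) / r = z \<bullet> z / r - 2 * (y \<bullet> z) + r * (y \<bullet> y)"
      using r by (simp add: field_simps power2_eq_square)
    moreover have "z \<bullet> z / r = z \<bullet> z / u + z \<bullet> z" using u by (simp add: r_def field_simps)
    moreover have "r * (y \<bullet> y) + y \<bullet> y / (1 + u) = y \<bullet> y"
    proof -
      have "r * (y \<bullet> y) + y \<bullet> y / (1 + u) = ((1 + u) * (y \<bullet> y)) / (1 + u)"
        unfolding r_def by (simp add: add_divide_distrib distrib_right)
      then show ?thesis using u by simp
    qed
    ultimately show ?thesis unfolding r_def[symmetric] by simp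
  qed
  moreover have "(y - z) \<bullet> (y - z) = y \<bullet> y - 2 * (y \<bullet> z) + z \<bullet> z"
    by (simp add: inner_diff inner_commute)
  moreover have "(z - (u / (1 + u)) *\<^sub>R y) \<bullet> (z - (u / (1 + u)) *\<^sub>R y)
      = z \<bullet> z - 2 * (u / (1 + u)) * (y \<bullet> z) + (u / (1 + u))\<^sup>2 * (y \<bullet> y)"
    by (simp add: inner_diff inner_commute power2_eq_square)
  ultimately show ?thesis
    unfolding B e power2_norm_eq_inner y_def[symmetric] z_def[symmetric] by simp
qed

definition gauss_norm :: "real^'k^'k \<Rightarrow> real" where
  "gauss_norm S = sqrt ((2 * pi) ^ CARD('k) * det S)"

lemma gauss_norm_pos: "pos_def S \<Longrightarrow> 0 < gauss_norm S"
  by (simp add: gauss_norm_def det_pos_def)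

lemma mvn_density_alt: "mvn_density \<mu> S x = exp (- mahal_sq S (x - \<mu>) / 2) / gauss_norm S"
  by (simp add: mvn_density_def gauss_norm_def)

lemma mvn_density_scaleR:
  fixes S :: "real^'k^'k"
  assumes S: "pos_def S" and u: "0 < u"
  shows "mvn_density 0 (u *\<^sub>R S) \<theta> = exp (- mahal_sq S \<theta> / (2 * u)) / (sqrt u ^ CARD('k) * gauss_norm S)"
proof -
  have "sqrt ((2 * pi) ^ CARD('k) * (u ^ CARD('k) * det S)) = sqrt u ^ CARD('k) * gauss_norm S"
    by (simp add: gauss_norm_def real_sqrt_mult real_sqrt_power mult_ac)
  then show ?thesis
    using u by (simp add: mvn_density_def mahal_sq_scaleR_matrix[OF S] det_scaleR_matrix mult.commute)
qed

text \<open>At \<open>u = 0\<close> the inverse of the covariance matrix is an unspecified matrix; one point does not affect measurability.\<close>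

lemma measurable_mvn_density_scaleR:
  fixes S :: "real^'k^'k"
  assumes S: "pos_def S"
  shows "(\<lambda>u. mvn_density 0 (u *\<^sub>R S) \<theta>) \<in> borel_measurable borel"
proof -
  have "(\<lambda>u. mvn_density 0 (u *\<^sub>R S) \<theta>) = (\<lambda>u. if u = 0 then mvn_density 0 (0 *\<^sub>R S) \<theta>
      else exp (- (mahal_sq S \<theta> / u) / 2) / sqrt ((2 * pi) ^ CARD('k) * (u ^ CARD('k) * det S)))"
  proof
    fix u :: real
    show "mvn_density 0 (u *\<^sub>R S) \<theta> = (if u = 0 then mvn_density 0 (0 *\<^sub>R S) \<theta>
      else exp (- (mahal_sq S \<theta> / u) / 2) / sqrt ((2 * pi) ^ CARD('k) * (u ^ CARD('k) * det S)))"
      by (cases "u = 0") (simp_all add: mvn_density_def mahal_sq_scaleR_matrix[OF S] det_scaleR_matrix)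
  qed
  also have "\<dots> \<in> borel_measurable borel" by measurable
  finally show ?thesis .
qed

lemma integral_lborel_reflect:
  fixes F :: "'a::euclidean_space \<Rightarrow> 'b::{banach, second_countable_topology}"
  assumes [measurable]: "F \<in> borel_measurable borel"
  shows "(\<integral>x. F (t - x) \<partial>lborel) = (\<integral>x. F x \<partial>lborel)"
proof -
  have "lborel = distr lborel borel (\<lambda>x::'a. t - x)"
    using lborel_affine[of "-1" t] by (simp add: density_1)
  then have "(\<integral>x. F x \<partial>lborel) = (\<integral>x. F x \<partial>distr lborel borel (\<lambda>x::'a. t - x))" by (rule arg_cong)
  also have "\<dots> = (\<integral>x. F (t - x) \<partial>lborel)" by (rule integral_distr) auto
  finally show ?thesis by simp
qed

text \<open>Reflection at \<open>a\<close> preserves the Gaussian factor and changes the sign of \<open>\<theta> - a\<close>.\<close>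

lemma gaussian_mahal_mean:
  fixes S :: "real^'k^'k"
  assumes S: "pos_def S" and r: "0 < r"
  shows "(\<integral>\<theta>. exp (- mahal_sq S (\<theta> - a) / (2 * r)) *\<^sub>R \<theta> \<partial>lborel) = (sqrt r ^ CARD('k) * gauss_norm S) *\<^sub>R a"
proof -
  define f where "f \<theta> = exp (- mahal_sq S (\<theta> - a) / (2 * r))" for \<theta> :: "real^'k"
  have [measurable]: "f \<in> borel_measurable borel" unfolding f_def by measurable
  have f0: "0 \<le> f \<theta>" for \<theta> by (simp add: f_def)
  have hb: "has_bochner_integral lborel f (sqrt r ^ CARD('k) * gauss_norm S)"
    using nn_integral_gaussian_mahal[OF S r, of a] r gauss_norm_pos[OF S] f0
    by (intro has_bochner_integral_nn_integral) (auto simp: f_def gauss_norm_def)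
  obtain b where b: "0 < b" "\<And>x. norm x \<le> b * sqrt (mahal_sq S x)" using norm_le_mahal[OF S] by metis
  have I: "integrable lborel (\<lambda>\<theta>. f \<theta> *\<^sub>R (\<theta> - a))"
  proof (rule Bochner_Integration.integrable_bound)
    have r2: "0 < 2 * r" using r by simp
    have "has_bochner_integral lborel (\<lambda>\<theta>. exp (- mahal_sq S (\<theta> - a) / (2 * (2 * r)))) (sqrt (2 * r) ^ CARD('k) * gauss_norm S)"
      using nn_integral_gaussian_mahal[OF S r2, of a] r gauss_norm_pos[OF S]
      by (intro has_bochner_integral_nn_integral) (auto simp: gauss_norm_def)
    then show "integrable lborel (\<lambda>\<theta>. (b * (2 * sqrt r)) * exp (- mahal_sq S (\<theta> - a) / (2 * (2 * r))))"
      by (auto simp: has_bochner_integral_iff)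
    have "norm (f \<theta> *\<^sub>R (\<theta> - a)) \<le> (b * (2 * sqrt r)) * exp (- mahal_sq S (\<theta> - a) / (2 * (2 * r)))" for \<theta>
    proof -
      define m where "m = mahal_sq S (\<theta> - a)"
      have m: "0 \<le> m" using mahal_sq_nonneg[OF S] by (simp add: m_def)
      define z where "z = sqrt m / (2 * sqrt r)"
      have z2: "z\<^sup>2 = m / (4 * r)" using m r by (simp add: z_def power_divide power_mult_distrib)
      have "z \<le> 1 + z\<^sup>2" using zero_le_power2[of "z - 1/2"] by (simp add: power2_diff power_divide)
      also have "\<dots> \<le> exp (z\<^sup>2)" by (rule exp_ge_add_one_self)
      finally have "sqrt m \<le> 2 * sqrt r * exp (m / (4 * r))"
        unfolding z2 using r by (simp add: z_def field_simps)
      then have "b * sqrt m * exp (- m / (2 * r)) \<le> b * (2 * sqrt r * exp (m / (4 * r))) * exp (- m / (2 * r))"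
        using b(1) by (intro mult_right_mono mult_left_mono) auto
      also have "\<dots> = b * (2 * sqrt r) * exp (m / (4 * r) + - m / (2 * r))"
        by (simp only: exp_add mult.assoc)
      also have "m / (4 * r) + - m / (2 * r) = - m / (2 * (2 * r))" using r by (simp add: field_simps)
      finally have 1: "b * sqrt m * exp (- m / (2 * r)) \<le> b * (2 * sqrt r) * exp (- m / (2 * (2 * r)))" .
      have "norm (f \<theta> *\<^sub>R (\<theta> - a)) = exp (- m / (2 * r)) * norm (\<theta> - a)" by (simp add: f_def m_def)
      also have "\<dots> \<le> exp (- m / (2 * r)) * (b * sqrt m)"
        using b(2)[of "\<theta> - a"] by (intro mult_left_mono) (auto simp: m_def)
      also have "\<dots> \<le> b * (2 * sqrt r) * exp (- m / (2 * (2 * r)))" using 1 by (simp add: mult_ac)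
      finally show ?thesis by (simp add: m_def)
    qed
    then show "AE \<theta> in lborel. norm (f \<theta> *\<^sub>R (\<theta> - a)) \<le> norm ((b * (2 * sqrt r)) * exp (- mahal_sq S (\<theta> - a) / (2 * (2 * r))))"
      using b(1) r by (intro AE_I2) simp
  qed measurable
  have "(\<integral>\<theta>. f (2 *\<^sub>R a - \<theta>) *\<^sub>R ((2 *\<^sub>R a - \<theta>) - a) \<partial>lborel) = (\<integral>\<theta>. f \<theta> *\<^sub>R (\<theta> - a) \<partial>lborel)"
    by (rule integral_lborel_reflect) measurable
  also have "(\<lambda>\<theta>. f (2 *\<^sub>R a - \<theta>) *\<^sub>R ((2 *\<^sub>R a - \<theta>) - a)) = (\<lambda>\<theta>. - (f \<theta> *\<^sub>R (\<theta> - a)))"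
  proof
    fix \<theta>
    have e: "(2 *\<^sub>R a - \<theta>) - a = - (\<theta> - a)" by (simp add: scaleR_2)
    show "f (2 *\<^sub>R a - \<theta>) *\<^sub>R ((2 *\<^sub>R a - \<theta>) - a) = - (f \<theta> *\<^sub>R (\<theta> - a))"
      unfolding f_def e mahal_sq_uminus by (simp add: scaleR_diff_right)
  qed
  finally have neg: "- (\<integral>\<theta>. f \<theta> *\<^sub>R (\<theta> - a) \<partial>lborel) = (\<integral>\<theta>. f \<theta> *\<^sub>R (\<theta> - a) \<partial>lborel)"
    by simp
  have odd: "(\<integral>\<theta>. f \<theta> *\<^sub>R (\<theta> - a) \<partial>lborel) = 0"
  proof -
    have "v = 0" if "- v = v" for v :: "real^'k"
    proof -
      have "2 *\<^sub>R v = v + - v" by (simp only: that scaleR_2)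
      then show ?thesis by simp
    qed
    from this[OF neg] show ?thesis .
  qed
  have "(\<integral>\<theta>. f \<theta> *\<^sub>R \<theta> \<partial>lborel) = (\<integral>\<theta>. f \<theta> *\<^sub>R (\<theta> - a) + f \<theta> *\<^sub>R a \<partial>lborel)"
    by (simp add: scaleR_diff_right)
  also have "\<dots> = (\<integral>\<theta>. f \<theta> *\<^sub>R (\<theta> - a) \<partial>lborel) + (\<integral>\<theta>. f \<theta> *\<^sub>R a \<partial>lborel)"
    using hb by (intro Bochner_Integration.integral_add I integrable_scaleR_left) (auto simp: has_bochner_integral_iff)
  also have "(\<integral>\<theta>. f \<theta> *\<^sub>R a \<partial>lborel) = (sqrt r ^ CARD('k) * gauss_norm S) *\<^sub>R a"
    using hb by (auto simp: has_bochner_integral_iff)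
  finally show ?thesis using odd by (simp add: f_def)
qed

section \<open>The posterior mean\<close>

text \<open>The joint density of the product \<open>u\<close> of the scales, the mean \<open>\<theta>\<close> and the observation \<open>x\<close>, up to the constant of the scale law.\<close>

definition EIG_joint :: "real^'k^'k \<Rightarrow> real \<Rightarrow> real \<Rightarrow> real^'k \<Rightarrow> real \<Rightarrow> real^'k \<Rightarrow> real" where
  "EIG_joint S d c x u \<theta> = indicator {0<..} u * scale_weight d c u
     * (exp (- mahal_sq S \<theta> / (2 * u)) / (sqrt u ^ CARD('k) * gauss_norm S)) * mvn_density \<theta> S x"

lemma EIG_joint_nonneg: "pos_def S \<Longrightarrow> 0 \<le> EIG_joint S d c x u \<theta>"
  using gauss_norm_pos[of S] by (cases "u > 0") (auto simp: EIG_joint_def mvn_density_alt)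

lemma measurable_EIG_joint [measurable]:
  "(\<lambda>z. EIG_joint S d c x (fst z) (snd z)) \<in> borel_measurable (lborel \<Otimes>\<^sub>M lborel)"
  unfolding EIG_joint_def mvn_density_alt by measurable

lemma EIG_joint_eq:
  fixes S :: "real^'k^'k"
  assumes S: "pos_def S" and u: "0 < u"
  shows "EIG_joint S d c x u \<theta> = post_weight (real CARD('k)) d c (mahal_sq S x) u
      / (gauss_norm S * (sqrt (u / (1 + u)) ^ CARD('k) * gauss_norm S))
      * exp (- mahal_sq S (\<theta> - (u / (1 + u)) *\<^sub>R x) / (2 * (u / (1 + u))))"
proof -
  define r where "r = u / (1 + u)"
  have u1: "0 < 1 + u" using u by simp
  have "- mahal_sq S \<theta> / (2 * u) + - mahal_sq S (x - \<theta>) / 2 = - (mahal_sq S \<theta> / u + mahal_sq S (x - \<theta>)) / 2"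
    using u by (simp add: field_simps)
  also have "\<dots> = - (mahal_sq S (\<theta> - r *\<^sub>R x) / r + mahal_sq S x / (1 + u)) / 2"
    unfolding mahal_sq_complete_square[OF S u] r_def ..
  also have "\<dots> = - mahal_sq S x / (2 * (1 + u)) + - mahal_sq S (\<theta> - r *\<^sub>R x) / (2 * r)"
  proof -
    have gen: "- (A / r + B / p) / 2 = - B / (2 * p) + - A / (2 * r)" for A B p :: real
      by (simp add: add_divide_distrib mult.commute)
    show ?thesis by (rule gen)
  qed
  finally have E: "exp (- mahal_sq S \<theta> / (2 * u)) * exp (- mahal_sq S (x - \<theta>) / 2)
     = exp (- mahal_sq S x / (2 * (1 + u))) * exp (- mahal_sq S (\<theta> - r *\<^sub>R x) / (2 * r))"
    by (simp only: exp_add[symmetric])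
  have P: "(1 + u) powr (- real CARD('k) / 2) = 1 / sqrt (1 + u) ^ CARD('k)"
    using u1 by (simp add: powr_minus_divide powr_half_sqrt[symmetric] powr_realpow[symmetric] powr_powr)
  have Q: "sqrt r ^ CARD('k) = sqrt u ^ CARD('k) / sqrt (1 + u) ^ CARD('k)"
    by (simp add: r_def real_sqrt_divide power_divide)
  have nz: "sqrt u ^ CARD('k) \<noteq> 0" "sqrt (1 + u) ^ CARD('k) \<noteq> 0" "gauss_norm S \<noteq> 0"
    using u gauss_norm_pos[OF S] by auto
  have "EIG_joint S d c x u \<theta> = scale_weight d c u * (exp (- mahal_sq S \<theta> / (2 * u)) * exp (- mahal_sq S (x - \<theta>) / 2))
      / (sqrt u ^ CARD('k) * gauss_norm S * gauss_norm S)"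
    using u by (simp add: EIG_joint_def mvn_density_alt)
  also have "\<dots> = post_weight (real CARD('k)) d c (mahal_sq S x) u
      / (gauss_norm S * (sqrt r ^ CARD('k) * gauss_norm S))
      * exp (- mahal_sq S (\<theta> - r *\<^sub>R x) / (2 * r))"
    unfolding E post_weight_def P Q using nz by (simp add: field_simps)
  finally show ?thesis by (simp add: r_def)
qed

lemma nn_integral_EIG_joint:
  fixes S :: "real^'k^'k"
  assumes S: "pos_def S"
  shows "(\<integral>\<^sup>+\<theta>. ennreal (EIG_joint S d c x u \<theta>) \<partial>lborel)
    = ennreal (indicator {0<..} u * post_weight (real CARD('k)) d c (mahal_sq S x) u / gauss_norm S)"
proof (cases "0 < u")
  case True
  define r where "r = u / (1 + u)"
  define N where "N = sqrt r ^ CARD('k) * gauss_norm S"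
  have r: "0 < r" using True by (simp add: r_def)
  have g: "0 < gauss_norm S" by (rule gauss_norm_pos[OF S])
  have N: "0 < N" using r g by (simp add: N_def)
  define A where "A = post_weight (real CARD('k)) d c (mahal_sq S x) u / (gauss_norm S * N)"
  have A: "0 \<le> A" using g N by (simp add: A_def)
  have "(\<integral>\<^sup>+\<theta>. ennreal (EIG_joint S d c x u \<theta>) \<partial>lborel)
     = (\<integral>\<^sup>+\<theta>. ennreal A * ennreal (exp (- mahal_sq S (\<theta> - r *\<^sub>R x) / (2 * r))) \<partial>lborel)"
    unfolding EIG_joint_eq[OF S True] r_def[symmetric] N_def[symmetric] A_def[symmetric]
    using A by (simp add: ennreal_mult)
  also have "\<dots> = ennreal A * ennreal N"
    using nn_integral_gaussian_mahal[OF S r, of "r *\<^sub>R x"]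
    by (subst nn_integral_cmult) (auto simp: N_def gauss_norm_def)
  also have "\<dots> = ennreal (A * N)" using A N by (intro ennreal_mult[symmetric]) auto
  also have "A * N = indicator {0<..} u * post_weight (real CARD('k)) d c (mahal_sq S x) u / gauss_norm S"
    using True N by (simp add: A_def)
  finally show ?thesis .
qed (simp add: EIG_joint_def)

lemma integral_EIG_joint_mean:
  fixes S :: "real^'k^'k"
  assumes S: "pos_def S"
  shows "(\<integral>\<theta>. EIG_joint S d c x u \<theta> *\<^sub>R \<theta> \<partial>lborel)
    = (indicator {0<..} u * (u / (1 + u) * post_weight (real CARD('k)) d c (mahal_sq S x) u) / gauss_norm S) *\<^sub>R x"
proof (cases "0 < u")
  case True
  define r where "r = u / (1 + u)"
  define N where "N = sqrt r ^ CARD('k) * gauss_norm S"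
  have r: "0 < r" using True by (simp add: r_def)
  have g: "0 < gauss_norm S" by (rule gauss_norm_pos[OF S])
  have N: "0 < N" using r g by (simp add: N_def)
  define A where "A = post_weight (real CARD('k)) d c (mahal_sq S x) u / (gauss_norm S * N)"
  have "(\<integral>\<theta>. EIG_joint S d c x u \<theta> *\<^sub>R \<theta> \<partial>lborel)
     = (\<integral>\<theta>. A *\<^sub>R (exp (- mahal_sq S (\<theta> - r *\<^sub>R x) / (2 * r)) *\<^sub>R \<theta>) \<partial>lborel)"
    unfolding EIG_joint_eq[OF S True] r_def[symmetric] N_def[symmetric] A_def[symmetric] by simp
  also have "\<dots> = A *\<^sub>R N *\<^sub>R r *\<^sub>R x"
    unfolding integral_scaleR_right gaussian_mahal_mean[OF S r] N_def ..
  also have "\<dots> = (indicator {0<..} u * (r * post_weight (real CARD('k)) d c (mahal_sq S x) u) / gauss_norm S) *\<^sub>R x"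
    using True N by (simp add: A_def mult.commute)
  finally show ?thesis by (simp add: r_def)
qed (simp add: EIG_joint_def)

text \<open>The prior of \<open>\<theta>\<close> may have no first moment, but \<open>norm \<theta>\<close> times the likelihood of \<open>x\<close> is bounded, so the finite mass of the prior
suffices. This justifies the exchange of integrals in the posterior mean.\<close>

lemma integrable_EIG_joint_scaleR:
  fixes S :: "real^'k^'k"
  assumes S: "pos_def S" and dc: "0 < d" "0 < c"
  shows "integrable (lborel \<Otimes>\<^sub>M lborel) (\<lambda>(u, \<theta>). EIG_joint S d c x u \<theta> *\<^sub>R \<theta>)"
proof (rule integrableI_bounded)
  show "(\<lambda>(u, \<theta>). EIG_joint S d c x u \<theta> *\<^sub>R \<theta>) \<in> borel_measurable (lborel \<Otimes>\<^sub>M lborel)"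
    unfolding case_prod_unfold by measurable
  have g: "0 < gauss_norm S" by (rule gauss_norm_pos[OF S])
  obtain b where b: "0 < b" "\<And>x. norm x \<le> b * sqrt (mahal_sq S x)" using norm_le_mahal[OF S] by metis
  define C where "C = (norm x + b) / gauss_norm S"
  have C: "0 \<le> C" using b(1) g by (simp add: C_def)
  have bnd: "mvn_density \<theta> S x * norm \<theta> \<le> C" for \<theta>
  proof -
    define m where "m = mahal_sq S (x - \<theta>)"
    have m: "0 \<le> m" using mahal_sq_nonneg[OF S] by (simp add: m_def)
    have "sqrt m \<le> 1 + m / 2"
      using zero_le_power2[of "sqrt m - 1"] m by (simp add: power2_diff)
    also have "\<dots> \<le> exp (m / 2)" by (rule exp_ge_add_one_self)
    finally have 1: "sqrt m * exp (- m / 2) \<le> 1" by (simp add: exp_minus field_simps)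
    have "norm \<theta> \<le> norm x + norm (x - \<theta>)" by (metis norm_triangle_sub add.commute norm_minus_commute)
    also have "\<dots> \<le> norm x + b * sqrt m" using b(2)[of "x - \<theta>"] by (simp add: m_def)
    finally have "exp (- m / 2) * norm \<theta> \<le> exp (- m / 2) * (norm x + b * sqrt m)" by (intro mult_left_mono) auto
    also have "\<dots> = exp (- m / 2) * norm x + b * (sqrt m * exp (- m / 2))" by (simp add: algebra_simps)
    also have "\<dots> \<le> 1 * norm x + b * 1"
      using 1 b(1) m by (intro add_mono mult_mono mult_left_mono mult_right_mono) auto
    finally have "exp (- m / 2) * norm \<theta> \<le> norm x + b" by simp
    then show ?thesis using g by (simp add: mvn_density_alt m_def C_def divide_right_mono)
  qed
  have "(\<integral>\<^sup>+z. ennreal (norm (case z of (u, \<theta>) \<Rightarrow> EIG_joint S d c x u \<theta> *\<^sub>R \<theta>)) \<partial>(lborel \<Otimes>\<^sub>M lborel))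
     = (\<integral>\<^sup>+u. \<integral>\<^sup>+\<theta>. ennreal (norm (EIG_joint S d c x u \<theta> *\<^sub>R \<theta>)) \<partial>lborel \<partial>lborel)"
    unfolding case_prod_unfold by (subst lborel.nn_integral_fst[symmetric]) auto
  also have "\<dots> \<le> (\<integral>\<^sup>+u. ennreal (C * (indicator {0<..} u * scale_weight d c u)) \<partial>lborel)"
  proof (rule nn_integral_mono)
    fix u :: real
    show "(\<integral>\<^sup>+\<theta>. ennreal (norm (EIG_joint S d c x u \<theta> *\<^sub>R \<theta>)) \<partial>lborel) \<le> ennreal (C * (indicator {0<..} u * scale_weight d c u))"
    proof (cases "0 < u")
      case True
      define N where "N = sqrt u ^ CARD('k) * gauss_norm S"
      have N: "0 < N" using True g by (simp add: N_def)
      have "(\<integral>\<^sup>+\<theta>. ennreal (norm (EIG_joint S d c x u \<theta> *\<^sub>R \<theta>)) \<partial>lborel)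
        \<le> (\<integral>\<^sup>+\<theta>. ennreal (C * scale_weight d c u / N) * ennreal (exp (- mahal_sq S (\<theta> - 0) / (2 * u))) \<partial>lborel)"
      proof (rule nn_integral_mono)
        fix \<theta> :: "real^'k"
        have "norm (EIG_joint S d c x u \<theta> *\<^sub>R \<theta>)
           = (scale_weight d c u * (exp (- mahal_sq S \<theta> / (2 * u)) / N)) * (mvn_density \<theta> S x * norm \<theta>)"
        proof -
          have "norm (EIG_joint S d c x u \<theta> *\<^sub>R \<theta>) = EIG_joint S d c x u \<theta> * norm \<theta>"
            using EIG_joint_nonneg[OF S, of d c x u \<theta>] by (simp only: norm_scaleR abs_of_nonneg)
          then show ?thesis using True by (simp add: EIG_joint_def N_def)
        qed
        also have "\<dots> \<le> (scale_weight d c u * (exp (- mahal_sq S \<theta> / (2 * u)) / N)) * C"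
          using N by (intro mult_left_mono bnd) auto
        also have "\<dots> = (C * scale_weight d c u / N) * exp (- mahal_sq S (\<theta> - 0) / (2 * u))"
          by simp
        finally show "ennreal (norm (EIG_joint S d c x u \<theta> *\<^sub>R \<theta>))
            \<le> ennreal (C * scale_weight d c u / N) * ennreal (exp (- mahal_sq S (\<theta> - 0) / (2 * u)))"
          using C N by (subst ennreal_mult[symmetric]) (auto intro!: ennreal_leI)
      qed
      also have "\<dots> = ennreal (C * scale_weight d c u / N) * ennreal N"
        using nn_integral_gaussian_mahal[OF S True, of 0]
        by (subst nn_integral_cmult) (auto simp: N_def gauss_norm_def)
      also have "\<dots> = ennreal (C * scale_weight d c u / N * N)"
        using C N by (intro ennreal_mult[symmetric]) auto
      also have "C * scale_weight d c u / N * N = C * (indicator {0<..} u * scale_weight d c u)"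
        using True N by simp
      finally show ?thesis .
    qed (simp add: EIG_joint_def)
  qed
  also have "\<dots> < \<infinity>"
  proof -
    have "set_integrable lborel {0<..} (scale_weight d c)"
      by (rule set_integrable_subset[OF scale_weight_tail(1)[of d c 0]]) (use dc in auto)
    then have "integrable lborel (\<lambda>u. C * (indicator {0<..} u * scale_weight d c u))"
      by (intro integrable_mult_right) (simp add: set_integrable_def)
    then show ?thesis using C by (subst nn_integral_eq_integral) auto
  qed
  finally show "(\<integral>\<^sup>+z. ennreal (norm (case z of (u, \<theta>) \<Rightarrow> EIG_joint S d c x u \<theta> *\<^sub>R \<theta>)) \<partial>(lborel \<Otimes>\<^sub>M lborel)) < \<infinity>" .
qed

text \<open>Bayes' formula makes the posterior density of \<open>\<theta>\<close> proportional to the integral of the joint density over \<open>u\<close>. Fubini's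
theorem moves the mean in \<open>\<theta>\<close> inside, where it is \<open>(u / (1 + u)) *\<^sub>R x\<close>.\<close>

theorem EIG_estimator_eq:
  fixes S :: "real^'k^'k"
  assumes S: "pos_def S" and d: "0 < d" and c: "0 < c"
  shows "EIG_estimator S d c x = shrink_factor (real CARD('k)) d c (mahal_sq S x) *\<^sub>R x"
proof -
  define g where "g = gauss_norm S"
  have g: "0 < g" by (simp add: g_def gauss_norm_pos[OF S])
  define k where "k = real CARD('k)"
  define s where "s = mahal_sq S x"
  have s: "0 \<le> s" by (simp add: s_def mahal_sq_nonneg[OF S])
  define q where "q = EIG_joint S d c x"
  have q0: "0 \<le> q u \<theta>" for u \<theta> by (simp add: q_def EIG_joint_nonneg[OF S])
  have qm [measurable]: "(\<lambda>z. q (fst z) (snd z)) \<in> borel_measurable (lborel \<Otimes>\<^sub>M lborel)"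
    unfolding q_def by measurable
  obtain K where K: "0 < K"
    "\<And>h. h \<in> borel_measurable borel \<Longrightarrow>
       (\<integral>\<^sup>+(l, t). h (l * t) \<partial>EIG_scale_law d c) =
       ennreal K * (\<integral>\<^sup>+u. ennreal (indicator {0<..} u * scale_weight d c u) * h u \<partial>lborel)"
    using nn_integral_EIG_scale_law[OF d c] by metis
  define P where "P \<theta> = (\<integral>\<^sup>+(l, t). ennreal (mvn_density 0 ((l * t) *\<^sub>R S) \<theta>) \<partial>EIG_scale_law d c)" for \<theta>
  define N where "N u \<theta> = indicator {0<..} u * scale_weight d c u
     * (exp (- mahal_sq S \<theta> / (2 * u)) / (sqrt u ^ CARD('k) * g))" for u and \<theta> :: "real^'k"
  have N0: "0 \<le> N u \<theta>" for u \<theta> using g by (cases "0 < u") (auto simp: N_def)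
  have [measurable]: "(\<lambda>z. N (fst z) (snd z)) \<in> borel_measurable (lborel \<Otimes>\<^sub>M lborel)"
    unfolding N_def by measurable
  have Nswap: "(\<lambda>z. ennreal (N (snd z) (fst z))) \<in> borel_measurable (lborel \<Otimes>\<^sub>M lborel)"
    unfolding N_def by measurable
  have P: "P \<theta> = ennreal K * (\<integral>\<^sup>+u. ennreal (N u \<theta>) \<partial>lborel)" for \<theta>
  proof -
    have "P \<theta> = ennreal K * (\<integral>\<^sup>+u. ennreal (indicator {0<..} u * scale_weight d c u) * ennreal (mvn_density 0 (u *\<^sub>R S) \<theta>) \<partial>lborel)"
      unfolding P_def using measurable_mvn_density_scaleR[OF S] by (intro K(2)) measurable
    also have "(\<integral>\<^sup>+u. ennreal (indicator {0<..} u * scale_weight d c u) * ennreal (mvn_density 0 (u *\<^sub>R S) \<theta>) \<partial>lborel)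
       = (\<integral>\<^sup>+u. ennreal (N u \<theta>) \<partial>lborel)"
    proof (rule nn_integral_cong)
      fix u :: real
      show "ennreal (indicator {0<..} u * scale_weight d c u) * ennreal (mvn_density 0 (u *\<^sub>R S) \<theta>) = ennreal (N u \<theta>)"
        by (cases "0 < u") (simp_all add: N_def mvn_density_scaleR[OF S] g_def ennreal_mult'[symmetric])
    qed
    finally show ?thesis .
  qed
  have Pm [measurable]: "P \<in> borel_measurable borel"
  proof -
    have "(\<lambda>\<theta>. \<integral>\<^sup>+u. ennreal (N u \<theta>) \<partial>lborel) \<in> borel_measurable lborel"
      by (rule lborel.borel_measurable_nn_integral) (simp add: case_prod_unfold Nswap)
    then show ?thesis unfolding P[abs_def] by simp
  qed
  define Q where "Q \<theta> = (\<integral>\<^sup>+u. ennreal (q u \<theta>) \<partial>lborel)" for \<theta>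
  have \<phi>0: "0 \<le> mvn_density \<theta> S x" for \<theta> using g by (simp add: mvn_density_alt g_def)
  have \<phi>m [measurable]: "(\<lambda>\<theta>. mvn_density \<theta> S x) \<in> borel_measurable borel"
    unfolding mvn_density_alt by measurable
  have Nm1 [measurable]: "(\<lambda>u. N u \<theta>) \<in> borel_measurable borel" for \<theta>
    unfolding N_def by measurable
  have PQ: "P \<theta> * ennreal (mvn_density \<theta> S x) = ennreal K * Q \<theta>" for \<theta>
  proof -
    have "Q \<theta> = (\<integral>\<^sup>+u. ennreal (N u \<theta>) * ennreal (mvn_density \<theta> S x) \<partial>lborel)"
      unfolding Q_def q_def EIG_joint_def g_def[symmetric] N_def[symmetric]
      using N0 \<phi>0 by (simp add: ennreal_mult)
    also have "\<dots> = (\<integral>\<^sup>+u. ennreal (N u \<theta>) \<partial>lborel) * ennreal (mvn_density \<theta> S x)"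
      by (rule nn_integral_multc) measurable
    finally show ?thesis by (simp add: P mult.assoc)
  qed
  define Z where "Z = (LINT u:{0<..}|lborel. post_weight k d c s u) / g"
  have Z: "0 < Z"
    unfolding Z_def using post_weight_mass_pos[OF d c _ s, of k] g by (simp add: k_def)
  have pwi: "integrable lborel (\<lambda>u. indicator {0<..} u * post_weight k d c s u / g)"
    using post_weight_integrable[OF d c _ s, of k] by (simp add: k_def set_integrable_def)
  have QZ: "(\<integral>\<^sup>+\<theta>. Q \<theta> \<partial>lborel) = ennreal Z"
  proof -
    have "(\<integral>\<^sup>+\<theta>. Q \<theta> \<partial>lborel) = (\<integral>\<^sup>+u. \<integral>\<^sup>+\<theta>. ennreal (q u \<theta>) \<partial>lborel \<partial>lborel)"
      unfolding Q_def by (rule lborel_pair.Fubini'[of "\<lambda>u \<theta>. ennreal (q u \<theta>)"]) (simp add: case_prod_unfold)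
    also have "\<dots> = (\<integral>\<^sup>+u. ennreal (indicator {0<..} u * post_weight k d c s u / g) \<partial>lborel)"
      unfolding q_def nn_integral_EIG_joint[OF S] k_def s_def g_def ..
    also have "\<dots> = ennreal (\<integral>u. indicator {0<..} u * post_weight k d c s u / g \<partial>lborel)"
      using g by (intro nn_integral_eq_integral pwi) auto
    also have "(\<integral>u. indicator {0<..} u * post_weight k d c s u / g \<partial>lborel) = Z"
      by (simp add: Z_def set_lebesgue_integral_def)
    finally show ?thesis .
  qed
  have Qm [measurable]: "Q \<in> borel_measurable borel"
  proof -
    have "(\<lambda>z. ennreal (q (snd z) (fst z))) \<in> borel_measurable (lborel \<Otimes>\<^sub>M lborel)"
      unfolding q_def EIG_joint_def mvn_density_alt by measurable
    then have "(\<lambda>\<theta>. \<integral>\<^sup>+u. ennreal (q u \<theta>) \<partial>lborel) \<in> borel_measurable lborel"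
      by (intro lborel.borel_measurable_nn_integral) (simp add: case_prod_unfold)
    then show ?thesis unfolding Q_def[abs_def] by simp
  qed
  have M: "(\<integral>\<^sup>+\<theta>'. ennreal (mvn_density \<theta>' S x) \<partial>EIG_prior S d c) = ennreal (K * Z)"
  proof -
    have "(\<integral>\<^sup>+\<theta>'. ennreal (mvn_density \<theta>' S x) \<partial>EIG_prior S d c) = (\<integral>\<^sup>+\<theta>'. P \<theta>' * ennreal (mvn_density \<theta>' S x) \<partial>lborel)"
      unfolding EIG_prior_def P_def[symmetric] by (rule nn_integral_density) measurable
    also have "\<dots> = ennreal K * (\<integral>\<^sup>+\<theta>. Q \<theta> \<partial>lborel)"
      unfolding PQ by (rule nn_integral_cmult) measurable
    finally show ?thesis using K(1) Z by (simp add: QZ ennreal_mult)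
  qed
  define Q' where "Q' \<theta> = (\<integral>u. q u \<theta> \<partial>lborel)" for \<theta>
  have qm1 [measurable]: "(\<lambda>u. q u \<theta>) \<in> borel_measurable borel" for \<theta>
    unfolding q_def EIG_joint_def by measurable
  have Q'Q: "Q' \<theta> = enn2real (Q \<theta>)" for \<theta>
    unfolding Q'_def Q_def using q0 by (intro integral_eq_nn_integral) auto
  have Q'm [measurable]: "Q' \<in> borel_measurable borel" unfolding Q'Q[abs_def] by measurable
  have Q'0: "0 \<le> Q' \<theta>" for \<theta> by (simp add: Q'Q)
  \<comment> \<open>the prior density is infinite at \<open>0\<close> in dimension two and above, hence only almost everywhere\<close>
  have fin: "AE \<theta> in lborel. Q \<theta> \<noteq> \<infinity>"
    by (rule nn_integral_PInf_AE) (auto simp: QZ)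
  have "EIG_posterior S d c x = density lborel (\<lambda>\<theta>. P \<theta> * (ennreal (mvn_density \<theta> S x) / ennreal (K * Z)))"
    unfolding EIG_posterior_def M unfolding EIG_prior_def P_def[symmetric] by (rule density_density_eq) measurable
  also have "\<dots> = density lborel (\<lambda>\<theta>. ennreal (Q' \<theta> / Z))"
  proof (rule density_cong)
    show "AE \<theta> in lborel. P \<theta> * (ennreal (mvn_density \<theta> S x) / ennreal (K * Z)) = ennreal (Q' \<theta> / Z)"
      using fin
    proof eventually_elim
      case (elim \<theta>)
      have "P \<theta> * (ennreal (mvn_density \<theta> S x) / ennreal (K * Z)) = ennreal K * Q \<theta> / ennreal (K * Z)"
        unfolding PQ[symmetric] by (simp add: ennreal_times_divide)
      also have "Q \<theta> = ennreal (Q' \<theta>)" using elim by (simp add: Q'Q less_top)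
      also have "ennreal K * ennreal (Q' \<theta>) / ennreal (K * Z) = ennreal (K * Q' \<theta> / (K * Z))"
        using K(1) Z Q'0[of \<theta>] by (simp add: ennreal_mult[symmetric] divide_ennreal)
      also have "K * Q' \<theta> / (K * Z) = Q' \<theta> / Z" using K(1) by simp
      finally show ?case .
    qed
  qed measurable
  finally have "EIG_estimator S d c x = (\<integral>\<theta>. \<theta> \<partial>density lborel (\<lambda>\<theta>. ennreal (Q' \<theta> / Z)))"
    unfolding EIG_estimator_def by simp
  also have "\<dots> = (\<integral>\<theta>. (Q' \<theta> / Z) *\<^sub>R \<theta> \<partial>lborel)"
    using Z Q'0 by (intro integral_density) auto
  also have "\<dots> = (\<integral>\<theta>. (1 / Z) *\<^sub>R (\<integral>u. q u \<theta> *\<^sub>R \<theta> \<partial>lborel) \<partial>lborel)"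
  proof (rule integral_cong_AE)
    show "(\<lambda>\<theta>. (1 / Z) *\<^sub>R (\<integral>u. q u \<theta> *\<^sub>R \<theta> \<partial>lborel)) \<in> borel_measurable lborel"
    proof -
      have "(\<lambda>\<theta>. \<integral>u. q u \<theta> *\<^sub>R \<theta> \<partial>lborel) \<in> borel_measurable lborel"
        using lborel_pair.integrable_snd[OF integrable_EIG_joint_scaleR[OF S d c, of x]]
        unfolding q_def by (rule borel_measurable_integrable)
      then show ?thesis by measurable
    qed
    show "AE \<theta> in lborel. (Q' \<theta> / Z) *\<^sub>R \<theta> = (1 / Z) *\<^sub>R (\<integral>u. q u \<theta> *\<^sub>R \<theta> \<partial>lborel)"
      using fin
    proof eventually_elim
      case (elim \<theta>)
      have "integrable lborel (\<lambda>u. q u \<theta>)"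
        using elim q0 by (intro integrableI_nonneg) (auto simp: Q_def less_top)
      then show ?case by (simp add: Q'_def)
    qed
  qed measurable
  also have "\<dots> = (1 / Z) *\<^sub>R (\<integral>\<theta>. (\<integral>u. q u \<theta> *\<^sub>R \<theta> \<partial>lborel) \<partial>lborel)" by simp
  also have "(\<integral>\<theta>. (\<integral>u. q u \<theta> *\<^sub>R \<theta> \<partial>lborel) \<partial>lborel) = (\<integral>u. (\<integral>\<theta>. q u \<theta> *\<^sub>R \<theta> \<partial>lborel) \<partial>lborel)"
    using lborel_pair.Fubini_integral[OF integrable_EIG_joint_scaleR[OF S d c, of x]] unfolding q_def .
  also have "\<dots> = (\<integral>u. (indicator {0<..} u * (u / (1 + u) * post_weight k d c s u) / g) *\<^sub>R x \<partial>lborel)"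
    unfolding q_def integral_EIG_joint_mean[OF S] k_def s_def g_def ..
  also have "\<dots> = ((LINT u:{0<..}|lborel. u / (1 + u) * post_weight k d c s u) / g) *\<^sub>R x"
  proof -
    have "integrable lborel (\<lambda>u. indicator {0<..} u * (u / (1 + u) * post_weight k d c s u))"
      using post_weight_mult_integrable[OF d c _ s, of k "\<lambda>u. u / (1 + u)"] by (simp add: k_def set_integrable_def)
    moreover have "(\<integral>u. (f u / g) *\<^sub>R x \<partial>lborel) = (integral\<^sup>L lborel f / g) *\<^sub>R x" if "integrable lborel f" for f
      using that by simp
    ultimately show ?thesis unfolding set_lebesgue_integral_def real_scaleR_def by blast
  qed
  also have "(1 / Z) *\<^sub>R \<dots> = shrink_factor k d c s *\<^sub>R x"
    using g by (simp add: Z_def shrink_factor_def)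
  finally show ?thesis by (simp add: k_def s_def)
qed

section \<open>Risk at a single mean\<close>

lemma sets_mvn [simp, measurable_cong]: "sets (mvn \<theta> S) = sets borel"
  by (simp add: mvn_def)

lemma nn_integral_mvn:
  assumes [measurable]: "h \<in> borel_measurable borel"
  shows "(\<integral>\<^sup>+x. h x \<partial>mvn \<theta> S) = (\<integral>\<^sup>+x. ennreal (mvn_density \<theta> S x) * h x \<partial>lborel)"
  unfolding mvn_def mvn_density_alt by (rule nn_integral_density) measurable

text \<open>Under \<open>mvn \<theta> S\<close> the factor \<open>exp (m / 2)\<close> cancels the Gaussian density, and \<open>exp (- m / (2 * v))\<close> puts back one with
covariance \<open>v *\<^sub>R S\<close>. Taking \<open>v = 1\<close> gives the total mass, larger \<open>v\<close> exponential moments.\<close>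

lemma nn_integral_mvn_exp:
  fixes S :: "real^'k^'k"
  assumes S: "pos_def S" and v: "0 < v"
  shows "(\<integral>\<^sup>+x. ennreal (exp (mahal_sq S (x - \<theta>) / 2 - mahal_sq S (x - \<theta>) / (2 * v))) \<partial>mvn \<theta> S)
    = ennreal (sqrt v ^ CARD('k))"
proof -
  have g: "0 < gauss_norm S" by (rule gauss_norm_pos[OF S])
  have "(\<integral>\<^sup>+x. ennreal (exp (mahal_sq S (x - \<theta>) / 2 - mahal_sq S (x - \<theta>) / (2 * v))) \<partial>mvn \<theta> S)
    = (\<integral>\<^sup>+x. ennreal (1 / gauss_norm S) * ennreal (exp (- mahal_sq S (x - \<theta>) / (2 * v))) \<partial>lborel)"
    unfolding mvn_density_alt
  proof (subst nn_integral_mvn, measurable, rule nn_integral_cong)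
    fix x :: "real^'k"
    define m where "m = mahal_sq S (x - \<theta>)"
    have "mvn_density \<theta> S x * exp (m / 2 - m / (2 * v)) = 1 / gauss_norm S * exp (- m / 2 + (m / 2 - m / (2 * v)))"
      unfolding exp_add by (simp add: mvn_density_alt m_def)
    then have "mvn_density \<theta> S x * exp (m / 2 - m / (2 * v)) = 1 / gauss_norm S * exp (- m / (2 * v))"
      by simp
    then show "ennreal (mvn_density \<theta> S x) * ennreal (exp (mahal_sq S (x - \<theta>) / 2 - mahal_sq S (x - \<theta>) / (2 * v)))
      = ennreal (1 / gauss_norm S) * ennreal (exp (- mahal_sq S (x - \<theta>) / (2 * v)))"
      unfolding m_def[symmetric] using g
      by (subst (1 2) ennreal_mult[symmetric]) (auto simp: mvn_density_alt)
  qed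
  also have "\<dots> = ennreal (1 / gauss_norm S) * ennreal (sqrt v ^ CARD('k) * gauss_norm S)"
    using nn_integral_gaussian_mahal[OF S v, of \<theta>] by (subst nn_integral_cmult) (auto simp: gauss_norm_def)
  also have "\<dots> = ennreal (1 / gauss_norm S * (sqrt v ^ CARD('k) * gauss_norm S))"
    using g v by (intro ennreal_mult[symmetric]) auto
  finally show ?thesis using g by simp
qed

lemma nn_integral_mvn_const:
  fixes S :: "real^'k^'k"
  assumes S: "pos_def S"
  shows "(\<integral>\<^sup>+x. c \<partial>mvn \<theta> S) = c"
proof -
  have "emeasure (mvn \<theta> S) (space (mvn \<theta> S)) = 1"
    using nn_integral_mvn_exp[OF S, of 1 \<theta>] by simp
  then show ?thesis by simp
qed

lemma mvn_second_moment_le: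
  fixes S :: "real^'k^'k"
  assumes S: "pos_def S"
  shows "(\<integral>\<^sup>+x. ennreal (mahal_sq S (x - \<theta>)) \<partial>mvn \<theta> S) \<le> ennreal (4 * sqrt 2 ^ CARD('k))"
proof -
  have "(\<integral>\<^sup>+x. ennreal (mahal_sq S (x - \<theta>)) \<partial>mvn \<theta> S)
    \<le> (\<integral>\<^sup>+x. ennreal 4 * ennreal (exp (mahal_sq S (x - \<theta>) / 2 - mahal_sq S (x - \<theta>) / (2 * 2))) \<partial>mvn \<theta> S)"
  proof (rule nn_integral_mono)
    fix x
    have "mahal_sq S (x - \<theta>) \<le> 4 * exp (mahal_sq S (x - \<theta>) / 2 - mahal_sq S (x - \<theta>) / (2 * 2))"
      using exp_ge_add_one_self[of "mahal_sq S (x - \<theta>) / 4"] by (simp add: field_simps)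
    then show "ennreal (mahal_sq S (x - \<theta>)) \<le> ennreal 4 * ennreal (exp (mahal_sq S (x - \<theta>) / 2 - mahal_sq S (x - \<theta>) / (2 * 2)))"
      by (subst ennreal_mult[symmetric]) (auto intro: ennreal_leI)
  qed
  also have "\<dots> = ennreal 4 * ennreal (sqrt 2 ^ CARD('k))"
    using nn_integral_mvn_exp[OF S, of 2 \<theta>] by (subst nn_integral_cmult) (auto simp: mvn_def)
  also have "\<dots> = ennreal (4 * sqrt 2 ^ CARD('k))" by (rule ennreal_mult[symmetric]) auto
  finally show ?thesis .
qed

lemma mahal_sq_scaleR: "mahal_sq S (r *\<^sub>R x) = r\<^sup>2 * mahal_sq S x"
  by (simp add: mahal_sq_def matrix_vector_mult_scaleR power2_eq_square)

lemma mahal_triangle: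
  fixes S :: "real^'k^'k"
  assumes S: "pos_def S"
  shows "sqrt (mahal_sq S (x + y)) \<le> sqrt (mahal_sq S x) + sqrt (mahal_sq S y)"
proof -
  obtain B :: "real^'k^'k" where B: "\<And>x. mahal_sq S x = (norm (B *v x))\<^sup>2"
    using pos_def_whitening[OF S] by metis
  show ?thesis
    using norm_triangle_ineq[of "B *v x" "B *v y"] by (simp add: B matrix_vector_right_distrib)
qed

text \<open>The error is the noise \<open>x - \<theta>\<close> minus the bias \<open>(1 - R) *\<^sub>R x\<close>, and the bias is bounded pointwise. Since \<open>b\<close> will grow
while the noise has a bounded second moment, \<open>h\<close> can be taken small.\<close>

lemma EIG_risk_upper:
  fixes S :: "real^'k^'k"
  assumes S: "pos_def S" and d: "0 < d" and c: "0 < c" and b: "0 \<le> b" and h: "0 < h"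
    and bias: "\<And>s. 0 \<le> s \<Longrightarrow> (1 - shrink_factor (real CARD('k)) d c s) * sqrt s \<le> b"
  shows "EIG_risk S d c \<theta> \<le> ennreal ((1 + h) * b\<^sup>2 + (1 + 1 / h) * (4 * sqrt 2 ^ CARD('k)))"
proof -
  define R where "R x = shrink_factor (real CARD('k)) d c (mahal_sq S x)" for x
  have bnd: "mahal_sq S (R x *\<^sub>R x - \<theta>) \<le> (1 + h) * b\<^sup>2 + (1 + 1 / h) * mahal_sq S (x - \<theta>)" for x
  proof -
    define p where "p = sqrt (mahal_sq S (x - \<theta>))"
    have p: "0 \<le> p" "p\<^sup>2 = mahal_sq S (x - \<theta>)" using mahal_sq_nonneg[OF S] by (auto simp: p_def)
    have R1: "R x \<le> 1"
      unfolding R_def by (rule shrink_factor_bounds(2)[OF d c]) (auto simp: mahal_sq_nonneg[OF S])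
    have "sqrt (mahal_sq S (R x *\<^sub>R x - \<theta>)) = sqrt (mahal_sq S ((x - \<theta>) + (R x - 1) *\<^sub>R x))"
      by (simp add: scaleR_diff_left)
    also have "\<dots> \<le> p + sqrt (mahal_sq S ((R x - 1) *\<^sub>R x))"
      unfolding p_def by (rule mahal_triangle[OF S])
    also have "sqrt (mahal_sq S ((R x - 1) *\<^sub>R x)) = (1 - R x) * sqrt (mahal_sq S x)"
      using R1 by (simp add: mahal_sq_scaleR real_sqrt_mult)
    also have "\<dots> \<le> b" unfolding R_def by (rule bias[OF mahal_sq_nonneg[OF S]])
    finally have "sqrt (mahal_sq S (R x *\<^sub>R x - \<theta>)) \<le> p + b" by simp
    then have "(sqrt (mahal_sq S (R x *\<^sub>R x - \<theta>)))\<^sup>2 \<le> (p + b)\<^sup>2"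
      by (intro power_mono) (auto simp: mahal_sq_nonneg[OF S])
    then have "mahal_sq S (R x *\<^sub>R x - \<theta>) \<le> (p + b)\<^sup>2" by (simp add: mahal_sq_nonneg[OF S])
    also have "(p + b)\<^sup>2 \<le> (1 + h) * b\<^sup>2 + (1 + 1 / h) * p\<^sup>2"
    proof -
      have "(1 + h) * b\<^sup>2 + (1 + 1 / h) * p\<^sup>2 - (p + b)\<^sup>2 = (h * b - p)\<^sup>2 / h"
        using h by (simp add: field_simps power2_eq_square)
      moreover have "0 \<le> (h * b - p)\<^sup>2 / h" using h by simp
      ultimately show ?thesis by linarith
    qed
    finally show ?thesis by (simp add: p)
  qed
  have "EIG_risk S d c \<theta> \<le> (\<integral>\<^sup>+x. ennreal ((1 + h) * b\<^sup>2) + ennreal (1 + 1 / h) * ennreal (mahal_sq S (x - \<theta>)) \<partial>mvn \<theta> S)"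
    unfolding EIG_risk_def EIG_estimator_eq[OF S d c] R_def[symmetric]
  proof (rule nn_integral_mono)
    fix x
    have "ennreal (mahal_sq S (R x *\<^sub>R x - \<theta>)) \<le> ennreal ((1 + h) * b\<^sup>2 + (1 + 1 / h) * mahal_sq S (x - \<theta>))"
      by (rule ennreal_leI[OF bnd])
    also have "\<dots> = ennreal ((1 + h) * b\<^sup>2) + ennreal ((1 + 1 / h) * mahal_sq S (x - \<theta>))"
      using h mahal_sq_nonneg[OF S] by (intro ennreal_plus) auto
    also have "ennreal ((1 + 1 / h) * mahal_sq S (x - \<theta>)) = ennreal (1 + 1 / h) * ennreal (mahal_sq S (x - \<theta>))"
      using h mahal_sq_nonneg[OF S] by (intro ennreal_mult) auto
    finally show "ennreal (mahal_sq S (R x *\<^sub>R x - \<theta>))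
      \<le> ennreal ((1 + h) * b\<^sup>2) + ennreal (1 + 1 / h) * ennreal (mahal_sq S (x - \<theta>))" .
  qed
  also have "\<dots> = ennreal ((1 + h) * b\<^sup>2) + ennreal (1 + 1 / h) * (\<integral>\<^sup>+x. ennreal (mahal_sq S (x - \<theta>)) \<partial>mvn \<theta> S)"
  proof -
    show ?thesis
      by (subst nn_integral_add, measurable, subst nn_integral_cmult, measurable)
        (simp only: nn_integral_mvn_const[OF S])
  qed
  also have "\<dots> \<le> ennreal ((1 + h) * b\<^sup>2) + ennreal (1 + 1 / h) * ennreal (4 * sqrt 2 ^ CARD('k))"
    by (intro add_left_mono mult_left_mono mvn_second_moment_le[OF S]) simp
  also have "\<dots> = ennreal ((1 + h) * b\<^sup>2) + ennreal ((1 + 1 / h) * (4 * sqrt 2 ^ CARD('k)))"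
    using h by (subst ennreal_mult[symmetric]) auto
  also have "\<dots> = ennreal ((1 + h) * b\<^sup>2 + (1 + 1 / h) * (4 * sqrt 2 ^ CARD('k)))"
    using h by (intro ennreal_plus[symmetric]) auto
  finally show ?thesis .
qed

text \<open>As long as the noise has norm at most \<open>K\<close>, the estimate has norm at most \<open>r * (a + K)\<close> and misses the mean by the rest of \<open>a\<close>.
Chebyshev's inequality bounds the probability of larger noise.\<close>

lemma EIG_risk_lower:
  fixes S :: "real^'k^'k"
  assumes S: "pos_def S" and d: "0 < d" and c: "0 < c" and K: "0 < K"
    and a: "sqrt (mahal_sq S \<theta>) = a"
    and small: "\<And>s. 0 \<le> s \<Longrightarrow> sqrt s \<le> a + K \<Longrightarrow> shrink_factor (real CARD('k)) d c s \<le> r"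
    and pos: "0 \<le> a - r * (a + K)"
  shows "ennreal ((a - r * (a + K))\<^sup>2 * (1 - 4 * sqrt 2 ^ CARD('k) / K\<^sup>2)) \<le> EIG_risk S d c \<theta>"
proof -
  define R where "R x = shrink_factor (real CARD('k)) d c (mahal_sq S x)" for x
  define t where "t = a - r * (a + K)"
  define near where "near = {x. mahal_sq S (x - \<theta>) \<le> K\<^sup>2}"
  have [measurable]: "near \<in> sets borel" unfolding near_def by measurable
  have t0: "0 \<le> t" using pos by (simp add: t_def)
  have bnd: "t\<^sup>2 \<le> mahal_sq S (R x *\<^sub>R x - \<theta>)" if "x \<in> near" for x
  proof -
    have sK: "sqrt (mahal_sq S (x - \<theta>)) \<le> K"
      using that K by (simp add: near_def real_le_lsqrt)
    have sx: "sqrt (mahal_sq S x) \<le> a + K"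
      using mahal_triangle[OF S, of \<theta> "x - \<theta>"] sK a by simp
    have R: "0 \<le> R x" "R x \<le> r"
      unfolding R_def using shrink_factor_bounds(1)[OF d c] small sx mahal_sq_nonneg[OF S] by auto
    have "a = sqrt (mahal_sq S ((- 1) *\<^sub>R (R x *\<^sub>R x - \<theta>) + R x *\<^sub>R x))"
      using a by simp
    also have "\<dots> \<le> sqrt (mahal_sq S ((- 1) *\<^sub>R (R x *\<^sub>R x - \<theta>))) + sqrt (mahal_sq S (R x *\<^sub>R x))"
      by (rule mahal_triangle[OF S])
    also have "sqrt (mahal_sq S ((- 1) *\<^sub>R (R x *\<^sub>R x - \<theta>))) = sqrt (mahal_sq S (R x *\<^sub>R x - \<theta>))"
      by (simp only: mahal_sq_scaleR) simp
    also have "sqrt (mahal_sq S (R x *\<^sub>R x)) = R x * sqrt (mahal_sq S x)"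
      using R by (simp add: mahal_sq_scaleR real_sqrt_mult)
    also have "\<dots> \<le> r * (a + K)" using R sx mahal_sq_nonneg[OF S] by (intro mult_mono) auto
    finally have "t \<le> sqrt (mahal_sq S (R x *\<^sub>R x - \<theta>))" by (simp add: t_def)
    then have "t\<^sup>2 \<le> (sqrt (mahal_sq S (R x *\<^sub>R x - \<theta>)))\<^sup>2" using t0 by (intro power_mono)
    then show ?thesis by (simp add: mahal_sq_nonneg[OF S])
  qed
  define M where "M = 4 * sqrt 2 ^ CARD('k)"
  have M: "0 \<le> M" by (simp add: M_def)
  have "ennreal (t\<^sup>2) = (\<integral>\<^sup>+x. ennreal (t\<^sup>2) \<partial>mvn \<theta> S)" by (rule nn_integral_mvn_const[OF S, symmetric])
  also have "\<dots> \<le> (\<integral>\<^sup>+x. ennreal (t\<^sup>2) * indicator near x + ennreal (t\<^sup>2 / K\<^sup>2) * ennreal (mahal_sq S (x - \<theta>)) \<partial>mvn \<theta> S)"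
  proof (rule nn_integral_mono)
    fix x
    show "ennreal (t\<^sup>2) \<le> ennreal (t\<^sup>2) * indicator near x + ennreal (t\<^sup>2 / K\<^sup>2) * ennreal (mahal_sq S (x - \<theta>))"
    proof (cases "x \<in> near")
      case False
      then have "1 \<le> mahal_sq S (x - \<theta>) / K\<^sup>2" using K by (simp add: near_def)
      then have "t\<^sup>2 * 1 \<le> t\<^sup>2 * (mahal_sq S (x - \<theta>) / K\<^sup>2)" by (intro mult_left_mono) auto
      then have "ennreal (t\<^sup>2) \<le> ennreal (t\<^sup>2 / K\<^sup>2 * mahal_sq S (x - \<theta>))" by (intro ennreal_leI) simp
      also have "\<dots> = ennreal (t\<^sup>2 / K\<^sup>2) * ennreal (mahal_sq S (x - \<theta>))"
        using mahal_sq_nonneg[OF S] by (intro ennreal_mult) auto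
      finally show ?thesis using False by simp
    qed simp
  qed
  also have "\<dots> = (\<integral>\<^sup>+x. ennreal (t\<^sup>2) * indicator near x \<partial>mvn \<theta> S)
      + ennreal (t\<^sup>2 / K\<^sup>2) * (\<integral>\<^sup>+x. ennreal (mahal_sq S (x - \<theta>)) \<partial>mvn \<theta> S)"
    by (subst nn_integral_add, measurable) (simp add: nn_integral_cmult)
  also have "\<dots> \<le> EIG_risk S d c \<theta> + ennreal (t\<^sup>2 / K\<^sup>2) * ennreal M"
  proof (intro add_mono mult_left_mono)
    show "(\<integral>\<^sup>+x. ennreal (t\<^sup>2) * indicator near x \<partial>mvn \<theta> S) \<le> EIG_risk S d c \<theta>"
      unfolding EIG_risk_def EIG_estimator_eq[OF S d c] R_def[symmetric]
      by (intro nn_integral_mono) (auto simp: indicator_def intro!: ennreal_leI bnd)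
  qed (auto simp: M_def intro: mvn_second_moment_le[OF S])
  also have "ennreal (t\<^sup>2 / K\<^sup>2) * ennreal M = ennreal (t\<^sup>2 / K\<^sup>2 * M)"
    using M by (intro ennreal_mult[symmetric]) auto
  finally have "ennreal (t\<^sup>2) - ennreal (t\<^sup>2 / K\<^sup>2 * M) \<le> EIG_risk S d c \<theta>"
    by (simp add: ennreal_minus_le_iff add.commute)
  moreover have "ennreal (t\<^sup>2) - ennreal (t\<^sup>2 / K\<^sup>2 * M) = ennreal (t\<^sup>2 - t\<^sup>2 / K\<^sup>2 * M)"
    using M by (intro ennreal_minus) simp
  moreover have "t\<^sup>2 - t\<^sup>2 / K\<^sup>2 * M = t\<^sup>2 * (1 - M / K\<^sup>2)" by (simp add: algebra_simps)
  ultimately show ?thesis by (simp add: t_def M_def)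
qed

text \<open>Below the level \<open>T\<close>, the bound \<open>R s\<close> of order \<open>c powr d * exp (s / 2)\<close> cancels the Gaussian density, and what remains is of the order of \<open>T\<close> times the volume of
a ball of radius \<open>sqrt T\<close>. Above \<open>T\<close>, the bound \<open>R s \<le> 1\<close> and the Gaussian tail suffice.\<close>

lemma EIG_zero_risk_upper:
  fixes S :: "real^'k^'k"
  assumes S: "pos_def S" and d: "0 < d" "d < 1"
  obtains C where "0 < C" "\<And>c T. 0 < c \<Longrightarrow> c \<le> 1 \<Longrightarrow> 1 \<le> T \<Longrightarrow>
    (\<integral>\<^sup>+x. ennreal (mahal_sq S (EIG_estimator S d c x)) \<partial>mvn 0 S)
      \<le> ennreal (C * (c powr d * (T * sqrt T ^ CARD('k)) + exp (- 3 * T / 8)))"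
proof -
  obtain C1 where C1: "0 < C1" "\<And>c s. 0 < c \<Longrightarrow> c \<le> 1 \<Longrightarrow> 0 \<le> s \<Longrightarrow>
    shrink_factor (real CARD('k)) d c s \<le> C1 * (c powr d * exp (s / 2))"
    using shrink_factor_upper[OF d, of "real CARD('k)"] by auto
  define C where "C = max (C1 * exp (1/2)) (16 * sqrt 8 ^ CARD('k))"
  have C: "0 < C" "C1 * exp (1/2) \<le> C" "16 * sqrt 8 ^ CARD('k) \<le> C"
    using C1(1) by (auto simp: C_def less_max_iff_disj)
  have main: "(\<integral>\<^sup>+x. ennreal (mahal_sq S (EIG_estimator S d c x)) \<partial>mvn 0 S)
      \<le> ennreal (C * (c powr d * (T * sqrt T ^ CARD('k)) + exp (- 3 * T / 8)))"
    if c: "0 < c" "c \<le> 1" and T: "1 \<le> T" for c T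
  proof -
    define R where "R x = shrink_factor (real CARD('k)) d c (mahal_sq S x)" for x
    define A where "A = C1 * c powr d * T * exp (1/2)"
    define B where "B = 16 * exp (- 3 * T / 8)"
    have AB: "0 \<le> A" "0 \<le> B" using C1(1) T by (auto simp: A_def B_def)
    have bnd: "mahal_sq S (R x *\<^sub>R x) \<le> A * exp (mahal_sq S (x - 0) / 2 - mahal_sq S (x - 0) / (2 * T))
        + B * exp (mahal_sq S (x - 0) / 2 - mahal_sq S (x - 0) / (2 * 8))" for x
    proof -
      define s where "s = mahal_sq S x"
      have s: "0 \<le> s" by (simp add: s_def mahal_sq_nonneg[OF S])
      have R: "0 \<le> R x" "R x \<le> 1" "R x \<le> C1 * (c powr d * exp (s / 2))"
        unfolding R_def s_def[symmetric] using shrink_factor_bounds[OF d(1) c(1) _ s] C1(2)[OF c s] by auto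
      have "(R x)\<^sup>2 \<le> R x" using R by (simp add: power2_eq_square mult_left_le)
      then have "(R x)\<^sup>2 * s \<le> R x * s" using s by (intro mult_right_mono)
      also have "R x * s \<le> A * exp (s / 2 - s / (2 * T)) + B * exp (s / 2 - s / (2 * 8))"
      proof (cases "s \<le> T")
        case True
        have "s / (2 * T) \<le> 1 / 2" using True T by (simp add: field_simps)
        then have "exp (s / 2) \<le> exp (1 / 2 + (s / 2 - s / (2 * T)))" by simp
        then have E: "exp (s / 2) \<le> exp (1 / 2) * exp (s / 2 - s / (2 * T))" by (simp only: exp_add)
        have "R x * s \<le> C1 * (c powr d * exp (s / 2)) * T"
          using R True s C1(1) by (intro mult_mono) auto
        also have "\<dots> \<le> C1 * (c powr d * (exp (1 / 2) * exp (s / 2 - s / (2 * T)))) * T"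
          using E C1(1) T by (intro mult_right_mono mult_left_mono) auto
        also have "\<dots> = A * exp (s / 2 - s / (2 * T))" by (simp add: A_def)
        finally show ?thesis using AB by (simp add: add_increasing2)
      next
        case False
        \<comment> \<open>\<open>s / 16 = 7 * s / 16 - 3 * s / 8\<close>, and \<open>s > T\<close> in the last term; \<open>7 * s / 16\<close> is the exponent at scale \<open>v = 8\<close>\<close>
        have "s \<le> 16 * exp (s / 16)" using exp_ge_add_one_self[of "s / 16"] by (simp add: field_simps)
        also have "\<dots> \<le> 16 * exp (- 3 * T / 8 + (s / 2 - s / (2 * 8)))"
          using False by simp
        also have "\<dots> = B * exp (s / 2 - s / (2 * 8))" unfolding exp_add B_def by simp
        finally have "s \<le> B * exp (s / 2 - s / (2 * 8))" .
        moreover have "R x * s \<le> s" using R s by (simp add: mult_left_le_one_le)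
        moreover have "0 \<le> A * exp (s / 2 - s / (2 * T))" using AB by simp
        ultimately show ?thesis by linarith
      qed
      finally show ?thesis by (simp add: mahal_sq_scaleR s_def)
    qed
    have "(\<integral>\<^sup>+x. ennreal (mahal_sq S (EIG_estimator S d c x)) \<partial>mvn 0 S)
       \<le> (\<integral>\<^sup>+x. ennreal A * ennreal (exp (mahal_sq S (x - 0) / 2 - mahal_sq S (x - 0) / (2 * T)))
          + ennreal B * ennreal (exp (mahal_sq S (x - 0) / 2 - mahal_sq S (x - 0) / (2 * 8))) \<partial>mvn 0 S)"
      unfolding EIG_estimator_eq[OF S d(1) c(1)] R_def[symmetric]
    proof (rule nn_integral_mono)
      fix x
      have "ennreal (mahal_sq S (R x *\<^sub>R x)) \<le> ennreal (A * exp (mahal_sq S (x - 0) / 2 - mahal_sq S (x - 0) / (2 * T))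
        + B * exp (mahal_sq S (x - 0) / 2 - mahal_sq S (x - 0) / (2 * 8)))"
        by (rule ennreal_leI[OF bnd])
      also have "\<dots> = ennreal A * ennreal (exp (mahal_sq S (x - 0) / 2 - mahal_sq S (x - 0) / (2 * T)))
          + ennreal B * ennreal (exp (mahal_sq S (x - 0) / 2 - mahal_sq S (x - 0) / (2 * 8)))"
        using AB by (subst ennreal_plus) (auto intro!: arg_cong2[where f = "(+)"] ennreal_mult)
      finally show "ennreal (mahal_sq S (R x *\<^sub>R x)) \<le> ennreal A * ennreal (exp (mahal_sq S (x - 0) / 2 - mahal_sq S (x - 0) / (2 * T)))
          + ennreal B * ennreal (exp (mahal_sq S (x - 0) / 2 - mahal_sq S (x - 0) / (2 * 8)))" .
    qed
    also have "\<dots> = ennreal A * ennreal (sqrt T ^ CARD('k)) + ennreal B * ennreal (sqrt 8 ^ CARD('k))"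
    proof -
      have T0: "0 < T" using T by simp
      have cm: "(\<integral>\<^sup>+x. ennreal a * ennreal (exp (mahal_sq S (x - 0) / 2 - mahal_sq S (x - 0) / (2 * v))) \<partial>mvn 0 S)
          = ennreal a * ennreal (sqrt v ^ CARD('k))" if "0 < v" for a v
        by (subst nn_integral_cmult, measurable) (simp only: nn_integral_mvn_exp[OF S that])
      show ?thesis
        by (subst nn_integral_add, measurable) (simp only: cm[OF T0] cm[of 8] zero_less_numeral)
    qed
    also have "\<dots> = ennreal (A * sqrt T ^ CARD('k) + B * sqrt 8 ^ CARD('k))"
      using AB T by (subst ennreal_plus) (auto intro!: arg_cong2[where f = "(+)"] ennreal_mult[symmetric])
    also have "\<dots> \<le> ennreal (C * (c powr d * (T * sqrt T ^ CARD('k)) + exp (- 3 * T / 8)))"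
    proof (rule ennreal_leI)
      have "A * sqrt T ^ CARD('k) + B * sqrt 8 ^ CARD('k)
        = (C1 * exp (1/2)) * (c powr d * (T * sqrt T ^ CARD('k))) + (16 * sqrt 8 ^ CARD('k)) * exp (- 3 * T / 8)"
        by (simp add: A_def B_def)
      also have "\<dots> \<le> C * (c powr d * (T * sqrt T ^ CARD('k))) + C * exp (- 3 * T / 8)"
        using C T by (intro add_mono mult_right_mono) auto
      finally show "A * sqrt T ^ CARD('k) + B * sqrt 8 ^ CARD('k) \<le> C * (c powr d * (T * sqrt T ^ CARD('k)) + exp (- 3 * T / 8))"
        by (simp add: algebra_simps)
    qed
    finally show ?thesis .
  qed
  show ?thesis by (rule that[OF C(1) main])
qed

section \<open>Rates as the sparsity level vanishes\<close>

text \<open>The factor \<open>exp L\<close> stands for \<open>n / q\<close>. It is compensated by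
\<open>c powr d\<close> up to \<open>exp (- (L / ln L))\<close>, which decays faster than any power of \<open>L\<close>.\<close>

lemma EIG_zero_risk_rate:
  fixes S :: "real^'k^'k"
  assumes S: "pos_def S" and d: "0 < d" "d < 1"
  obtains z where "(z \<longlongrightarrow> 0) at_top" "\<And>L. 1 \<le> L \<Longrightarrow> 0 \<le> z L"
    "\<And>L c. 1 \<le> L \<Longrightarrow> 0 < c \<Longrightarrow> c \<le> 1 \<Longrightarrow> c powr d = exp (- (L + L / ln L)) \<Longrightarrow>
      ennreal (exp L) * (\<integral>\<^sup>+x. ennreal (mahal_sq S (EIG_estimator S d c x)) \<partial>mvn 0 S) \<le> ennreal (L * z L)"
proof -
  obtain C where C: "0 < C" "\<And>c T. 0 < c \<Longrightarrow> c \<le> 1 \<Longrightarrow> 1 \<le> T \<Longrightarrow>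
    (\<integral>\<^sup>+x. ennreal (mahal_sq S (EIG_estimator S d c x)) \<partial>mvn 0 S)
      \<le> ennreal (C * (c powr d * (T * sqrt T ^ CARD('k)) + exp (- 3 * T / 8)))"
    using EIG_zero_risk_upper[OF S d] by metis
  define p where "p = real CARD('k) / 2"
  \<comment> \<open>the risk bound with level \<open>T = 4 * L\<close>\<close>
  define z where "z L = C * (exp (- (L / ln L)) * (4 * L * (4 * L) powr p) / L + exp (- L / 2) / L)" for L :: real
  have "((\<lambda>L. exp (- (L / ln L)) * (4 * L * (4 * L) powr p) / L) \<longlongrightarrow> 0) at_top" by real_asymp
  moreover have "((\<lambda>L::real. exp (- L / 2) / L) \<longlongrightarrow> 0) at_top" by real_asymp
  ultimately have "((\<lambda>L. C * (exp (- (L / ln L)) * (4 * L * (4 * L) powr p) / L + exp (- L / 2) / L)) \<longlongrightarrow> C * (0 + 0)) at_top"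
    by (intro tendsto_intros)
  then have z0: "(z \<longlongrightarrow> 0) at_top" by (simp only: z_def[abs_def] add_0 mult_zero_right)
  have "0 \<le> z L" if "1 \<le> L" for L using that C(1) by (simp add: z_def)
  moreover have "ennreal (exp L) * (\<integral>\<^sup>+x. ennreal (mahal_sq S (EIG_estimator S d c x)) \<partial>mvn 0 S) \<le> ennreal (L * z L)"
    if L: "1 \<le> L" and c: "0 < c" "c \<le> 1" and cd: "c powr d = exp (- (L + L / ln L))" for L c
  proof -
    have sq: "sqrt (4 * L) ^ CARD('k) = (4 * L) powr p"
      using L by (simp add: p_def powr_half_sqrt[symmetric] powr_realpow[symmetric] powr_powr)
    have "ennreal (exp L) * (\<integral>\<^sup>+x. ennreal (mahal_sq S (EIG_estimator S d c x)) \<partial>mvn 0 S)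
       \<le> ennreal (exp L) * ennreal (C * (c powr d * (4 * L * sqrt (4 * L) ^ CARD('k)) + exp (- 3 * (4 * L) / 8)))"
      using L c by (intro mult_left_mono C(2)) auto
    also have "\<dots> = ennreal (exp L * (C * (c powr d * (4 * L * sqrt (4 * L) ^ CARD('k)) + exp (- 3 * (4 * L) / 8))))"
      using C(1) L by (intro ennreal_mult[symmetric]) auto
    also have "exp L * (C * (c powr d * (4 * L * sqrt (4 * L) ^ CARD('k)) + exp (- 3 * (4 * L) / 8)))
       = C * ((exp L * exp (- (L + L / ln L))) * (4 * L * (4 * L) powr p) + exp L * exp (- 3 * (4 * L) / 8))"
      unfolding cd sq by (simp add: algebra_simps)
    also have "exp L * exp (- (L + L / ln L)) = exp (- (L / ln L))" by (simp add: exp_add[symmetric])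
    also have "exp L * exp (- 3 * (4 * L) / 8) = exp (- L / 2)" by (simp add: exp_add[symmetric])
    also have "C * (exp (- (L / ln L)) * (4 * L * (4 * L) powr p) + exp (- L / 2)) = L * z L"
      using L by (simp add: z_def algebra_simps)
    finally show ?thesis .
  qed
  ultimately show ?thesis using that[OF z0] by blast
qed

text \<open>For \<open>s \<le> 2 * (1 + h) * L\<close> the bias is at most \<open>sqrt s\<close>; for larger \<open>s\<close> it is at most \<open>2\<close>, because \<open>s\<close> then exceeds the
threshold \<open>2 * (L + L / ln L)\<close> by a constant factor.\<close>

lemma EIG_nonzero_risk_rate:
  fixes S :: "real^'k^'k"
  assumes S: "pos_def S" and d: "0 < d" and h: "0 < h" "h < 1"
  shows "\<forall>\<^sub>F L in at_top. \<forall>c \<theta>. 0 < c \<longrightarrow> c \<le> 1 \<longrightarrow> c powr d = exp (- (L + L / ln L)) \<longrightarrow>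
    EIG_risk S d c \<theta> \<le> ennreal (2 * L * (1 + 4 * h))"
proof -
  define k where "k = real CARD('k)"
  have k: "0 \<le> k" by (simp add: k_def)
  \<comment> \<open>then \<open>(1 - \<gamma>) * s / 2\<close> exceeds \<open>L * (1 + h / 2)\<close>, hence \<open>ln (c powr (- d))\<close>, for \<open>s > 2 * (1 + h) * L\<close>\<close>
  define \<gamma> where "\<gamma> = h / (2 * (1 + h))"
  have \<gamma>: "0 < \<gamma>" "\<gamma> \<le> 1" "(1 - \<gamma>) * (1 + h) = 1 + h / 2"
    using h by (auto simp: \<gamma>_def field_simps)
  obtain s0 where s0: "1 \<le> s0"
    "\<And>c s. 0 < c \<Longrightarrow> c \<le> 1 \<Longrightarrow> s0 \<le> s \<Longrightarrow> c powr (- d) \<le> exp ((1 - \<gamma>) * s / 2) \<Longrightarrow>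
      (1 - shrink_factor k d c s) * sqrt s \<le> 2"
    using shrink_factor_bias[OF d k \<gamma>(1,2)] by metis
  define M where "M = 4 * sqrt 2 ^ CARD('k)"
  have "((\<lambda>L::real. 1 / ln L) \<longlongrightarrow> 0) at_top" by real_asymp
  then have ev1: "\<forall>\<^sub>F L::real in at_top. 1 / ln L < h / 2"
    using h by (intro order_tendstoD) auto
  have ev2: "\<forall>\<^sub>F L::real in at_top. max (max s0 2) ((1 + 1 / h) * M / (2 * h)) \<le> L"
    by (rule eventually_ge_at_top)
  show ?thesis using ev1 ev2
  proof eventually_elim
    case (elim L)
    then have L: "s0 \<le> L" "2 \<le> L" "(1 + 1 / h) * M / (2 * h) \<le> L" by auto
    show ?case
    proof (intro allI impI)
      fix c :: real and \<theta> :: "real^'k"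
      assume c: "0 < c" "c \<le> 1" and cd: "c powr d = exp (- (L + L / ln L))"
      define b where "b = sqrt (2 * (1 + h) * L)"
      have b0: "0 \<le> b" using L h by (simp add: b_def)
      have b2: "b\<^sup>2 = 2 * (1 + h) * L" using L h by (simp add: b_def)
      have "4 \<le> 2 * (1 + h) * L"
        using mult_mono[of 1 "1 + h" 2 L] L h by (simp add: algebra_simps)
      then have "sqrt 4 \<le> b" unfolding b_def by (rule real_sqrt_le_mono)
      then have two: "2 \<le> b" by simp
      have bias: "(1 - shrink_factor (real CARD('k)) d c s) * sqrt s \<le> b" if s: "0 \<le> s" for s
      proof (cases "s \<le> 2 * (1 + h) * L")
        case True
        have "(1 - shrink_factor k d c s) * sqrt s \<le> 1 * sqrt s"
          using shrink_factor_bounds[OF d c(1) k s] s by (intro mult_right_mono) auto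
        also have "\<dots> \<le> b" using True by (simp add: b_def)
        finally show ?thesis by (simp add: k_def)
      next
        case False
        have "L \<le> 2 * (1 + h) * L" using L h by simp
        then have ss: "s0 \<le> s" using False L by linarith
        have "c powr (- d) = exp (L + L / ln L)"
          by (simp only: powr_minus cd exp_minus inverse_inverse_eq)
        also have "\<dots> \<le> exp ((1 - \<gamma>) * s / 2)"
        proof -
          have "L * (1 / ln L) \<le> L * (h / 2)" using elim L by (intro mult_left_mono) auto
          then have "L + L / ln L \<le> L * (1 + h / 2)" by (simp add: algebra_simps)
          also have "\<dots> = (1 - \<gamma>) * ((1 + h) * L)" using \<gamma>(3) by (simp add: mult_ac)
          also have "\<dots> \<le> (1 - \<gamma>) * (s / 2)"
            using False \<gamma>(2) by (intro mult_left_mono) (auto simp: algebra_simps not_le)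
          finally show ?thesis by simp
        qed
        finally have "(1 - shrink_factor k d c s) * sqrt s \<le> 2" by (rule s0(2)[OF c ss])
        then show ?thesis using two by (simp add: k_def)
      qed
      have "EIG_risk S d c \<theta> \<le> ennreal ((1 + h) * b\<^sup>2 + (1 + 1 / h) * M)"
        unfolding M_def by (rule EIG_risk_upper[OF S d c(1) b0 h(1) bias])
      also have "\<dots> \<le> ennreal (2 * L * (1 + 4 * h))"
      proof (rule ennreal_leI)
        have "(1 + 1 / h) * M \<le> 2 * L * h" using L(3) h by (simp add: field_simps)
        moreover have "(1 + h) * b\<^sup>2 = 2 * L * ((1 + h) * (1 + h))" by (simp add: b2)
        moreover have "2 * L * ((1 + h) * (1 + h)) \<le> 2 * L * (1 + 3 * h)"
          using L h by (intro mult_left_mono) (auto simp: algebra_simps mult_left_le)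
        ultimately have "(1 + h) * b\<^sup>2 + (1 + 1 / h) * M \<le> 2 * L * (1 + 3 * h) + 2 * L * h" by linarith
        also have "\<dots> = 2 * L * (1 + 4 * h)" by (simp add: algebra_simps)
        finally show "(1 + h) * b\<^sup>2 + (1 + 1 / h) * M \<le> 2 * L * (1 + 4 * h)" .
      qed
      finally show "EIG_risk S d c \<theta> \<le> ennreal (2 * L * (1 + 4 * h))" .
    qed
  qed
qed

lemma mahal_sphere_nonempty:
  fixes S :: "real^'k^'k"
  assumes S: "pos_def S" and a: "0 < a"
  obtains \<theta> where "\<theta> \<noteq> 0" "sqrt (mahal_sq S \<theta>) = a"
proof -
  obtain b where b: "0 < b" "\<And>x. norm x \<le> b * sqrt (mahal_sq S x)" using norm_le_mahal[OF S] by metis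
  define x :: "real^'k" where "x = axis undefined 1"
  have "norm x = 1" by (simp add: x_def)
  then have m: "0 < sqrt (mahal_sq S x)" using b(2)[of x] b(1) by (metis not_le zero_less_mult_iff zero_less_one less_le_trans less_asym)
  show ?thesis
  proof
    show "(a / sqrt (mahal_sq S x)) *\<^sub>R x \<noteq> 0" using m a \<open>norm x = 1\<close> by auto
    show "sqrt (mahal_sq S ((a / sqrt (mahal_sq S x)) *\<^sub>R x)) = a"
      using m a by (simp add: mahal_sq_scaleR real_sqrt_mult)
  qed
qed

text \<open>A mean with squared Mahalanobis norm \<open>2 * (1 - h) * L\<close> stays below the threshold even after adding noise of bounded norm.\<close>

lemma EIG_worst_risk_rate:
  fixes S :: "real^'k^'k"
  assumes S: "pos_def S" and d: "0 < d" "d < 1" and h: "0 < h" "h < 1"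
  shows "\<forall>\<^sub>F L in at_top. \<forall>c. 0 < c \<longrightarrow> c \<le> 1 \<longrightarrow> c powr d = exp (- (L + L / ln L)) \<longrightarrow>
    (\<exists>\<theta>. \<theta> \<noteq> 0 \<and> ennreal (2 * L * (1 - 4 * h)) \<le> EIG_risk S d c \<theta>)"
proof -
  obtain C where C: "0 < C" "\<And>c s. 0 < c \<Longrightarrow> c \<le> 1 \<Longrightarrow> 0 \<le> s \<Longrightarrow>
    shrink_factor (real CARD('k)) d c s \<le> C * (c powr d * exp (s / 2))"
    using shrink_factor_upper[OF d, of "real CARD('k)"] by auto
  define M where "M = 4 * sqrt 2 ^ CARD('k)"
  have M: "0 < M" by (simp add: M_def)
  \<comment> \<open>noise of norm above \<open>K\<close> has probability at most \<open>h\<close>\<close>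
  define K where "K = sqrt (M / h)"
  have K: "0 < K" "M / K\<^sup>2 = h" using M h by (auto simp: K_def)
  define a where "a L = sqrt (2 * (1 - h) * L)" for L
  define r where "r L = C * exp (- L + (a L + K)\<^sup>2 / 2)" for L
  define t where "t L = a L - r L * (a L + K)" for L
  define l where "l = 1 - h"
  have l: "0 < l" "l < 1" using h by (auto simp: l_def)
  define w where "w = sqrt (2 * l)"
  have w: "0 < w" using l by (simp add: w_def)
  have "((\<lambda>L. C * exp (- (h * L) + K * w * sqrt L + K\<^sup>2 / 2) * (w * sqrt L + K)) \<longlongrightarrow> 0) at_top"
    using w h(1) K(1) C(1) by real_asymp
  moreover have "\<forall>\<^sub>F L in at_top. C * exp (- (h * L) + K * w * sqrt L + K\<^sup>2 / 2) * (w * sqrt L + K) = r L * (a L + K)"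
    using eventually_ge_at_top[of 0]
  proof eventually_elim
    case (elim L)
    have aw: "a L = w * sqrt L" by (simp add: a_def w_def l_def real_sqrt_mult)
    have "w\<^sup>2 = 2 * (1 - h)" using l by (simp add: w_def l_def)
    then have "(a L)\<^sup>2 = 2 * (1 - h) * L" using elim by (simp add: aw power_mult_distrib)
    then have "- (h * L) + K * w * sqrt L + K\<^sup>2 / 2 = - L + (a L + K)\<^sup>2 / 2"
      by (simp add: power2_sum aw field_simps)
    then show ?case by (simp add: r_def aw)
  qed
  ultimately have lim: "((\<lambda>L. r L * (a L + K)) \<longlongrightarrow> 0) at_top"
    by (rule Lim_transform_eventually)
  have ev1: "\<forall>\<^sub>F L in at_top. r L * (a L + K) < h"
    using lim h by (intro order_tendstoD) auto
  have "filterlim (\<lambda>L. sqrt (2 * l * L)) at_top at_top" using l by real_asymp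
  then have ev2: "\<forall>\<^sub>F L in at_top. 2 \<le> a L"
    by (simp add: filterlim_at_top a_def l_def)
  show ?thesis using ev1 ev2 eventually_gt_at_top[of 1]
  proof eventually_elim
    case (elim L)
    show ?case
    proof (intro allI impI)
      fix c :: real assume c: "0 < c" "c \<le> 1" and cd: "c powr d = exp (- (L + L / ln L))"
      have a0: "0 < a L" using elim by simp
      obtain \<theta> :: "real^'k" where \<theta>: "\<theta> \<noteq> 0" "sqrt (mahal_sq S \<theta>) = a L"
        using mahal_sphere_nonempty[OF S a0] by metis
      have small: "shrink_factor (real CARD('k)) d c s \<le> r L" if s: "0 \<le> s" "sqrt s \<le> a L + K" for s
      proof -
        have "s = (sqrt s)\<^sup>2" using s by simp
        also have "\<dots> \<le> (a L + K)\<^sup>2" using s by (intro power_mono) auto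
        finally have le: "s \<le> (a L + K)\<^sup>2" .
        have ln0: "0 \<le> L / ln L" using elim by simp
        have "shrink_factor (real CARD('k)) d c s \<le> C * (c powr d * exp (s / 2))"
          by (rule C(2)[OF c s(1)])
        also have "c powr d * exp (s / 2) = exp (- (L + L / ln L) + s / 2)" by (simp only: cd exp_add)
        also have "C * \<dots> \<le> r L"
          unfolding r_def using C(1) le ln0 by (intro mult_left_mono) auto
        finally show ?thesis .
      qed
      have rt: "r L * (a L + K) < h" by (rule elim(1))
      have t1: "a L - h \<le> t L" using rt by (simp add: t_def)
      have t0: "0 \<le> a L - r L * (a L + K)" using t1 h elim by (simp add: t_def)
      have "2 * L * (1 - 4 * h) \<le> (t L)\<^sup>2 * (1 - M / K\<^sup>2)"
      proof -
        have "a L * (1 - h) \<le> a L - h" using elim h by (simp add: algebra_simps)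
        also note t1
        finally have "(a L * (1 - h))\<^sup>2 \<le> (t L)\<^sup>2" using a0 h by (intro power_mono) auto
        then have "(a L * (1 - h))\<^sup>2 * (1 - h) \<le> (t L)\<^sup>2 * (1 - M / K\<^sup>2)"
          unfolding K(2) using h by (intro mult_right_mono) auto
        moreover have "(a L)\<^sup>2 = 2 * (1 - h) * L" using elim h by (simp add: a_def)
        then have "(a L * (1 - h))\<^sup>2 * (1 - h) = 2 * L * (1 - h) ^ 4"
          by (simp add: power_mult_distrib power2_eq_square power4_eq_xxxx)
        moreover have "1 - 4 * h \<le> (1 - h) ^ 4"
          using Bernoulli_inequality[of "- h" 4] h by simp
        then have "2 * L * (1 - 4 * h) \<le> 2 * L * (1 - h) ^ 4" using elim by (intro mult_left_mono) auto
        ultimately show ?thesis by linarith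
      qed
      then have "ennreal (2 * L * (1 - 4 * h)) \<le> ennreal ((t L)\<^sup>2 * (1 - M / K\<^sup>2))" by (rule ennreal_leI)
      also have "\<dots> \<le> EIG_risk S d c \<theta>"
        unfolding M_def t_def by (rule EIG_risk_lower[OF S d(1) c(1) K(1) \<theta>(2) small t0])
      finally show "\<exists>\<theta>. \<theta> \<noteq> 0 \<and> ennreal (2 * L * (1 - 4 * h)) \<le> EIG_risk S d c \<theta>" using \<theta>(1) by blast
    qed
  qed
qed

section \<open>Sums over nearly black means\<close>

lemma nearly_black_card:
  assumes "\<theta> \<in> nearly_black n m"
  shows "card {i \<in> {1..n}. \<theta> i \<noteq> 0} \<le> m"
proof -
  have "(\<Sum>i=1..n. of_bool (\<theta> i \<noteq> 0)) = card ({1..n} \<inter> {i. \<theta> i \<noteq> 0})"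
    by (simp add: sum_of_bool_eq)
  moreover have "{1..n} \<inter> {i. \<theta> i \<noteq> 0} = {i \<in> {1..n}. \<theta> i \<noteq> 0}" by auto
  ultimately show ?thesis using assms by (simp add: nearly_black_def)
qed

lemma ennreal_divide_le:
  assumes "x \<le> ennreal (y * z)" "0 < y"
  shows "x / ennreal y \<le> ennreal z"
proof (cases "0 \<le> z")
  case True
  have "x / ennreal y \<le> ennreal (y * z) / ennreal y" using assms(1) by (rule divide_right_mono_ennreal)
  also have "\<dots> = ennreal z" using assms(2) True by (simp add: divide_ennreal)
  finally show ?thesis .
next
  case False
  then have "ennreal (y * z) = 0" using assms(2) by (simp add: ennreal_neg mult_nonneg_nonpos)
  then show ?thesis using assms(1) by simp
qed

lemma ennreal_le_divide:
  assumes "ennreal (y * z) \<le> x" "0 < y"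
  shows "ennreal z \<le> x / ennreal y"
proof (cases "0 \<le> z")
  case True
  have "ennreal z = ennreal (y * z) / ennreal y" using assms(2) True by (simp add: divide_ennreal)
  also have "\<dots> \<le> x / ennreal y" using assms(1) by (rule divide_right_mono_ennreal)
  finally show ?thesis .
qed (simp add: ennreal_neg)

lemma zero_part_sum_le:
  fixes Z :: ennreal and \<theta> :: "nat \<Rightarrow> real^'k"
  assumes n: "real n = real m * exp L" and m: "0 < m" and L: "0 < L"
    and Z: "ennreal (exp L) * Z \<le> ennreal (L * z)"
  shows "(\<Sum>i \<in> {i \<in> {1..n}. \<theta> i = 0}. Z) \<le> ennreal (real m * L * z)"
proof -
  have "card {i \<in> {1..n}. \<theta> i = 0} \<le> card {1..n}" by (rule card_mono) auto
  then have "(\<Sum>i \<in> {i \<in> {1..n}. \<theta> i = 0}. Z) \<le> ennreal (real n) * Z"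
    by (simp add: ennreal_of_nat_eq_real_of_nat mult_right_mono)
  also have "\<dots> = ennreal (real m) * (ennreal (exp L) * Z)"
    unfolding n by (simp add: ennreal_mult mult.assoc)
  also have "\<dots> \<le> ennreal (real m) * ennreal (L * z)" by (intro mult_left_mono Z) simp
  also have "\<dots> = ennreal (real m * L * z)" by (simp add: ennreal_mult'[symmetric] mult.assoc)
  finally show ?thesis .
qed

lemma nonzero_part_le:
  fixes \<rho> :: "real^'k \<Rightarrow> ennreal" and \<theta> :: "nat \<Rightarrow> real^'k"
  assumes \<theta>: "\<theta> \<in> nearly_black n m" and m: "0 < m" and L: "0 < L"
    and r: "\<And>\<eta>. \<rho> \<eta> \<le> ennreal (2 * L * z)"
  shows "(\<Sum>i \<in> {i \<in> {1..n}. \<theta> i \<noteq> 0}. \<rho> (\<theta> i)) / ennreal (2 * real m * L) \<le> ennreal z"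
proof (rule ennreal_divide_le)
  have "(\<Sum>i \<in> {i \<in> {1..n}. \<theta> i \<noteq> 0}. \<rho> (\<theta> i)) \<le> (\<Sum>i \<in> {i \<in> {1..n}. \<theta> i \<noteq> 0}. ennreal (2 * L * z))"
    by (intro sum_mono r)
  also have "\<dots> \<le> ennreal (real m) * ennreal (2 * L * z)"
    using nearly_black_card[OF \<theta>] by (simp add: ennreal_of_nat_eq_real_of_nat mult_right_mono)
  also have "\<dots> = ennreal (2 * real m * L * z)" by (simp add: ennreal_mult'[symmetric] mult_ac)
  finally show "(\<Sum>i \<in> {i \<in> {1..n}. \<theta> i \<noteq> 0}. \<rho> (\<theta> i)) \<le> ennreal (2 * real m * L * z)" .
qed (use m L in simp)

text \<open>The supremum is tested at the configuration with \<open>\<eta>\<close> in the first \<open>m\<close> places and \<open>0\<close> elsewhere.\<close>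

lemma total_ge:
  fixes \<rho> :: "real^'k \<Rightarrow> ennreal"
  assumes mn: "m \<le> n" and m: "0 < m" and L: "0 < L" and \<eta>: "ennreal (2 * L * z) \<le> \<rho> \<eta>" "\<eta> \<noteq> 0"
  shows "ennreal z \<le> (SUP \<theta> \<in> (nearly_black n m :: (nat \<Rightarrow> real^'k) set). (\<Sum>i=1..n. \<rho> (\<theta> i)) / ennreal (2 * real m * L))"
proof -
  define \<theta> where "\<theta> = (\<lambda>i\<in>{1..n}. if i \<le> m then \<eta> else 0)"
  have "(\<Sum>i=1..n. of_bool (\<theta> i \<noteq> 0)) = (\<Sum>i=1..n. of_bool (i \<le> m))"
    using \<eta>(2) by (intro sum.cong) (auto simp: \<theta>_def)
  also have "\<dots> = card ({1..n} \<inter> {i. i \<le> m})" by (simp add: sum_of_bool_eq)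
  also have "{1..n} \<inter> {i. i \<le> m} = {1..m}" using mn by auto
  finally have m_eq: "(\<Sum>i=1..n. of_bool (\<theta> i \<noteq> 0)) = m" by simp
  have "\<theta> \<in> {1..n} \<rightarrow>\<^sub>E UNIV" by (auto simp: \<theta>_def)
  then have nb: "\<theta> \<in> nearly_black n m"
    unfolding nearly_black_def by (intro CollectI conjI eq_refl[OF m_eq])
  have "ennreal (2 * real m * L * z) = ennreal (real m) * ennreal (2 * L * z)"
    by (simp add: ennreal_mult'[symmetric] mult_ac)
  also have "\<dots> \<le> ennreal (real m) * \<rho> \<eta>" by (intro mult_left_mono \<eta>) simp
  also have "\<dots> = (\<Sum>i=1..m. \<rho> (\<theta> i))"
    using mn by (simp add: \<theta>_def ennreal_of_nat_eq_real_of_nat)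
  also have "\<dots> \<le> (\<Sum>i=1..n. \<rho> (\<theta> i))" using mn by (intro sum_mono2) auto
  finally have "ennreal z \<le> (\<Sum>i=1..n. \<rho> (\<theta> i)) / ennreal (2 * real m * L)"
    using m L by (intro ennreal_le_divide) auto
  also have "\<dots> \<le> (SUP \<theta> \<in> (nearly_black n m :: (nat \<Rightarrow> real^'k) set). (\<Sum>i=1..n. \<rho> (\<theta> i)) / ennreal (2 * real m * L))"
    by (intro SUP_upper nb)
  finally show ?thesis .
qed

lemma total_le:
  fixes \<rho> :: "real^'k \<Rightarrow> ennreal" and \<theta> :: "nat \<Rightarrow> real^'k"
  assumes \<theta>: "\<theta> \<in> nearly_black n m" and n: "real n = real m * exp L" and m: "0 < m" and L: "0 < L"
    and Z: "ennreal (exp L) * \<rho> 0 \<le> ennreal (L * y)"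
    and r: "\<And>\<eta>. \<rho> \<eta> \<le> ennreal (2 * L * z)" and yz: "0 \<le> y" "0 \<le> z"
  shows "(\<Sum>i=1..n. \<rho> (\<theta> i)) / ennreal (2 * real m * L) \<le> ennreal (y + z)"
proof -
  define D where "D = ennreal (2 * real m * L)"
  let ?A = "{i \<in> {1..n}. \<theta> i = 0}" and ?B = "{i \<in> {1..n}. \<theta> i \<noteq> 0}"
  have AB: "{1..n} = ?A \<union> ?B" by auto
  have "(\<Sum>i=1..n. \<rho> (\<theta> i)) = (\<Sum>i \<in> ?A \<union> ?B. \<rho> (\<theta> i))" by (rule sum.cong[OF AB refl])
  also have "\<dots> = (\<Sum>i \<in> ?A. \<rho> (\<theta> i)) + (\<Sum>i \<in> ?B. \<rho> (\<theta> i))" by (intro sum.union_disjoint) auto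
  also have "(\<Sum>i \<in> ?A. \<rho> (\<theta> i)) = (\<Sum>i \<in> ?A. \<rho> 0)" by (intro sum.cong) auto
  finally have "(\<Sum>i=1..n. \<rho> (\<theta> i)) / D = (\<Sum>i \<in> ?A. \<rho> 0) / D + (\<Sum>i \<in> ?B. \<rho> (\<theta> i)) / D"
    by (simp only: add_divide_distrib_ennreal)
  also have "\<dots> \<le> ennreal y + ennreal z"
    unfolding D_def
  proof (intro add_mono nonzero_part_le[OF \<theta> m L r] ennreal_divide_le)
    have "(\<Sum>i \<in> ?A. \<rho> 0) \<le> ennreal (real m * L * y)" by (rule zero_part_sum_le[OF n m L Z])
    also have "\<dots> \<le> ennreal (2 * real m * L * y)" using L yz by (intro ennreal_leI) simp
    finally show "(\<Sum>i \<in> ?A. \<rho> 0) \<le> ennreal (2 * real m * L * y)" .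
  qed (use m L in simp)
  finally show ?thesis using yz by (simp add: D_def)
qed

text \<open>With \<open>L n = ln (n / q n)\<close>, the rates above give the first claim directly, and the others up to a fixed small \<open>h\<close>, which
then tends to \<open>0\<close>.\<close>

theorem theorem4:
  fixes S :: "real^'k^'k" and d :: real and q :: "nat \<Rightarrow> nat" and c :: "nat \<Rightarrow> real"
  assumes "0 < d" and "d < 1"
    and "pos_def S"
    and "0 < lambda_min S" and "lambda_min S \<le> lambda_max S"
    and "\<And>n. n \<ge> 1 \<Longrightarrow> q n > 0"
    and "(\<lambda>n. real (q n)) \<in> o(\<lambda>n. real n)"
    and "\<And>n. n \<ge> 1 \<Longrightarrow> c n > 0"
    and "c \<longlonglongrightarrow> 0"
    and "\<forall>\<^sub>F n in sequentially.
           c n = (real (q n) / real n) powr ((1 + 1 / ln (ln (real n / real (q n)))) / d)"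
  shows
    "((\<lambda>n. SUP \<theta> \<in> (nearly_black n (q n) :: (nat \<Rightarrow> real^'k) set).
        (\<Sum>i \<in> {i \<in> {1..n}. \<theta> i = 0}.
           \<integral>\<^sup>+x. ennreal (mahal_sq S (EIG_estimator S d (c n) x)) \<partial>mvn 0 S)
        / ennreal (real (q n) * ln (real n / real (q n)))) \<longlonglongrightarrow> 0)
     \<and> limsup (\<lambda>n. SUP \<theta> \<in> (nearly_black n (q n) :: (nat \<Rightarrow> real^'k) set).
        (\<Sum>i \<in> {i \<in> {1..n}. \<theta> i \<noteq> 0}. EIG_risk S d (c n) (\<theta> i))
        / ennreal (2 * real (q n) * ln (real n / real (q n)))) \<le> 1
     \<and> ((\<lambda>n. SUP \<theta> \<in> (nearly_black n (q n) :: (nat \<Rightarrow> real^'k) set).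
        (\<Sum>i=1..n. EIG_risk S d (c n) (\<theta> i))
        / ennreal (2 * real (q n) * ln (real n / real (q n)))) \<longlonglongrightarrow> 1)"
proof -
  note d = assms(1,2) and S = assms(3)
  define L where "L n = ln (real n / real (q n))" for n
  define N where "N = (nearly_black :: nat \<Rightarrow> nat \<Rightarrow> (nat \<Rightarrow> real^'k) set)"
  have L_top: "filterlim L at_top sequentially"
  proof -
    have "(\<lambda>n. real (q n) / real n) \<longlonglongrightarrow> 0" using assms(7) by (rule smalloD_tendsto)
    moreover have "\<forall>\<^sub>F n in sequentially. 0 < real (q n) / real n"
      using eventually_ge_at_top[of 1] by eventually_elim (simp add: assms(6))
    ultimately have "filterlim (\<lambda>n. inverse (real (q n) / real n)) at_top sequentially"
      by (rule filterlim_inverse_at_top)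
    then have "filterlim (\<lambda>n. real n / real (q n)) at_top sequentially" by (simp add: inverse_eq_divide)
    then show ?thesis unfolding L_def by (rule filterlim_compose[OF ln_at_top])
  qed
  have regular: "\<forall>\<^sub>F n in sequentially. 1 \<le> L n \<and> 0 < q n \<and> q n \<le> n \<and> real n = real (q n) * exp (L n)
      \<and> 0 < c n \<and> c n \<le> 1 \<and> c n powr d = exp (- (L n + L n / ln (L n)))"
  proof -
    have "\<forall>\<^sub>F n in sequentially. c n < 1" using assms(9) by (intro order_tendstoD) auto
    moreover have "\<forall>\<^sub>F n in sequentially. 1 \<le> L n" using L_top by (simp add: filterlim_at_top)
    ultimately show ?thesis using assms(10) eventually_ge_at_top[of 1]
    proof eventually_elim
      case (elim n)
      have qn: "0 < q n" "0 < real n / real (q n)" using assms(6)[of n] elim by auto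
      have e: "exp (L n) = real n / real (q n)" using qn by (simp add: L_def)
      have "1 \<le> exp (L n)" using elim by simp
      then have le: "q n \<le> n" using qn unfolding e by simp
      have "c n powr d = (real (q n) / real n) powr (1 + 1 / ln (L n))"
        using d unfolding elim(3) L_def[symmetric] by (simp add: powr_powr)
      also have "real (q n) / real n = exp (- L n)" using qn by (simp add: exp_minus e)
      also have "exp (- L n) powr (1 + 1 / ln (L n)) = exp (- (L n + L n / ln (L n)))"
        by (simp add: powr_def algebra_simps)
      finally have "c n powr d = exp (- (L n + L n / ln (L n)))" .
      then show ?case using elim qn le e assms(8)[of n] by simp
    qed
  qed
  obtain z where z: "(z \<longlongrightarrow> 0) at_top" "\<And>L. 1 \<le> L \<Longrightarrow> 0 \<le> z L"
    "\<And>L c. 1 \<le> L \<Longrightarrow> 0 < c \<Longrightarrow> c \<le> 1 \<Longrightarrow> c powr d = exp (- (L + L / ln L)) \<Longrightarrow>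
      ennreal (exp L) * (\<integral>\<^sup>+x. ennreal (mahal_sq S (EIG_estimator S d c x)) \<partial>mvn 0 S) \<le> ennreal (L * z L)"
    using EIG_zero_risk_rate[OF S d] by metis
  have zL: "(\<lambda>n. z (L n)) \<longlonglongrightarrow> 0" by (rule filterlim_compose[OF z(1) L_top])
  have risk0: "EIG_risk S d c 0 = (\<integral>\<^sup>+x. ennreal (mahal_sq S (EIG_estimator S d c x)) \<partial>mvn 0 S)" for c
    by (simp add: EIG_risk_def)
  define f1 where "f1 n = (SUP \<theta> \<in> N n (q n). (\<Sum>i \<in> {i \<in> {1..n}. \<theta> i = 0}.
      \<integral>\<^sup>+x. ennreal (mahal_sq S (EIG_estimator S d (c n) x)) \<partial>mvn 0 S) / ennreal (real (q n) * L n))" for n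
  define f2 where "f2 n = (SUP \<theta> \<in> N n (q n). (\<Sum>i \<in> {i \<in> {1..n}. \<theta> i \<noteq> 0}. EIG_risk S d (c n) (\<theta> i))
      / ennreal (2 * real (q n) * L n))" for n
  define f3 where "f3 n = (SUP \<theta> \<in> N n (q n). (\<Sum>i=1..n. EIG_risk S d (c n) (\<theta> i))
      / ennreal (2 * real (q n) * L n))" for n
  have lim1: "f1 \<longlonglongrightarrow> 0"
  proof (rule tendsto_sandwich[where f = "\<lambda>_. 0" and h = "\<lambda>n. ennreal (z (L n))"])
    show "\<forall>\<^sub>F n in sequentially. f1 n \<le> ennreal (z (L n))"
      using regular
    proof eventually_elim
      case (elim n)
      show ?case unfolding f1_def using elim by (intro SUP_least ennreal_divide_le zero_part_sum_le z(3)) auto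
    qed
    show "(\<lambda>n. ennreal (z (L n))) \<longlonglongrightarrow> 0" using tendsto_ennrealI[OF zL] by simp
  qed auto
  have risk_le: "\<forall>\<^sub>F n in sequentially. \<forall>\<eta>. EIG_risk S d (c n) \<eta> \<le> ennreal (2 * L n * (1 + 4 * h))"
    if "0 < h" "h < 1" for h
    using regular eventually_compose_filterlim[OF EIG_nonzero_risk_rate[OF S d(1) that] L_top]
    by eventually_elim auto
  have lim2: "limsup f2 \<le> 1"
  proof (rule ennreal_le_epsilon)
    fix e :: real assume e: "0 < e"
    define h where "h = min (e / 4) (1 / 2)"
    have h: "0 < h" "h < 1" "4 * h \<le> e" using e by (auto simp: h_def)
    have "\<forall>\<^sub>F n in sequentially. f2 n \<le> ennreal (1 + 4 * h)"
      using regular risk_le[OF h(1,2)]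
    proof eventually_elim
      case (elim n)
      show ?case unfolding f2_def N_def using elim by (intro SUP_least nonzero_part_le) auto
    qed
    then have "limsup f2 \<le> ennreal (1 + 4 * h)" by (rule Limsup_bounded)
    also have "\<dots> \<le> ennreal (1 + e)" using h by (intro ennreal_leI) simp
    also have "\<dots> = 1 + ennreal e" using e by (simp add: ennreal_plus)
    finally show "limsup f2 \<le> 1 + ennreal e" .
  qed
  have sup3: "limsup f3 \<le> 1"
  proof (rule ennreal_le_epsilon)
    fix e :: real assume e: "0 < e"
    define h where "h = min (e / 5) (1 / 2)"
    have h: "0 < h" "h < 1" "5 * h \<le> e" using e by (auto simp: h_def)
    have "\<forall>\<^sub>F n in sequentially. z (L n) < h" using zL h by (intro order_tendstoD) auto
    then have "\<forall>\<^sub>F n in sequentially. f3 n \<le> ennreal (1 + 5 * h)"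
      using regular risk_le[OF h(1,2)]
    proof eventually_elim
      case (elim n)
      have "f3 n \<le> ennreal (z (L n) + (1 + 4 * h))"
        unfolding f3_def N_def using elim h z(2)[of "L n"] z(3)[of "L n" "c n", folded risk0]
        by (intro SUP_least total_le) auto
      also have "\<dots> \<le> ennreal (1 + 5 * h)" using elim by (intro ennreal_leI) simp
      finally show ?case .
    qed
    then have "limsup f3 \<le> ennreal (1 + 5 * h)" by (rule Limsup_bounded)
    also have "\<dots> \<le> ennreal (1 + e)" using h by (intro ennreal_leI) simp
    also have "\<dots> = 1 + ennreal e" using e by (simp add: ennreal_plus)
    finally show "limsup f3 \<le> 1 + ennreal e" .
  qed
  have inf3: "1 \<le> liminf f3"
  proof (rule ennreal_le_epsilon)
    fix e :: real assume e: "0 < e"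
    define h where "h = min (e / 4) (1 / 4)"
    have h: "0 < h" "h < 1" "4 * h \<le> e" "4 * h \<le> 1" using e by (auto simp: h_def)
    have "\<forall>\<^sub>F n in sequentially. ennreal (1 - 4 * h) \<le> f3 n"
      using regular eventually_compose_filterlim[OF EIG_worst_risk_rate[OF S d h(1,2)] L_top]
    proof eventually_elim
      case (elim n)
      then obtain \<eta> :: "real^'k" where "\<eta> \<noteq> 0" "ennreal (2 * L n * (1 - 4 * h)) \<le> EIG_risk S d (c n) \<eta>" by blast
      then show ?case unfolding f3_def N_def using elim by (intro total_ge) auto
    qed
    then have le: "ennreal (1 - 4 * h) \<le> liminf f3" by (rule Liminf_bounded)
    have "1 = ennreal (1 - 4 * h) + ennreal (4 * h)" using h by (subst ennreal_plus[symmetric]) auto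
    also have "\<dots> \<le> liminf f3 + ennreal e" using h by (intro add_mono le ennreal_leI) auto
    finally show "1 \<le> liminf f3 + ennreal e" .
  qed
  have "liminf f3 \<le> limsup f3" by (rule Liminf_le_Limsup) simp
  with inf3 sup3 have "liminf f3 = 1 \<and> limsup f3 = 1" by (meson antisym order_trans)
  then have "f3 \<longlonglongrightarrow> 1" by (simp add: tendsto_iff_Liminf_eq_Limsup)
  with lim1 lim2 show ?thesis
    unfolding f1_def f2_def f3_def N_def L_def by blast
qed

end
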